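(* Let $(V,\mathcal F,\mu)$ be a $\sigma$-finite measure space, $K$ a $(1,\infty)$-bounded kernel on $V$, $d\in L^\infty(V)$, and let $S\subseteq V$ be a structural set of type A quasi-B for $K$. Let $\mathscr A=\mathscr A_{d,K}$, let $\mathscr R_S(\lambda)=\mathscr R_{S,d,K}(\lambda)$ be the reduced operators and $\Phi_S(\lambda)$ the limit reconstruction operators, $\lambda\in\mathbb C\setminus\Sigma_d$. Then: (1) $\operatorname{sp}(\mathscr A)\setminus\Sigma_d\subseteq\operatorname{sp}(\mathscr R_S)$. (2) Given $\lambda_0\in\mathbb C\setminus\Sigma_d$, $\lambda_0$ is an eigenvalue of $\mathscr A$ if and only if $\lambda_0$ is an eigenvalue of $\mathscr R_S(\lambda_0)$. (3) If $\lambda_0\in\mathbb C\setminus\Sigma_d$ is an eigenvalue of $\mathscr A$ and $u\in L^1(V)$ is an associated eigenfunction, $\mathscr Au=\lambda_0u$, then $\mathscr R_S(\lambda_0)u_S=\lambda_0u_S$, i.e. $u_S$ is the corresponding eigenfunction for $\mathscr R_S(\lambda_0)$, where $u_S$ is the restriction of $u$ to $S$. (4) If $\lambda_0\in\mathbb C\setminus\Sigma_d$ is an eigenvalue of $\mathscr R_S(\lambda_0)$ and $v\in L^1(S)$ is an associated eigenfunction, $\mathscr R_S(\lambda_0)v=\lambda_0v$, then $u=\Phi_S(\lambda_0)(v)$ is an eigenfunction of $\mathscr A$, i.e. $\mathscr Au=\lambda_0u$.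
   Context: Function spaces: $L^1(V)=L^1(V,\mu)$ is the space of complex $\mu$-integrable functions with norm $\|f\|_1=\int_V|f|\,d\mu$; $L^\infty(V)$ is the space of bounded complex $\mathcal F$-measurable functions with the sup norm; $L^{1,\infty}(V\times V,\mu)$ is the space of measurable $f:V\times V\to\mathbb C$ with $\|f\|_{1,\infty}:=\sup_{y\in V}\int_V|f(x,y)|\,\mu(dx)<\infty$. Kernels: a kernel on $V$ is a function $K:V\times\mathcal F\to\mathbb C$ such that $B\mapsto K(x,B)$ is a complex measure $K_x$ for each $x\in V$, and $x\mapsto K(x,B)$ is $\mathcal F$-measurable for each $B\in\mathcal F$. $|K|(x,B)$ is the total variation of $K_x$ on $B$. $K$ is $(1,\infty)$-bounded if there is $h\in L^{1,\infty}(V\times V,\mu)$ with $K(x,B)=\int_Bh(x,y)\,\mu(dy)$ for all $x\in V,B\in\mathcal F$; $h$ is denoted $dK/d\mu$ and $\|K\|:=\|h\|_{1,\infty}$. Operator: $\mathscr A_{d,K}:L^1(V)\to L^1(V)$, $(\mathscr A_{d,K}f)(x)=d(x)f(x)+\int_Vf(y)\,K(x,dy)$, a bounded operator; $\operatorname{sp}$ denotes the spectrum. Reduced operators: $S\subseteq V$ is measurable, $S^c=V\setminus S$, $\Sigma_d=\overline{d(V\setminus S)}$ (closure in $\mathbb C$), $\mathcal F_S=\{S\cap B:B\in\mathcal F\}$, $L^1(S)=L^1(S,\mu|_S)$. For $\lambda\in\mathbb C\setminus\Sigma_d$, $x\in S$, $B\in\mathcal F_S$ put $K^{(1)}_{S,\lambda}(x,B)=K(x,B)$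 and, for $n\ge2$, $$K^{(n)}_{S,\lambda}(x,B)=\int_{S^c}\cdots\int_{S^c}\frac{K(x,dz_1)K(z_1,dz_2)\cdots K(z_{n-1},B)}{\prod_{p=1}^{n-1}(\lambda-d(z_p))},$$ $R_{S,\lambda}(x,B)=\sum_{n\ge1}K^{(n)}_{S,\lambda}(x,B)$, and $\mathscr R_{S,d,K}(\lambda):L^1(S)\to L^1(S)$, $(\mathscr R_{S,d,K}(\lambda)f)(x)=d(x)f(x)+\int_Sf(y)\,R_{S,\lambda}(x,dy)$ (the paper shows these are well-defined bounded operators for structural sets of type A or B). $\operatorname{sp}(\mathscr R_S)$ is the set of $\lambda\in\mathbb C\setminus\Sigma_d$ such that $\mathscr R_S(\lambda)-\lambda I$ is not invertible on $L^1(S)$. Type A: for $n\ge2$, $x\in V$, $B\in\mathcal F$ let $\tau_{S,n}(x,B):=\int_{S^c}\cdots\int_{S^c}K(x,dz_1)K(z_1,dz_2)\cdots K(z_{n-1},B)$. A nonempty $S\subseteq V$ is a structural set of type A for $K$ if there exist a sequence $t_n>0$ with $\lim_{n\to\infty}\frac1n\log t_n=-\infty$ and a non-negative $M\in L^{1,\infty}(V\times V,\mu)$ such that $|\tau_{S,n}(x,B)|\le t_n\int_BM(x,y)\,\mu(dy)$ for all $x\in V$, $B\in\mathcal F$, $n\ge2$. Type B: a nonempty $S\subseteq V$ is a structural set of type B for $K$ if there is a measurable $M:S^c\to[0,+\infty)$ such that, with $\varphi_{S^c}(x):=S^c\cap\operatorname{supp}(K_x)$ for $x\in S^c$, where $\operatorname{supp}(K_x)=\{y\in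 V:(dK/d\mu)(x,y)\ne0\}$, and iterates $\varphi_{S^c}^0(x)=\{x\}$, $\varphi_{S^c}^n(x)=\bigcup\{\varphi_{S^c}(y):y\in\varphi_{S^c}^{n-1}(x)\}$: (1) for all $x\in S^c$ there is $n\in\mathbb N$ with $\varphi_{S^c}^n(x)=\emptyset$; (2) $|K(x,B)|\le M(x)\mu(B)$ for all $x\in S^c$, $B\in\mathcal F$, $B\subseteq S^c$; (3) with $n_S(x):=\min\{k\in\mathbb N:\varphi_{S^c}^k(x)=\emptyset\}$, $\int_{S^c}n_S(x)M(x)\,\mu(dx)<\infty$. Type A quasi-B: a nonempty $S\subseteq V$ is a structural set of type A quasi-B for $K$ if there is a sequence of $(1,\infty)$-bounded kernels $K_n$, $n\in\mathbb N$, such that $S$ is a structural set of type A for $K$, $\lim_{n\to\infty}\|K-K_n\|=0$, and $S$ is a structural set of type B for every $K_n$. Reconstruction operators: if $S$ is of type B for a kernel $L$, let $S_0=S$, $S_m=\{x\in V:|L|(x,V\setminus S_{m-1})=0\}\cup S_{m-1}$; for $\lambda\in\mathbb C\setminus\Sigma_d$ and $v\in L^1(S)$, $\Phi_{S,d,L}(\lambda)(v)\in L^1(V)$ is the function $u$ given recursively by $u=v$ on $S$ and $u(z)=\frac1{\lambda-d(z)}\int_{S_{m-1}}u(y)\,L(z,dy)$ for $z\in S_m\setminus S_{m-1}$, $m\ge1$. For $S$ of type A quasi-B for $K$ with approximating kernels $K_n$, the limit reconstruction operator is $\Phi_S(\lambda)(v):=\lim_{n\to\infty}\Phi_{S,d,K_n}(\lambda)(v)$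 in $L^1(V)$ (the paper shows that this limit exists). *)

theory Defs
  imports "HOL-Analysis.Analysis"
begin

section \<open>The space \<open>L\<^sup>1\<close>, bounded operators on it, spectrum and eigenvalues\<close>

text \<open>Elements of \<open>L\<^sup>1(N)\<close> are represented by integrable functions; equality in \<open>L\<^sup>1(N)\<close> is
  equality almost everywhere. Operators act on representatives.\<close>

definition L1 :: "'a measure \<Rightarrow> ('a \<Rightarrow> complex) set" where
  "L1 N = {f. integrable N f}"

definition norm_L1 :: "'a measure \<Rightarrow> ('a \<Rightarrow> complex) \<Rightarrow> real" where
  "norm_L1 N f = (\<integral>x. cmod (f x) \<partial>N)"

definition bounded_operator_L1 ::
  "'a measure \<Rightarrow> (('a \<Rightarrow> complex) \<Rightarrow> ('a \<Rightarrow> complex)) \<Rightarrow> bool" where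
  "bounded_operator_L1 N T \<longleftrightarrow>
     (\<forall>f\<in>L1 N. T f \<in> L1 N) \<and>
     (\<forall>f\<in>L1 N. \<forall>g\<in>L1 N. AE x in N. T (\<lambda>y. f y + g y) x = T f x + T g x) \<and>
     (\<forall>c. \<forall>f\<in>L1 N. AE x in N. T (\<lambda>y. c * f y) x = c * T f x) \<and>
     (\<exists>C. \<forall>f\<in>L1 N. norm_L1 N (T f) \<le> C * norm_L1 N f)"

text \<open>Compatibility with a.e. equality follows from linearity and boundedness.
  The inverse \<open>G\<close> is characterised by \<open>T f = g \<longleftrightarrow> G g = f\<close> in \<open>L\<^sup>1(N)\<close>, that is,
  \<open>G T = I\<close> and \<open>T G = I\<close>. It is written in this form since \<open>T f\<close> may be
  specified only almost everywhere, so that the function \<open>T f\<close> itself need be neither measurable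
  nor a legitimate argument of \<open>G\<close> when \<open>N\<close> is not complete.\<close>

definition invertible_L1 ::
  "'a measure \<Rightarrow> (('a \<Rightarrow> complex) \<Rightarrow> ('a \<Rightarrow> complex)) \<Rightarrow> bool" where
  "invertible_L1 N T \<longleftrightarrow>
     (\<exists>G. bounded_operator_L1 N G \<and>
       (\<forall>f\<in>L1 N. \<forall>g\<in>L1 N. (AE x in N. T f x = g x) \<longleftrightarrow> (AE x in N. G g x = f x)))"

definition spectrum_L1 ::
  "'a measure \<Rightarrow> (('a \<Rightarrow> complex) \<Rightarrow> ('a \<Rightarrow> complex)) \<Rightarrow> complex set" where
  "spectrum_L1 N T = {\<zeta>. \<not> invertible_L1 N (\<lambda>f x. T f x - \<zeta> * f x)}"

definition eigenfunction_L1 ::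
  "'a measure \<Rightarrow> (('a \<Rightarrow> complex) \<Rightarrow> ('a \<Rightarrow> complex)) \<Rightarrow> complex \<Rightarrow> ('a \<Rightarrow> complex) \<Rightarrow> bool" where
  "eigenfunction_L1 N T \<zeta> u \<longleftrightarrow>
     u \<in> L1 N \<and> \<not> (AE x in N. u x = 0) \<and> (AE x in N. T u x = \<zeta> * u x)"

definition eigenvalue_L1 ::
  "'a measure \<Rightarrow> (('a \<Rightarrow> complex) \<Rightarrow> ('a \<Rightarrow> complex)) \<Rightarrow> complex \<Rightarrow> bool" where
  "eigenvalue_L1 N T \<zeta> \<longleftrightarrow> (\<exists>u. eigenfunction_L1 N T \<zeta> u)"

definition Linf :: "'a measure \<Rightarrow> ('a \<Rightarrow> complex) set" where
  "Linf N = {f \<in> borel_measurable N. bounded (f ` space N)}"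

section \<open>Complex measures and kernels\<close>

definition complex_measure :: "'a measure \<Rightarrow> ('a set \<Rightarrow> complex) \<Rightarrow> bool" where
  "complex_measure N \<nu> \<longleftrightarrow>
     (\<forall>A :: nat \<Rightarrow> 'a set. range A \<subseteq> sets N \<longrightarrow> disjoint_family A \<longrightarrow>
        (\<lambda>i. \<nu> (A i)) sums \<nu> (\<Union>i. A i))"

definition total_variation :: "'a measure \<Rightarrow> ('a set \<Rightarrow> complex) \<Rightarrow> 'a set \<Rightarrow> ennreal" where
  "total_variation N \<nu> B =
     (SUP A \<in> {A :: nat \<Rightarrow> 'a set. range A \<subseteq> sets N \<and> disjoint_family A \<and> (\<Union>i. A i) = B}.
        \<Sum>i. ennreal (cmod (\<nu> (A i))))"

text \<open>The set function \<open>\<nu>\<close> has density \<open>g\<close> with respect to \<open>N\<close> on an exhausting sequence of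
  measurable sets. For a complex measure \<open>\<nu>(B) = \<integral>\<^sub>B g dN\<close> the constant sequence
  \<open>W j = space N\<close> does, and \<open>g\<close> is the usual Radon-Nikodym derivative. The local form is needed
  for the reduced kernels: for given \<open>x\<close> the density of \<open>R(x,\<cdot>)\<close> need not be integrable over all
  of \<open>S\<close>, although it gives a bounded operator on \<open>L\<^sup>1(S)\<close>. For \<open>\<sigma>\<close>-finite \<open>N\<close> the
  density is unique a.e. (\<open>has_density_unique\<close> below).\<close>

definition has_density :: "'a measure \<Rightarrow> ('a set \<Rightarrow> complex) \<Rightarrow> ('a \<Rightarrow> complex) \<Rightarrow> bool" where
  "has_density N \<nu> g \<longleftrightarrow>
     (\<exists>W :: nat \<Rightarrow> 'a set. range W \<subseteq> sets N \<and> incseq W \<and> (\<Union>j. W j) = space N \<and>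
        (\<forall>j. \<forall>B\<in>sets N. B \<subseteq> W j \<longrightarrow>
           set_integrable N B g \<and> \<nu> B = (LINT y:B|N. g y)))"

text \<open>\<open>\<integral>\<^sub>A f d\<nu>\<close> for \<open>\<nu>\<close> absolutely continuous with respect to \<open>N\<close>, namely
  \<open>\<integral>\<^sub>A f (d\<nu>/dN) dN\<close>.\<close>

definition cm_integral ::
  "'a measure \<Rightarrow> ('a set \<Rightarrow> complex) \<Rightarrow> 'a set \<Rightarrow> ('a \<Rightarrow> complex) \<Rightarrow> complex" where
  "cm_integral N \<nu> A f = (LINT y:A|N. f y * (SOME g. has_density N \<nu> g) y)"

lemma has_densityE:
  assumes "has_density N \<nu> g"
  obtains W :: "nat \<Rightarrow> 'a set" where "\<forall>j. W j \<in> sets N" "(\<Union>j. W j) = space N"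
    "\<forall>j. \<forall>B\<in>sets N. B \<subseteq> W j \<longrightarrow> set_integrable N B g \<and> \<nu> B = (LINT y:B|N. g y)"
proof -
  obtain W :: "nat \<Rightarrow> 'a set" where
    W: "range W \<subseteq> sets N \<and> incseq W \<and> (\<Union>j. W j) = space N \<and>
        (\<forall>j. \<forall>B\<in>sets N. B \<subseteq> W j \<longrightarrow> set_integrable N B g \<and> \<nu> B = (LINT y:B|N. g y))"
    using assms unfolding has_density_def ..
  show thesis
    by (rule that[of W]) (use W in \<open>simp_all add: image_subset_iff\<close>)
qed

lemma has_density_measurable:
  assumes "has_density N \<nu> g"
  shows "g \<in> borel_measurable N"
proof -
  from assms obtain W :: "nat \<Rightarrow> 'a set" where W: "\<forall>j. W j \<in> sets N" "(\<Union>j. W j) = space N"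
    "\<forall>j. \<forall>B\<in>sets N. B \<subseteq> W j \<longrightarrow> set_integrable N B g \<and> \<nu> B = (LINT y:B|N. g y)"
    by (rule has_densityE)
  have "g \<in> borel_measurable (restrict_space N (W j))" for j
  proof -
    have *: "W j \<in> sets N" using W(1) by simp
    then have "(\<lambda>x. indicator (W j) x *\<^sub>R g x) \<in> borel_measurable N"
      using W(3) unfolding set_integrable_def by (metis borel_measurable_integrable order_refl)
    then show ?thesis
      using * by (subst borel_measurable_restrict_space_iff) auto
  qed
  then have r: "g \<in> borel_measurable (restrict_space N \<Omega>)" if "\<Omega> \<in> range W" for \<Omega>
    using that by (elim imageE) simp
  show ?thesis
  proof (rule measurable_piecewise_restrict[of "range W"])
    show "countable (range W)" by simp
    show "\<Omega> \<inter> space N \<in> sets N" if "\<Omega> \<in> range W" for \<Omega>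
      using W(1) that by (elim imageE) simp
    show "space N \<subseteq> \<Union> (range W)" using W(2) by simp
  qed (rule r)
qed

lemma has_density_unique:
  assumes "has_density N \<nu> g" "has_density N \<nu> g'" "sigma_finite_measure N"
  shows "AE x in N. g x = g' x"
proof -
  have meas: "g \<in> borel_measurable N" "g' \<in> borel_measurable N"
    using assms(1,2) by (auto intro: has_density_measurable)
  from assms(1) obtain W :: "nat \<Rightarrow> 'a set" where
    W: "\<forall>j. W j \<in> sets N" "(\<Union>j. W j) = space N"
    "\<forall>j. \<forall>B\<in>sets N. B \<subseteq> W j \<longrightarrow> set_integrable N B g \<and> \<nu> B = (LINT y:B|N. g y)"
    by (rule has_densityE)
  from assms(2) obtain W' :: "nat \<Rightarrow> 'a set" where
    W': "\<forall>j. W' j \<in> sets N" "(\<Union>j. W' j) = space N"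
    "\<forall>j. \<forall>B\<in>sets N. B \<subseteq> W' j \<longrightarrow> set_integrable N B g' \<and> \<nu> B = (LINT y:B|N. g' y)"
    by (rule has_densityE)
  have "AE x in N. x \<in> W i \<inter> W' j \<longrightarrow> g x = g' x" for i j
  proof -
    let ?U = "W i \<inter> W' j"
    have U: "?U \<in> sets N" using W(1) W'(1) by (simp add: sets.Int)
    have "AE x in N. indicator ?U x *\<^sub>R g x = indicator ?U x *\<^sub>R g' x"
    proof (rule sigma_finite_measure.density_unique_banach[OF assms(3)])
      show "integrable N (\<lambda>x. indicator ?U x *\<^sub>R g x)"
        using W(3) U unfolding set_integrable_def by (metis inf_le1)
      show "integrable N (\<lambda>x. indicator ?U x *\<^sub>R g' x)"
        using W'(3) U unfolding set_integrable_def by (metis inf_le2)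
      fix A assume A: "A \<in> sets N"
      have AU: "A \<inter> ?U \<in> sets N" "A \<inter> ?U \<subseteq> W i" "A \<inter> ?U \<subseteq> W' j"
        using A U by (simp_all add: sets.Int le_infI2)
      have "(LINT x:A|N. indicator ?U x *\<^sub>R g x) = (LINT x:A \<inter> ?U|N. g x)"
        unfolding set_lebesgue_integral_def by (simp only: scaleR_scaleR indicator_inter_arith)
      also have "\<dots> = \<nu> (A \<inter> ?U)" using W(3)[rule_format, OF AU(1,2)] by simp
      also have "\<dots> = (LINT x:A \<inter> ?U|N. g' x)" using W'(3)[rule_format, OF AU(1,3)] by simp
      also have "\<dots> = (LINT x:A|N. indicator ?U x *\<^sub>R g' x)"
        unfolding set_lebesgue_integral_def by (simp only: scaleR_scaleR indicator_inter_arith)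
      finally show "(LINT x:A|N. indicator ?U x *\<^sub>R g x) = (LINT x:A|N. indicator ?U x *\<^sub>R g' x)" .
    qed
    then show ?thesis by eventually_elim (auto simp: indicator_def)
  qed
  then have "AE x in N. \<forall>i j. x \<in> W i \<inter> W' j \<longrightarrow> g x = g' x"
    unfolding AE_all_countable by blast
  moreover have "AE x in N. x \<in> space N" by simp
  ultimately show ?thesis
  proof eventually_elim
    case (elim x)
    then obtain i j where "x \<in> W i" "x \<in> W' j" using W(2) W'(2) by (metis UN_E)
    with elim show ?case by blast
  qed
qed

lemma cm_integral_eq:
  assumes "has_density N \<nu> g" "A \<in> sets N" "f \<in> borel_measurable N" "sigma_finite_measure N"
  shows "cm_integral N \<nu> A f = (LINT y:A|N. f y * g y)"
proof -
  let ?g = "SOME g. has_density N \<nu> g"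
  have s: "has_density N \<nu> ?g" using assms(1) by (rule someI[where P = "has_density N \<nu>"])
  have m: "?g \<in> borel_measurable N" "g \<in> borel_measurable N"
    using s assms(1) by (auto intro: has_density_measurable)
  have "AE x in N. ?g x = g x" using s assms(1,4) by (rule has_density_unique)
  then show ?thesis
    unfolding cm_integral_def set_lebesgue_integral_def
    using m assms(2,3) by (intro integral_cong_AE) auto
qed

definition is_kernel :: "'a measure \<Rightarrow> ('a \<Rightarrow> 'a set \<Rightarrow> complex) \<Rightarrow> bool" where
  "is_kernel \<mu> K \<longleftrightarrow>
     (\<forall>x\<in>space \<mu>. complex_measure \<mu> (K x)) \<and>
     (\<forall>B\<in>sets \<mu>. (\<lambda>x. K x B) \<in> borel_measurable \<mu>)"

definition norm_1inf :: "'a measure \<Rightarrow> ('a \<Rightarrow> 'a \<Rightarrow> complex) \<Rightarrow> ennreal" where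
  "norm_1inf \<mu> h = (SUP y\<in>space \<mu>. \<integral>\<^sup>+x. ennreal (cmod (h x y)) \<partial>\<mu>)"

definition L1inf :: "'a measure \<Rightarrow> ('a \<Rightarrow> 'a \<Rightarrow> complex) set" where
  "L1inf \<mu> = {h. (\<lambda>(x, y). h x y) \<in> borel_measurable (\<mu> \<Otimes>\<^sub>M \<mu>) \<and> norm_1inf \<mu> h < \<infinity>}"

text \<open>\<open>K\<close> is a \<open>(1,\<infinity>)\<close>-bounded kernel with \<open>dK/d\<mu> = h\<close>. For each \<open>x\<close> the density
  \<open>h x\<close> is determined only up to a null set, while the supports and the norm below (a genuine
  supremum over \<open>y\<close>) depend on the representative; therefore \<open>h\<close> is carried along explicitly.\<close>

definition kernel_1inf ::
  "'a measure \<Rightarrow> ('a \<Rightarrow> 'a set \<Rightarrow> complex) \<Rightarrow> ('a \<Rightarrow> 'a \<Rightarrow> complex) \<Rightarrow> bool" where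
  "kernel_1inf \<mu> K h \<longleftrightarrow>
     is_kernel \<mu> K \<and> h \<in> L1inf \<mu> \<and>
     (\<forall>x\<in>space \<mu>. integrable \<mu> (h x) \<and> (\<forall>B\<in>sets \<mu>. K x B = (LINT y:B|\<mu>. h x y)))"

lemma kernel_1inf_has_density:
  assumes "kernel_1inf \<mu> K h" "x \<in> space \<mu>"
  shows "has_density \<mu> (K x) (h x)"
  unfolding has_density_def
proof (rule exI[of _ "\<lambda>_. space \<mu>"], intro conjI allI ballI impI)
  fix B assume B: "B \<in> sets \<mu>"
  show "set_integrable \<mu> B (h x)"
    using assms B unfolding kernel_1inf_def set_integrable_def
    by (simp add: integrable_mult_indicator)
  show "K x B = (LINT y:B|\<mu>. h x y)"
    using assms B unfolding kernel_1inf_def by simp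
qed (simp_all add: incseq_def)

definition kernel_operator ::
  "'a measure \<Rightarrow> ('a \<Rightarrow> complex) \<Rightarrow> ('a \<Rightarrow> 'a set \<Rightarrow> complex) \<Rightarrow> ('a \<Rightarrow> complex) \<Rightarrow> 'a \<Rightarrow> complex" where
  "kernel_operator N d K f x = d x * f x + cm_integral N (K x) (space N) f"

section \<open>Reduced operators\<close>

definition Sigma_d :: "'a measure \<Rightarrow> ('a \<Rightarrow> complex) \<Rightarrow> 'a set \<Rightarrow> complex set" where
  "Sigma_d \<mu> d S = closure (d ` (space \<mu> - S))"

text \<open>\<open>chain_kernel \<mu> K S w k x B\<close> is the \<open>k\<close>-fold iterated integral over \<open>V - S\<close> of
  \<open>w z\<^sub>1 \<cdots> w z\<^sub>k\<close> against \<open>K(x,dz\<^sub>1) K(z\<^sub>1,dz\<^sub>2) \<cdots> K(z\<^sub>k,B)\<close>.\<close>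

primrec chain_kernel ::
  "'a measure \<Rightarrow> ('a \<Rightarrow> 'a set \<Rightarrow> complex) \<Rightarrow> 'a set \<Rightarrow> ('a \<Rightarrow> complex) \<Rightarrow> nat \<Rightarrow>
     'a \<Rightarrow> 'a set \<Rightarrow> complex" where
  "chain_kernel \<mu> K S w 0 = K"
| "chain_kernel \<mu> K S w (Suc k) =
     (\<lambda>x B. cm_integral \<mu> (K x) (space \<mu> - S) (\<lambda>z. w z * chain_kernel \<mu> K S w k z B))"

definition K_iter ::
  "'a measure \<Rightarrow> ('a \<Rightarrow> complex) \<Rightarrow> ('a \<Rightarrow> 'a set \<Rightarrow> complex) \<Rightarrow> 'a set \<Rightarrow> complex \<Rightarrow> nat \<Rightarrow>
     'a \<Rightarrow> 'a set \<Rightarrow> complex" where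
  "K_iter \<mu> d K S \<zeta> n = chain_kernel \<mu> K S (\<lambda>z. 1 / (\<zeta> - d z)) (n - 1)"

definition R_kernel ::
  "'a measure \<Rightarrow> ('a \<Rightarrow> complex) \<Rightarrow> ('a \<Rightarrow> 'a set \<Rightarrow> complex) \<Rightarrow> 'a set \<Rightarrow> complex \<Rightarrow>
     'a \<Rightarrow> 'a set \<Rightarrow> complex" where
  "R_kernel \<mu> d K S \<zeta> x B = (\<Sum>n. K_iter \<mu> d K S \<zeta> (Suc n) x B)"

definition reduced_operator ::
  "'a measure \<Rightarrow> ('a \<Rightarrow> complex) \<Rightarrow> ('a \<Rightarrow> 'a set \<Rightarrow> complex) \<Rightarrow> 'a set \<Rightarrow> complex \<Rightarrow>
     ('a \<Rightarrow> complex) \<Rightarrow> 'a \<Rightarrow> complex" where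
  "reduced_operator \<mu> d K S \<zeta> = kernel_operator (restrict_space \<mu> S) d (R_kernel \<mu> d K S \<zeta>)"

definition reduced_spectrum ::
  "'a measure \<Rightarrow> ('a \<Rightarrow> complex) \<Rightarrow> ('a \<Rightarrow> 'a set \<Rightarrow> complex) \<Rightarrow> 'a set \<Rightarrow> complex set" where
  "reduced_spectrum \<mu> d K S =
     {\<zeta>. \<zeta> \<notin> Sigma_d \<mu> d S \<and>
        \<not> invertible_L1 (restrict_space \<mu> S) (\<lambda>f x. reduced_operator \<mu> d K S \<zeta> f x - \<zeta> * f x)}"

section \<open>Structural sets\<close>

definition tau ::
  "'a measure \<Rightarrow> ('a \<Rightarrow> 'a set \<Rightarrow> complex) \<Rightarrow> 'a set \<Rightarrow> nat \<Rightarrow> 'a \<Rightarrow> 'a set \<Rightarrow> complex" where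
  "tau \<mu> K S n = chain_kernel \<mu> K S (\<lambda>_. 1) (n - 1)"

definition structural_A :: "'a measure \<Rightarrow> ('a \<Rightarrow> 'a set \<Rightarrow> complex) \<Rightarrow> 'a set \<Rightarrow> bool" where
  "structural_A \<mu> K S \<longleftrightarrow>
     S \<noteq> {} \<and> S \<subseteq> space \<mu> \<and>
     (\<exists>(t :: nat \<Rightarrow> real) (M :: 'a \<Rightarrow> 'a \<Rightarrow> real).
        (\<forall>n. t n > 0) \<and> filterlim (\<lambda>n. 1 / real n * ln (t n)) at_bot sequentially \<and>
        (\<forall>x\<in>space \<mu>. \<forall>y\<in>space \<mu>. M x y \<ge> 0) \<and> (\<lambda>x y. complex_of_real (M x y)) \<in> L1inf \<mu> \<and>
        (\<forall>x\<in>space \<mu>. \<forall>B\<in>sets \<mu>. \<forall>n\<ge>2.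
           ennreal (cmod (tau \<mu> K S n x B)) \<le> ennreal (t n) * (\<integral>\<^sup>+y\<in>B. ennreal (M x y) \<partial>\<mu>)))"

definition phi :: "'a measure \<Rightarrow> ('a \<Rightarrow> 'a \<Rightarrow> complex) \<Rightarrow> 'a set \<Rightarrow> 'a \<Rightarrow> 'a set" where
  "phi \<mu> h S x = (space \<mu> - S) \<inter> {y \<in> space \<mu>. h x y \<noteq> 0}"

primrec phi_iter :: "'a measure \<Rightarrow> ('a \<Rightarrow> 'a \<Rightarrow> complex) \<Rightarrow> 'a set \<Rightarrow> nat \<Rightarrow> 'a \<Rightarrow> 'a set" where
  "phi_iter \<mu> h S 0 x = {x}"
| "phi_iter \<mu> h S (Suc n) x = (\<Union>y\<in>phi_iter \<mu> h S n x. phi \<mu> h S y)"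

definition n_S :: "'a measure \<Rightarrow> ('a \<Rightarrow> 'a \<Rightarrow> complex) \<Rightarrow> 'a set \<Rightarrow> 'a \<Rightarrow> nat" where
  "n_S \<mu> h S x = (LEAST k. phi_iter \<mu> h S k x = {})"

definition structural_B ::
  "'a measure \<Rightarrow> ('a \<Rightarrow> 'a set \<Rightarrow> complex) \<Rightarrow> ('a \<Rightarrow> 'a \<Rightarrow> complex) \<Rightarrow> 'a set \<Rightarrow> bool" where
  "structural_B \<mu> K h S \<longleftrightarrow>
     S \<noteq> {} \<and> S \<subseteq> space \<mu> \<and>
     (\<exists>M :: 'a \<Rightarrow> real.
        M \<in> borel_measurable (restrict_space \<mu> (space \<mu> - S)) \<and> (\<forall>x\<in>space \<mu> - S. M x \<ge> 0) \<and>
        (\<forall>x\<in>space \<mu> - S. \<exists>n. phi_iter \<mu> h S n x = {}) \<and>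
        (\<forall>x\<in>space \<mu> - S. \<forall>B\<in>sets \<mu>. B \<subseteq> space \<mu> - S \<longrightarrow>
           ennreal (cmod (K x B)) \<le> ennreal (M x) * emeasure \<mu> B) \<and>
        (\<integral>\<^sup>+x\<in>space \<mu> - S. ennreal (real (n_S \<mu> h S x) * M x) \<partial>\<mu>) < \<infinity>)"

text \<open>\<open>K\<^sub>n\<close> with \<open>dK\<^sub>n/d\<mu> = h\<^sub>n\<close> is an approximating sequence for \<open>K\<close>; here
  \<open>d(K - K\<^sub>n)/d\<mu> = h - h\<^sub>n\<close>.\<close>

definition B_approximation ::
  "'a measure \<Rightarrow> ('a \<Rightarrow> 'a \<Rightarrow> complex) \<Rightarrow> 'a set \<Rightarrow>
     (nat \<Rightarrow> 'a \<Rightarrow> 'a set \<Rightarrow> complex) \<Rightarrow> (nat \<Rightarrow> 'a \<Rightarrow> 'a \<Rightarrow> complex) \<Rightarrow> bool" where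
  "B_approximation \<mu> h S Kn hn \<longleftrightarrow>
     (\<forall>n. kernel_1inf \<mu> (Kn n) (hn n)) \<and>
     (\<lambda>n. norm_1inf \<mu> (\<lambda>x y. h x y - hn n x y)) \<longlonglongrightarrow> 0 \<and>
     (\<forall>n. structural_B \<mu> (Kn n) (hn n) S)"

definition structural_A_quasi_B ::
  "'a measure \<Rightarrow> ('a \<Rightarrow> 'a set \<Rightarrow> complex) \<Rightarrow> ('a \<Rightarrow> 'a \<Rightarrow> complex) \<Rightarrow> 'a set \<Rightarrow> bool" where
  "structural_A_quasi_B \<mu> K h S \<longleftrightarrow>
     structural_A \<mu> K S \<and> (\<exists>Kn hn. B_approximation \<mu> h S Kn hn)"

section \<open>Reconstruction operators\<close>

primrec layer :: "'a measure \<Rightarrow> ('a \<Rightarrow> 'a set \<Rightarrow> complex) \<Rightarrow> 'a set \<Rightarrow> nat \<Rightarrow> 'a set" where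
  "layer \<mu> L S 0 = S"
| "layer \<mu> L S (Suc m) =
     {x \<in> space \<mu>. total_variation \<mu> (L x) (space \<mu> - layer \<mu> L S m) = 0} \<union> layer \<mu> L S m"

text \<open>Only the values of \<open>recon_stage \<dots> m\<close> on the \<open>m\<close>-th layer are meaningful.\<close>

primrec recon_stage ::
  "'a measure \<Rightarrow> ('a \<Rightarrow> complex) \<Rightarrow> ('a \<Rightarrow> 'a set \<Rightarrow> complex) \<Rightarrow> 'a set \<Rightarrow> complex \<Rightarrow>
     ('a \<Rightarrow> complex) \<Rightarrow> nat \<Rightarrow> 'a \<Rightarrow> complex" where
  "recon_stage \<mu> d L S \<zeta> v 0 = v"
| "recon_stage \<mu> d L S \<zeta> v (Suc m) =
     (\<lambda>z. if z \<in> layer \<mu> L S m then recon_stage \<mu> d L S \<zeta> v m z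
          else 1 / (\<zeta> - d z) * cm_integral \<mu> (L z) (layer \<mu> L S m) (recon_stage \<mu> d L S \<zeta> v m))"

definition reconstruction ::
  "'a measure \<Rightarrow> ('a \<Rightarrow> complex) \<Rightarrow> ('a \<Rightarrow> 'a set \<Rightarrow> complex) \<Rightarrow> 'a set \<Rightarrow> complex \<Rightarrow>
     ('a \<Rightarrow> complex) \<Rightarrow> 'a \<Rightarrow> complex" where
  "reconstruction \<mu> d L S \<zeta> v z = recon_stage \<mu> d L S \<zeta> v (LEAST m. z \<in> layer \<mu> L S m) z"

definition limit_reconstruction ::
  "'a measure \<Rightarrow> ('a \<Rightarrow> complex) \<Rightarrow> (nat \<Rightarrow> 'a \<Rightarrow> 'a set \<Rightarrow> complex) \<Rightarrow> 'a set \<Rightarrow> complex \<Rightarrow>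
     ('a \<Rightarrow> complex) \<Rightarrow> 'a \<Rightarrow> complex" where
  "limit_reconstruction \<mu> d Kn S \<zeta> v =
     (SOME u. u \<in> L1 \<mu> \<and> (\<forall>n. reconstruction \<mu> d (Kn n) S \<zeta> v \<in> L1 \<mu>) \<and>
        (\<lambda>n. norm_L1 \<mu> (\<lambda>x. reconstruction \<mu> d (Kn n) S \<zeta> v x - u x)) \<longlonglongrightarrow> 0)"

end

(* Let H be the operator with kernel h and q = 1/(zeta - d) off S, 0 on S. Everything reduces to the
   equation u = g + q H u in L^1. Approximation of h by type B kernels h_n makes q H a strict
   contraction in a weighted norm: a type B kernel only maps between levels S_m of increasing index,
   and the norm limit h is, up to a small error, dominated by a function D(x) in L^1, so a weight
   that decays exponentially along the D-mass of the levels works. Hence the kernel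
   r = h + h q h + h q h q h + ... converges in L^{1,oo}; it is the density of the reduced kernel, and
   u = g + q r g is the unique solution. The spectral statements are a Schur complement computation,
   and the reconstruction for h_n solves the same equation with h_n in place of h, so that
   convergence follows from the contraction. *)
theory Submission
  imports Defs
begin

section \<open>Integral operators\<close>

text \<open>The operator f -> q H f need not have norm below 1, and \<open>\<zeta>\<close> may be
  any point off the closure of d(V - S), so smallness must come from structure. For every
  \<open>\<rho>\<close> > 0 the weight lemma gives an equivalent L^1 norm in which H, compressed to
  functions on V - S, has norm at most \<open>\<rho>\<close>; this compression is thus
  quasinilpotent, and \<open>\<rho>\<close> is matched to the distance of \<open>\<zeta>\<close>
  from d(V - S). The type B conditions constrain only V - S, which is why the contraction is asked
  only in columns where q is nonzero. The second obstacle is that L^{1,oo} bounds columns (integrals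
  in x, for every y) and says nothing about a single row. Statements about H f (x) or the density of
  R(x,.) therefore hold for almost every x, and that density is only known to be integrable over
  suitable sets of finite measure. Majorants with values in \<open>ennreal\<close> settle these
  questions by Tonelli before complex integrals are exchanged. The weight is built for the limit
  kernel h itself. Each h_n is compared with h in that one norm, so the estimates are uniform in
  n.\<close>

definition int_op :: "'a measure \<Rightarrow> ('a \<Rightarrow> 'a \<Rightarrow> complex) \<Rightarrow> ('a \<Rightarrow> complex) \<Rightarrow> 'a \<Rightarrow> complex" where
  "int_op N k f x = (LINT y|N. f y * k x y)"

lemma L1infD:
  assumes "k \<in> L1inf N"
  shows "case_prod k \<in> borel_measurable (N \<Otimes>\<^sub>M N)"
    and "\<exists>C\<ge>0. \<forall>y\<in>space N. (\<integral>\<^sup>+x. ennreal (cmod (k x y)) \<partial>N) \<le> ennreal C"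
proof -
  show "case_prod k \<in> borel_measurable (N \<Otimes>\<^sub>M N)"
    using assms by (simp add: L1inf_def)
  have "norm_1inf N k < \<infinity>"
    using assms by (simp add: L1inf_def)
  then have "norm_1inf N k = ennreal (enn2real (norm_1inf N k))"
    by simp
  moreover have "(\<integral>\<^sup>+x. ennreal (cmod (k x y)) \<partial>N) \<le> norm_1inf N k" if "y \<in> space N" for y
    unfolding norm_1inf_def using that by (rule SUP_upper)
  ultimately show "\<exists>C\<ge>0. \<forall>y\<in>space N. (\<integral>\<^sup>+x. ennreal (cmod (k x y)) \<partial>N) \<le> ennreal C"
    by (metis enn2real_nonneg)
qed

lemma L1infI:
  assumes "case_prod k \<in> borel_measurable (N \<Otimes>\<^sub>M N)"
    and "\<And>y. y \<in> space N \<Longrightarrow> (\<integral>\<^sup>+x. ennreal (cmod (k x y)) \<partial>N) \<le> ennreal C"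
  shows "k \<in> L1inf N"
proof -
  have "norm_1inf N k \<le> ennreal C"
    unfolding norm_1inf_def using assms(2) by (rule SUP_least)
  then have "norm_1inf N k < \<infinity>"
    by (simp add: order_le_less_trans)
  then show ?thesis
    using assms(1) by (simp add: L1inf_def)
qed

lemma norm_L1_eq_nn:
  assumes "integrable N f"
  shows "ennreal (norm_L1 N f) = (\<integral>\<^sup>+x. ennreal (cmod (f x)) \<partial>N)"
  unfolding norm_L1_def using assms by (subst nn_integral_eq_integral) auto

lemma norm_L1_nonneg: "0 \<le> norm_L1 N f"
  by (simp add: norm_L1_def)

lemma norm_L1_add:
  assumes "integrable N f" "integrable N g"
  shows "norm_L1 N (\<lambda>x. f x + g x) \<le> norm_L1 N f + norm_L1 N g"
proof -
  have "norm_L1 N (\<lambda>x. f x + g x) \<le> (\<integral>x. cmod (f x) + cmod (g x) \<partial>N)"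
    unfolding norm_L1_def using assms by (intro integral_mono) (auto intro: norm_triangle_ineq)
  then show ?thesis
    using assms by (simp add: norm_L1_def)
qed

lemma norm_L1_eq_0:
  assumes "integrable N f" "norm_L1 N f = 0"
  shows "AE x in N. f x = 0"
  using assms AE_iff_measurable[OF _ refl, of N "\<lambda>x. f x = 0"] integral_norm_eq_0_iff[OF assms(1)]
  by (simp add: norm_L1_def)

section \<open>Tonelli and L^1 bounds for integral operators\<close>

context sigma_finite_measure
begin

lemma pair_sf: "pair_sigma_finite M M"
  by (simp add: pair_sigma_finite_def sigma_finite_measure_axioms)

text \<open>Tonelli, with both factors left in front of the inner integrals. In this form a weight
  in x moves onto the columns of the kernel, the only direction in which L^{1,oo} and the weighted
  contraction give information.\<close>

lemma nn_integral_swap: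
  fixes g p :: "'a \<Rightarrow> ennreal" and a :: "'a \<Rightarrow> 'a \<Rightarrow> ennreal"
  assumes [measurable]: "case_prod a \<in> borel_measurable (M \<Otimes>\<^sub>M M)"
    "g \<in> borel_measurable M" "p \<in> borel_measurable M"
  shows "(\<integral>\<^sup>+x. g x * (\<integral>\<^sup>+y. p y * a x y \<partial>M) \<partial>M) = (\<integral>\<^sup>+y. p y * (\<integral>\<^sup>+x. g x * a x y \<partial>M) \<partial>M)"
proof -
  interpret P: pair_sigma_finite M M by (rule pair_sf)
  have "(\<integral>\<^sup>+x. g x * (\<integral>\<^sup>+y. p y * a x y \<partial>M) \<partial>M) = (\<integral>\<^sup>+x. (\<integral>\<^sup>+y. g x * (p y * a x y) \<partial>M) \<partial>M)"
    by (intro nn_integral_cong nn_integral_cmult[symmetric]) measurable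
  also have "\<dots> = (\<integral>\<^sup>+y. (\<integral>\<^sup>+x. g x * (p y * a x y) \<partial>M) \<partial>M)"
    by (rule P.Fubini'[symmetric]) measurable
  also have "\<dots> = (\<integral>\<^sup>+y. p y * (\<integral>\<^sup>+x. g x * a x y \<partial>M) \<partial>M)"
    by (intro nn_integral_cong) (subst nn_integral_cmult[symmetric], measurable, simp add: ac_simps)
  finally show ?thesis .
qed

lemma int_op_measurable [measurable]:
  assumes [measurable]: "case_prod k \<in> borel_measurable (M \<Otimes>\<^sub>M M)" "f \<in> borel_measurable M"
  shows "int_op M k f \<in> borel_measurable M"
  unfolding int_op_def[abs_def] by measurable

text \<open>Valid at every x: where the integrand is not integrable, the Bochner integral defaults
  to 0. Integrability therefore need not be known before passing to absolute values.\<close>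

lemma int_op_norm_le:
  "ennreal (cmod (int_op M k f x)) \<le> (\<integral>\<^sup>+y. ennreal (cmod (f y)) * ennreal (cmod (k x y)) \<partial>M)"
proof (cases "integrable M (\<lambda>y. f y * k x y)")
  case True
  then show ?thesis
    unfolding int_op_def using integral_norm_bound_ennreal[OF True]
    by (simp add: norm_mult ennreal_mult)
qed (simp add: int_op_def not_integrable_integral_eq)

text \<open>The L^1 endpoint of the Schur test: a uniform column bound is an operator bound.\<close>

lemma nn_kernel_bound:
  fixes a :: "'a \<Rightarrow> 'a \<Rightarrow> ennreal"
  assumes a[measurable]: "case_prod a \<in> borel_measurable (M \<Otimes>\<^sub>M M)"
    and f[measurable]: "f \<in> borel_measurable M"
    and C: "\<And>y. y \<in> space M \<Longrightarrow> (\<integral>\<^sup>+x. a x y \<partial>M) \<le> C"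
  shows "(\<integral>\<^sup>+x. (\<integral>\<^sup>+y. f y * a x y \<partial>M) \<partial>M) \<le> C * (\<integral>\<^sup>+y. f y \<partial>M)"
proof -
  have "(\<integral>\<^sup>+x. (\<integral>\<^sup>+y. f y * a x y \<partial>M) \<partial>M) = (\<integral>\<^sup>+y. f y * (\<integral>\<^sup>+x. a x y \<partial>M) \<partial>M)"
    using nn_integral_swap[of a "\<lambda>_. 1" f] by simp
  also have "\<dots> \<le> (\<integral>\<^sup>+y. f y * C \<partial>M)"
    by (intro nn_integral_mono mult_left_mono C) auto
  also have "\<dots> = C * (\<integral>\<^sup>+y. f y \<partial>M)"
    by (subst nn_integral_multc) (auto simp: mult.commute)
  finally show ?thesis .
qed

text \<open>The source of all information about rows: a function with finite integral is finite
  almost everywhere. Besides integrable functions, indicators of sets of finite measure are inserted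
  for f later.\<close>

lemma nn_kernel_AE_finite:
  fixes a :: "'a \<Rightarrow> 'a \<Rightarrow> ennreal"
  assumes a[measurable]: "case_prod a \<in> borel_measurable (M \<Otimes>\<^sub>M M)"
    and C: "\<And>y. y \<in> space M \<Longrightarrow> (\<integral>\<^sup>+x. a x y \<partial>M) \<le> ennreal C"
    and f[measurable]: "f \<in> borel_measurable M" "(\<integral>\<^sup>+y. f y \<partial>M) < \<infinity>"
  shows "AE x in M. (\<integral>\<^sup>+y. f y * a x y \<partial>M) < \<infinity>"
proof -
  have "(\<integral>\<^sup>+x. (\<integral>\<^sup>+y. f y * a x y \<partial>M) \<partial>M) \<le> ennreal C * (\<integral>\<^sup>+y. f y \<partial>M)"
    using C by (intro nn_kernel_bound) auto
  also have "\<dots> < \<infinity>"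
    using f(2) by (simp add: ennreal_mult_less_top)
  finally have "AE x in M. (\<integral>\<^sup>+y. f y * a x y \<partial>M) \<noteq> \<infinity>"
    by (intro nn_integral_PInf_AE) auto
  then show ?thesis
    by eventually_elim (simp add: less_top)
qed

lemma int_op_AE_finite:
  assumes k: "k \<in> L1inf M" and f: "integrable M f"
  shows "AE x in M. (\<integral>\<^sup>+y. ennreal (cmod (f y)) * ennreal (cmod (k x y)) \<partial>M) < \<infinity>"
proof -
  have [measurable]: "case_prod k \<in> borel_measurable (M \<Otimes>\<^sub>M M)" "f \<in> borel_measurable M"
    using L1infD(1)[OF k] f by auto
  obtain C where C: "\<forall>y\<in>space M. (\<integral>\<^sup>+x. ennreal (cmod (k x y)) \<partial>M) \<le> ennreal C"
    using L1infD(2)[OF k] by auto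
  show ?thesis
    using C f by (intro nn_kernel_AE_finite[of _ C]) (auto simp: integrable_iff_bounded)
qed

lemma integrable_mult_bounded:
  fixes f g :: "'a \<Rightarrow> complex"
  assumes "f \<in> borel_measurable M" "g \<in> borel_measurable M"
    and "(\<integral>\<^sup>+y. ennreal (cmod (f y)) * ennreal (cmod (g y)) \<partial>M) < \<infinity>"
  shows "integrable M (\<lambda>y. f y * g y)"
  using assms by (intro integrableI_bounded) (simp_all add: norm_mult ennreal_mult)

lemma int_op_AE_integrable:
  assumes k: "k \<in> L1inf M" and f: "integrable M f"
  shows "AE x in M. integrable M (\<lambda>y. f y * k x y)"
proof -
  have [measurable]: "case_prod k \<in> borel_measurable (M \<Otimes>\<^sub>M M)" "f \<in> borel_measurable M"
    using L1infD(1)[OF k] f by auto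
  show ?thesis
    using int_op_AE_finite[OF assms] AE_space
  proof eventually_elim
    case (elim x)
    show ?case
      by (rule integrable_mult_bounded[OF _ _ elim(1)]) (use elim(2) in measurable)
  qed
qed

lemma int_op_norm_L1_le:
  assumes C0: "0 \<le> C" and C: "\<And>y. y \<in> space M \<Longrightarrow> (\<integral>\<^sup>+x. ennreal (cmod (k x y)) \<partial>M) \<le> ennreal C"
    and f: "integrable M f" and k: "k \<in> L1inf M"
  shows "integrable M (int_op M k f)" "norm_L1 M (int_op M k f) \<le> C * norm_L1 M f"
proof -
  note [measurable] = L1infD(1)[OF k] borel_measurable_integrable[OF f]
  have "(\<integral>\<^sup>+x. ennreal (cmod (int_op M k f x)) \<partial>M)
      \<le> (\<integral>\<^sup>+x. (\<integral>\<^sup>+y. ennreal (cmod (f y)) * ennreal (cmod (k x y)) \<partial>M) \<partial>M)"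
    by (intro nn_integral_mono int_op_norm_le)
  also have "\<dots> \<le> ennreal C * (\<integral>\<^sup>+y. ennreal (cmod (f y)) \<partial>M)"
    using C by (intro nn_kernel_bound) auto
  also have "\<dots> = ennreal (C * norm_L1 M f)"
    using C0 by (simp add: norm_L1_eq_nn[OF f, symmetric] ennreal_mult norm_L1_nonneg)
  finally have *: "(\<integral>\<^sup>+x. ennreal (cmod (int_op M k f x)) \<partial>M) \<le> ennreal (C * norm_L1 M f)" .
  then show i: "integrable M (int_op M k f)"
    by (intro integrableI_bounded) (auto simp: order_le_less_trans)
  with * show "norm_L1 M (int_op M k f) \<le> C * norm_L1 M f"
    using C0 by (simp add: norm_L1_eq_nn[symmetric] norm_L1_nonneg)
qed

lemma int_op_L1:
  assumes "k \<in> L1inf M"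
  shows "\<exists>C\<ge>0. \<forall>f. integrable M f \<longrightarrow> norm_L1 M (int_op M k f) \<le> C * norm_L1 M f"
  using L1infD(2)[OF assms] int_op_norm_L1_le(2)[OF _ _ _ assms] by metis

lemma int_op_integrable:
  assumes "k \<in> L1inf M" "integrable M f"
  shows "integrable M (int_op M k f)"
  using L1infD(2)[OF assms(1)] int_op_norm_L1_le(1)[OF _ _ assms(2,1)] by metis

text \<open>At exceptional x with a nonintegrable summand the default value 0 may spoil additivity,
  hence the almost-everywhere form. Homogeneity (\<open>int_op_cmult\<close>) survives the default
  value and holds at every x.\<close>

lemma int_op_add:
  assumes "k \<in> L1inf M" "integrable M f" "integrable M g"
  shows "AE x in M. int_op M k (\<lambda>y. f y + g y) x = int_op M k f x + int_op M k g x"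
  using int_op_AE_integrable[OF assms(1,2)] int_op_AE_integrable[OF assms(1,3)]
  by eventually_elim (simp add: int_op_def distrib_right)

lemma int_op_diff:
  assumes "k \<in> L1inf M" "integrable M f" "integrable M g"
  shows "AE x in M. int_op M k (\<lambda>y. f y - g y) x = int_op M k f x - int_op M k g x"
  using int_op_AE_integrable[OF assms(1,2)] int_op_AE_integrable[OF assms(1,3)]
  by eventually_elim (simp add: int_op_def left_diff_distrib)

lemma int_op_kernel_diff:
  assumes "k \<in> L1inf M" "l \<in> L1inf M" "integrable M f"
  shows "AE x in M. int_op M (\<lambda>x y. k x y - l x y) f x = int_op M k f x - int_op M l f x"
  using int_op_AE_integrable[OF assms(1,3)] int_op_AE_integrable[OF assms(2,3)]
  by eventually_elim (simp add: int_op_def right_diff_distrib)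

lemma int_op_cmult: "int_op M k (\<lambda>y. c * f y) x = c * int_op M k f x"
  by (simp add: int_op_def mult.assoc)

text \<open>A null set in y affects no row integral, so here, unlike for additivity, the equality
  holds at each single x.\<close>

lemma int_op_cong_AE:
  assumes k: "case_prod k \<in> borel_measurable (M \<Otimes>\<^sub>M M)" and "x \<in> space M"
    and f: "f \<in> borel_measurable M" "g \<in> borel_measurable M" "AE y in M. f y = g y"
  shows "int_op M k f x = int_op M k g x"
proof -
  note k[measurable] f(1,2)[measurable]
  have [measurable]: "k x \<in> borel_measurable M"
    using \<open>x \<in> space M\<close> by measurable
  show ?thesis
    unfolding int_op_def using f(3) by (intro integral_cong_AE) auto
qed

end

section \<open>The resolvent kernel\<close>

text \<open>Since W lies between b > 0 and 1, the norm weighted by W is equivalent to the usual one.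
  \<open>contr\<close> bounds the W-weighted mass of column z of |q h| by half of
  \<open>W z\<close>, and is asked only where \<open>q z\<close> is nonzero. The value 1/2 stands
  for any ratio below 1.\<close>

locale contracting_kernel = sigma_finite_measure +
  fixes h :: "'a \<Rightarrow> 'a \<Rightarrow> complex" and q :: "'a \<Rightarrow> complex" and W :: "'a \<Rightarrow> real" and b B :: real
  assumes h: "h \<in> L1inf M"
    and q [measurable]: "q \<in> borel_measurable M"
    and q_le: "\<And>z. z \<in> space M \<Longrightarrow> cmod (q z) \<le> B"
    and W [measurable]: "W \<in> borel_measurable M"
    and b: "0 < b"
    and W_ge: "\<And>z. z \<in> space M \<Longrightarrow> b \<le> W z"
    and W_le: "\<And>z. z \<in> space M \<Longrightarrow> W z \<le> 1"
    and contr: "AE z in M. q z \<noteq> 0 \<longrightarrow>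
      (\<integral>\<^sup>+x. ennreal (W x * cmod (q x)) * ennreal (cmod (h x z)) \<partial>M) \<le> ennreal (1/2) * ennreal (W z)"
begin

lemma h_measurable [measurable]: "case_prod h \<in> borel_measurable (M \<Otimes>\<^sub>M M)"
  by (rule L1infD(1)[OF h])

primrec k_iter :: "nat \<Rightarrow> 'a \<Rightarrow> 'a \<Rightarrow> complex" where
  "k_iter 0 = h"
| "k_iter (Suc n) = (\<lambda>x y. int_op M h (\<lambda>z. q z * k_iter n z y) x)"

text \<open>The products of \<open>k_iter\<close> with absolute values inside, in
  \<open>ennreal\<close>, so that Tonelli and infinite sums require no convergence hypothesis.
  Finiteness of \<open>a_total\<close> then decides where the complex series is meaningful.\<close>

primrec a_iter :: "nat \<Rightarrow> 'a \<Rightarrow> 'a \<Rightarrow> ennreal" where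
  "a_iter 0 = (\<lambda>x y. ennreal (cmod (h x y)))"
| "a_iter (Suc n) = (\<lambda>x y. \<integral>\<^sup>+z. (ennreal (cmod (q z)) * a_iter n z y) * ennreal (cmod (h x z)) \<partial>M)"

definition a_total :: "'a \<Rightarrow> 'a \<Rightarrow> ennreal" where
  "a_total x y = (\<Sum>n. a_iter n x y)"

definition res_kernel :: "'a \<Rightarrow> 'a \<Rightarrow> complex" where
  "res_kernel x y = (\<Sum>n. k_iter n x y)"

lemma k_iter_measurable [measurable]: "case_prod (k_iter n) \<in> borel_measurable (M \<Otimes>\<^sub>M M)"
proof (induction n)
  case (Suc n)
  note Suc[measurable]
  show ?case by (simp add: int_op_def) measurable
qed simp

lemma a_iter_measurable [measurable]: "case_prod (a_iter n) \<in> borel_measurable (M \<Otimes>\<^sub>M M)"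
proof (induction n)
  case (Suc n)
  note Suc[measurable]
  show ?case by simp
qed simp

lemma a_total_measurable [measurable]: "case_prod a_total \<in> borel_measurable (M \<Otimes>\<^sub>M M)"
  unfolding a_total_def[abs_def] by measurable

lemma res_kernel_measurable [measurable]: "case_prod res_kernel \<in> borel_measurable (M \<Otimes>\<^sub>M M)"
  unfolding res_kernel_def[abs_def] by measurable

lemma k_iter_le: "ennreal (cmod (k_iter n x y)) \<le> a_iter n x y"
proof (induction n arbitrary: x)
  case (Suc n)
  have "ennreal (cmod (k_iter (Suc n) x y))
      \<le> (\<integral>\<^sup>+z. ennreal (cmod (q z * k_iter n z y)) * ennreal (cmod (h x z)) \<partial>M)"
    unfolding k_iter.simps by (rule int_op_norm_le)
  also have "\<dots> \<le> a_iter (Suc n) x y"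
    by (simp add: norm_mult ennreal_mult) (intro nn_integral_mono mult_right_mono mult_left_mono Suc; simp)
  finally show ?case .
qed simp

text \<open>Each step gains a factor 1/2: Tonelli moves the weight onto column z of h, where
  \<open>contr\<close> applies, and points with \<open>q z\<close> = 0 drop out because the iterate
  carries the factor |q z|. The initial constant comes from W |q| <= B.\<close>

lemma a_iter_weight:
  assumes C: "0 \<le> C" "\<And>y. y \<in> space M \<Longrightarrow> (\<integral>\<^sup>+x. ennreal (cmod (h x y)) \<partial>M) \<le> ennreal C"
    and y: "y \<in> space M"
  shows "(\<integral>\<^sup>+x. ennreal (W x * cmod (q x)) * a_iter n x y \<partial>M) \<le> ennreal (B * C * (1/2)^n)"
proof (induction n)
  case 0
  have "(\<integral>\<^sup>+x. ennreal (W x * cmod (q x)) * a_iter 0 x y \<partial>M) \<le> (\<integral>\<^sup>+x. ennreal B * ennreal (cmod (h x y)) \<partial>M)"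
  proof (intro nn_integral_mono)
    fix x assume x: "x \<in> space M"
    have "W x * cmod (q x) \<le> 1 * B"
      using W_ge[OF x] W_le[OF x] q_le[OF x] b by (intro mult_mono) auto
    then show "ennreal (W x * cmod (q x)) * a_iter 0 x y \<le> ennreal B * ennreal (cmod (h x y))"
      unfolding a_iter.simps by (intro mult_right_mono ennreal_leI) auto
  qed
  also have "\<dots> \<le> ennreal B * ennreal C"
    using y by (subst nn_integral_cmult) (auto intro!: mult_left_mono C)
  also have "\<dots> = ennreal (B * C * (1/2)^0)"
    using C(1) by (simp add: ennreal_mult'')
  finally show ?case .
next
  case (Suc n)
  have [measurable]: "(\<lambda>z. a_iter n z y) \<in> borel_measurable M"
    using y by measurable
  have "(\<integral>\<^sup>+x. ennreal (W x * cmod (q x)) * a_iter (Suc n) x y \<partial>M)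
      = (\<integral>\<^sup>+z. (ennreal (cmod (q z)) * a_iter n z y) *
          (\<integral>\<^sup>+x. ennreal (W x * cmod (q x)) * ennreal (cmod (h x z)) \<partial>M) \<partial>M)"
    unfolding a_iter.simps by (rule nn_integral_swap) measurable
  also have "\<dots> \<le> (\<integral>\<^sup>+z. ennreal (1/2) * (ennreal (W z * cmod (q z)) * a_iter n z y) \<partial>M)"
  proof (rule nn_integral_mono_AE)
    show "AE z in M. (ennreal (cmod (q z)) * a_iter n z y) *
          (\<integral>\<^sup>+x. ennreal (W x * cmod (q x)) * ennreal (cmod (h x z)) \<partial>M)
        \<le> ennreal (1/2) * (ennreal (W z * cmod (q z)) * a_iter n z y)"
      using contr AE_space
    proof eventually_elim
      case (elim z)
      show ?case
      proof (cases "q z = 0")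
        case False
        then have "(ennreal (cmod (q z)) * a_iter n z y) *
          (\<integral>\<^sup>+x. ennreal (W x * cmod (q x)) * ennreal (cmod (h x z)) \<partial>M)
          \<le> (ennreal (cmod (q z)) * a_iter n z y) * (ennreal (1/2) * ennreal (W z))"
          using elim by (intro mult_left_mono) auto
        also have "\<dots> = ennreal (1/2) * (ennreal (W z * cmod (q z)) * a_iter n z y)"
          using W_ge[OF elim(2)] b by (simp add: ennreal_mult mult_ac)
        finally show ?thesis .
      qed simp
    qed
  qed
  also have "\<dots> = ennreal (1/2) * (\<integral>\<^sup>+z. ennreal (W z * cmod (q z)) * a_iter n z y \<partial>M)"
    by (rule nn_integral_cmult) measurable
  also have "\<dots> \<le> ennreal (1/2) * ennreal (B * C * (1/2)^n)"
    by (intro mult_left_mono Suc) simp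
  also have "\<dots> = ennreal (B * C * (1/2)^Suc n)"
    by (subst ennreal_mult'[symmetric]) (auto simp: mult_ac)
  finally show ?case .
qed

text \<open>The weight W |q| vanishes where q does, so the geometric decay alone gives no bound
  there. Splitting off the leftmost factor h repairs this: the column bound C carries the mass of
  |q| \<open>a_iter n\<close> to the whole space, and 1/b removes the weight. The term n = 0 is kept
  apart.\<close>

lemma a_total_bound: "\<exists>C. \<forall>y\<in>space M. (\<integral>\<^sup>+x. a_total x y \<partial>M) \<le> ennreal C"
proof -
  obtain C where C: "0 \<le> C" "\<And>y. y \<in> space M \<Longrightarrow> (\<integral>\<^sup>+x. ennreal (cmod (h x y)) \<partial>M) \<le> ennreal C"
    using L1infD(2)[OF h] by auto
  have "(\<integral>\<^sup>+x. a_total x y \<partial>M) \<le> ennreal (C + 2 * (C / b * (B * C)))" if y: "y \<in> space M" for y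
  proof -
    have [measurable]: "(\<lambda>z. a_iter n z y) \<in> borel_measurable M" for n
      using y by measurable
    have B: "0 \<le> B"
      using q_le[OF y] norm_ge_zero order_trans by blast
    have step: "(\<integral>\<^sup>+x. a_iter (Suc n) x y \<partial>M) \<le> ennreal (C / b * (B * C) * (1/2)^n)" for n
    proof -
      have "(\<integral>\<^sup>+x. a_iter (Suc n) x y \<partial>M) \<le> ennreal C * (\<integral>\<^sup>+z. ennreal (cmod (q z)) * a_iter n z y \<partial>M)"
        unfolding a_iter.simps by (rule nn_kernel_bound) (use C(2) in auto)
      also have "\<dots> \<le> ennreal C * (\<integral>\<^sup>+z. ennreal (1 / b) * (ennreal (W z * cmod (q z)) * a_iter n z y) \<partial>M)"
      proof (intro mult_left_mono nn_integral_mono)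
        fix z assume z: "z \<in> space M"
        have "1 \<le> 1 / b * W z"
          using W_ge[OF z] b by simp
        then have "1 * cmod (q z) \<le> (1 / b * W z) * cmod (q z)"
          by (intro mult_right_mono) auto
        then have "ennreal (cmod (q z)) \<le> ennreal (1 / b) * ennreal (W z * cmod (q z))"
          using b W_ge[OF z] by (simp add: ennreal_mult[symmetric] mult.assoc)
        then show "ennreal (cmod (q z)) * a_iter n z y \<le> ennreal (1 / b) * (ennreal (W z * cmod (q z)) * a_iter n z y)"
          unfolding mult.assoc[symmetric] by (rule mult_right_mono) simp
      qed simp
      also have "\<dots> = ennreal C * (ennreal (1 / b) * (\<integral>\<^sup>+z. ennreal (W z * cmod (q z)) * a_iter n z y \<partial>M))"
        by (subst nn_integral_cmult) auto
      also have "\<dots> \<le> ennreal C * (ennreal (1 / b) * ennreal (B * C * (1/2)^n))"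
        by (intro mult_left_mono a_iter_weight C y) auto
      also have "\<dots> = ennreal (C / b * (B * C) * (1/2)^n)"
        using C(1) b B by (simp add: ennreal_mult[symmetric])
      finally show ?thesis .
    qed
    have "(\<integral>\<^sup>+x. a_total x y \<partial>M) = (\<Sum>n. \<integral>\<^sup>+x. a_iter n x y \<partial>M)"
      unfolding a_total_def by (rule nn_integral_suminf) measurable
    also have "\<dots> = (\<Sum>n. \<integral>\<^sup>+x. a_iter (Suc n) x y \<partial>M) + (\<integral>\<^sup>+x. a_iter 0 x y \<partial>M)"
      by (subst suminf_offset[where i=1]) (auto simp: add.commute)
    also have "\<dots> \<le> (\<Sum>n. ennreal (C / b * (B * C) * (1/2)^n)) + ennreal C"
      by (intro add_mono suminf_le step) (use C y in auto)
    also have "(\<Sum>n. ennreal (C / b * (B * C) * (1/2)^n)) = ennreal (C / b * (B * C) * 2)"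
    proof -
      have "(\<lambda>n. C / b * (B * C) * (1/2)^n) sums (C / b * (B * C) * 2)"
        using geometric_sums[of "1/2::real"] by (intro sums_mult) simp
      then show ?thesis
        using C(1) b B by (intro sums_unique[symmetric]) (subst sums_ennreal, auto)
    qed
    also have "\<dots> + ennreal C = ennreal (C + 2 * (C / b * (B * C)))"
      using C(1) b B by (subst ennreal_plus[symmetric]) (auto simp: algebra_simps)
    finally show ?thesis .
  qed
  then show ?thesis by blast
qed

lemma a_total_Suc:
  assumes "x \<in> space M" "y \<in> space M"
  shows "a_total x y = ennreal (cmod (h x y)) +
    (\<integral>\<^sup>+z. (ennreal (cmod (q z)) * a_total z y) * ennreal (cmod (h x z)) \<partial>M)"
proof -
  have [measurable]: "(\<lambda>z. a_iter n z y) \<in> borel_measurable M" "h x \<in> borel_measurable M" for n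
    using assms by measurable
  have "a_total x y = a_iter 0 x y + (\<Sum>n. a_iter (Suc n) x y)"
    unfolding a_total_def by (subst suminf_offset[where i=1]) auto
  also have "(\<Sum>n. a_iter (Suc n) x y)
      = (\<integral>\<^sup>+z. (\<Sum>n. (ennreal (cmod (q z)) * a_iter n z y) * ennreal (cmod (h x z))) \<partial>M)"
    unfolding a_iter.simps by (rule nn_integral_suminf[symmetric]) measurable
  also have "\<dots> = (\<integral>\<^sup>+z. (ennreal (cmod (q z)) * a_total z y) * ennreal (cmod (h x z)) \<partial>M)"
    unfolding a_total_def by (simp add: ennreal_suminf_cmult ennreal_suminf_multc)
  finally show ?thesis by simp
qed

lemma res_kernel_summable:
  assumes "a_total x y < \<infinity>"
  shows "summable (\<lambda>n. cmod (k_iter n x y))" "ennreal (\<Sum>n. cmod (k_iter n x y)) \<le> a_total x y"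
proof -
  have le: "(\<Sum>n. ennreal (cmod (k_iter n x y))) \<le> a_total x y"
    unfolding a_total_def by (intro suminf_le k_iter_le) auto
  then have fin: "(\<Sum>n. ennreal (cmod (k_iter n x y))) \<noteq> \<infinity>"
    using assms by (auto simp: top_unique)
  show s: "summable (\<lambda>n. cmod (k_iter n x y))"
    using fin by (intro summable_suminf_not_top) auto
  show "ennreal (\<Sum>n. cmod (k_iter n x y)) \<le> a_total x y"
    using le by (subst suminf_ennreal2[OF _ s, symmetric]) auto
qed

text \<open>Where \<open>a_total\<close> is infinite the bound is vacuous, so the unspecified value
  of a divergent \<open>suminf\<close> does no harm.\<close>

lemma res_kernel_le: "ennreal (cmod (res_kernel x y)) \<le> a_total x y"
proof (cases "a_total x y < \<infinity>")
  case True
  have "cmod (res_kernel x y) \<le> (\<Sum>n. cmod (k_iter n x y))"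
    unfolding res_kernel_def by (rule summable_norm[OF res_kernel_summable(1)[OF True]])
  then show ?thesis
    using res_kernel_summable(2)[OF True] by (meson ennreal_leI order_trans)
qed (auto simp: top.not_eq_extremum[symmetric])

lemma res_kernel_L1inf: "res_kernel \<in> L1inf M"
proof -
  obtain C where C: "\<forall>y\<in>space M. (\<integral>\<^sup>+x. a_total x y \<partial>M) \<le> ennreal C"
    using a_total_bound by blast
  show ?thesis
  proof (rule L1infI)
    fix y assume "y \<in> space M"
    have "(\<integral>\<^sup>+x. ennreal (cmod (res_kernel x y)) \<partial>M) \<le> (\<integral>\<^sup>+x. a_total x y \<partial>M)"
      by (intro nn_integral_mono res_kernel_le)
    also have "\<dots> \<le> ennreal C"
      using C \<open>y \<in> space M\<close> by blast
    finally show "(\<integral>\<^sup>+x. ennreal (cmod (res_kernel x y)) \<partial>M) \<le> ennreal C" .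
  qed measurable
qed

text \<open>The identity r = h + h q r at individual points: the head of the series is h, and the
  tail is summed under the integral in z, which the finite majorant at (x, y) permits.\<close>

lemma res_kernel_eq:
  assumes "x \<in> space M" "y \<in> space M" and fin: "a_total x y < \<infinity>"
  shows "res_kernel x y = h x y + int_op M h (\<lambda>z. q z * res_kernel z y) x"
proof -
  have [measurable]: "(\<lambda>z. a_iter n z y) \<in> borel_measurable M" "(\<lambda>z. k_iter n z y) \<in> borel_measurable M"
    "h x \<in> borel_measurable M" "(\<lambda>z. a_total z y) \<in> borel_measurable M" for n
    using assms by measurable
  have "(\<integral>\<^sup>+z. (ennreal (cmod (q z)) * a_total z y) * ennreal (cmod (h x z)) \<partial>M) < \<infinity>"
    using a_total_Suc[OF assms(1,2)] fin by (auto simp: ennreal_add_eq_top less_top)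
  then have "AE z in M. (ennreal (cmod (q z)) * a_total z y) * ennreal (cmod (h x z)) \<noteq> \<infinity>"
    by (intro nn_integral_PInf_AE) auto
  \<comment> \<open>Finiteness passes from (x, y) to (z, y) for almost every z with a nonzero factor
    \<open>q z * h x z\<close>; for other z all terms vanish, whether or not the series at (z, y)
    converges.\<close>
  then have AE_s: "AE z in M. q z * h x z \<noteq> 0 \<longrightarrow> a_total z y < \<infinity>"
    by eventually_elim (auto simp: less_top ennreal_mult_eq_top_iff ennreal_top_mult ennreal_mult_top)
  have le: "(\<integral>\<^sup>+z. ennreal (cmod (q z * k_iter n z y)) * ennreal (cmod (h x z)) \<partial>M) \<le> a_iter (Suc n) x y" for n
    by (simp add: norm_mult ennreal_mult) (intro nn_integral_mono mult_right_mono mult_left_mono k_iter_le; simp)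
  have suma: "(\<Sum>n. a_iter n x y) < \<infinity>"
    using fin by (simp add: a_total_def)
  have afin: "a_iter n x y < \<infinity>" for n
    using suma ennreal_suminf_lessD by blast
  have i: "integrable M (\<lambda>z. q z * k_iter n z y * h x z)" for n
    by (rule integrable_mult_bounded[OF _ _ order_le_less_trans[OF le afin]]) measurable
  have "(\<Sum>n. ennreal (\<integral>z. cmod (q z * k_iter n z y * h x z) \<partial>M)) \<le> (\<Sum>n. a_iter (Suc n) x y)"
  proof (rule suminf_le)
    fix n
    have "ennreal (\<integral>z. cmod (q z * k_iter n z y * h x z) \<partial>M)
        = (\<integral>\<^sup>+z. ennreal (cmod (q z * k_iter n z y * h x z)) \<partial>M)"
      by (rule nn_integral_eq_integral[OF integrable_norm[OF i], symmetric]) simp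
    also have "\<dots> \<le> a_iter (Suc n) x y"
      using le[of n] by (simp add: norm_mult ennreal_mult)
    finally show "ennreal (\<integral>z. cmod (q z * k_iter n z y * h x z) \<partial>M) \<le> a_iter (Suc n) x y" .
  qed auto
  also have "\<dots> \<le> (\<Sum>n. a_iter n x y)"
    by (subst suminf_offset[where i=1 and f="\<lambda>n. a_iter n x y"]) auto
  finally have "(\<Sum>n. ennreal (\<integral>z. cmod (q z * k_iter n z y * h x z) \<partial>M)) < \<infinity>"
    using suma by (rule order_le_less_trans)
  then have si: "summable (\<lambda>n. \<integral>z. cmod (q z * k_iter n z y * h x z) \<partial>M)"
    by (intro summable_suminf_not_top) (auto simp: less_top)
  have sn: "AE z in M. summable (\<lambda>n. cmod (q z * k_iter n z y * h x z))"
    using AE_s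
  proof eventually_elim
    case (elim z)
    show ?case
    proof (cases "q z * h x z = 0")
      case False
      then have "summable (\<lambda>n. cmod (q z) * cmod (k_iter n z y) * cmod (h x z))"
        using elim by (intro summable_mult summable_mult2 res_kernel_summable) auto
      then show ?thesis by (simp add: norm_mult)
    qed (auto simp: norm_mult)
  qed
  have "res_kernel x y = k_iter 0 x y + (\<Sum>n. k_iter (Suc n) x y)"
    unfolding res_kernel_def
    using suminf_split_head[OF res_kernel_summable(1)[OF fin, THEN summable_norm_cancel]] by simp
  also have "(\<Sum>n. k_iter (Suc n) x y) = (\<integral>z. (\<Sum>n. q z * k_iter n z y * h x z) \<partial>M)"
    by (simp add: int_op_def integral_suminf[OF i sn si])
  also have "\<dots> = int_op M h (\<lambda>z. q z * res_kernel z y) x"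
    unfolding int_op_def
  proof (rule integral_cong_AE)
    show "AE z in M. (\<Sum>n. q z * k_iter n z y * h x z) = q z * res_kernel z y * h x z"
      using AE_s
    proof eventually_elim
      case (elim z)
      show ?case
      proof (cases "q z * h x z = 0")
        case False
        then have "a_total z y < \<infinity>"
          using elim by simp
        then have s: "summable (\<lambda>n. k_iter n z y)"
          by (rule summable_norm_cancel[OF res_kernel_summable(1)])
        show ?thesis
          unfolding res_kernel_def suminf_mult[OF s, symmetric] suminf_mult2[OF summable_mult[OF s]] ..
      qed auto
    qed
  qed (use assms in measurable)
  finally show ?thesis by simp
qed

text \<open>R f = H (f + q R f): the kernel identity integrated against f. For almost every row x
  the function |f| \<open>a_total x\<close> has finite integral, which supplies both the joint
  integrability for Fubini and, for almost every y with f y nonzero, the finiteness needed for the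
  kernel identity.\<close>

lemma res_op_eq:
  assumes f: "integrable M f"
  shows "AE x in M. int_op M res_kernel f x = int_op M h (\<lambda>z. f z + q z * int_op M res_kernel f z) x"
proof -
  interpret P: pair_sigma_finite M M by (rule pair_sf)
  have [measurable]: "f \<in> borel_measurable M"
    using f by auto
  obtain C where C: "\<forall>y\<in>space M. (\<integral>\<^sup>+x. a_total x y \<partial>M) \<le> ennreal C"
    using a_total_bound by blast
  have "AE x in M. (\<integral>\<^sup>+y. ennreal (cmod (f y)) * a_total x y \<partial>M) < \<infinity>"
    using C f by (intro nn_kernel_AE_finite[of _ C]) (auto simp: integrable_iff_bounded)
  then show ?thesis
    using AE_space
  proof eventually_elim
    case (elim x)
    note x [measurable] = elim(2)
    have [measurable]: "h x \<in> borel_measurable M" "res_kernel x \<in> borel_measurable M" "a_total x \<in> borel_measurable M"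
      by measurable
    have i_res: "integrable M (\<lambda>y. f y * res_kernel x y)"
      using elim(1)
      by (intro integrable_mult_bounded)
         (auto intro!: order_le_less_trans[OF _ elim(1)[unfolded infinity_ennreal_def]] nn_integral_mono mult_left_mono res_kernel_le)
    have h_le: "ennreal (cmod (h x y)) \<le> a_total x y" if "y \<in> space M" for y
      using a_total_Suc[OF x that] by simp
    have i_h: "integrable M (\<lambda>y. f y * h x y)"
      using elim(1) h_le
      by (intro integrable_mult_bounded)
         (auto intro!: order_le_less_trans[OF _ elim(1)[unfolded infinity_ennreal_def]] nn_integral_mono mult_left_mono)
    \<comment> \<open>Integrated in z this gives f (r - h) along row x; integrated in y it gives the
      integrand of H (q R f) at x.\<close>
    let ?G = "\<lambda>y z. f y * (q z * res_kernel z y * h x z)"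
    have G: "integrable (M \<Otimes>\<^sub>M M) (case_prod ?G)"
    proof (rule integrableI_bounded)
      have "(\<integral>\<^sup>+p. ennreal (cmod (case_prod ?G p)) \<partial>(M \<Otimes>\<^sub>M M)) = (\<integral>\<^sup>+y. (\<integral>\<^sup>+z. ennreal (cmod (?G y z)) \<partial>M) \<partial>M)"
        by (subst nn_integral_fst[symmetric]) auto
      also have "\<dots> \<le> (\<integral>\<^sup>+y. ennreal (cmod (f y)) * a_total x y \<partial>M)"
      proof (rule nn_integral_mono)
        fix y assume y: "y \<in> space M"
        have [measurable]: "(\<lambda>z. a_total z y) \<in> borel_measurable M"
          using y by measurable
        have "(\<integral>\<^sup>+z. ennreal (cmod (?G y z)) \<partial>M)
            \<le> (\<integral>\<^sup>+z. ennreal (cmod (f y)) * ((ennreal (cmod (q z)) * a_total z y) * ennreal (cmod (h x z))) \<partial>M)"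
          by (simp add: norm_mult ennreal_mult)
             (intro nn_integral_mono mult_left_mono mult_right_mono res_kernel_le; simp)
        also have "\<dots> = ennreal (cmod (f y)) * (\<integral>\<^sup>+z. (ennreal (cmod (q z)) * a_total z y) * ennreal (cmod (h x z)) \<partial>M)"
          by (rule nn_integral_cmult) measurable
        also have "\<dots> \<le> ennreal (cmod (f y)) * a_total x y"
          using a_total_Suc[OF x y] by (intro mult_left_mono) auto
        finally show "(\<integral>\<^sup>+z. ennreal (cmod (?G y z)) \<partial>M) \<le> ennreal (cmod (f y)) * a_total x y" .
      qed
      also have "\<dots> < \<infinity>" by fact
      finally show "(\<integral>\<^sup>+p. ennreal (cmod (case_prod ?G p)) \<partial>(M \<Otimes>\<^sub>M M)) < \<infinity>" .
    qed measurable
    have i_fst: "integrable M (\<lambda>y. \<integral>z. ?G y z \<partial>M)"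
      using P.integrable_fst[OF G] .
    have i_snd: "integrable M (\<lambda>z. \<integral>y. ?G y z \<partial>M)"
      using P.integrable_snd[OF G] .
    have "AE y in M. ennreal (cmod (f y)) * a_total x y \<noteq> \<infinity>"
      using elim(1) by (intro nn_integral_PInf_AE) (auto simp: less_top)
    then have AEy: "AE y in M. f y * res_kernel x y = f y * h x y + (\<integral>z. ?G y z \<partial>M)"
      using AE_space
    proof eventually_elim
      case (elim y)
      show ?case
      proof (cases "f y = 0")
        case False
        then have "a_total x y < \<infinity>"
          using elim(1) by (auto simp: less_top ennreal_mult_eq_top_iff)
        from res_kernel_eq[OF x elim(2) this] show ?thesis
          by (simp add: int_op_def distrib_left)
      qed simp
    qed
    have "int_op M res_kernel f x = (\<integral>y. f y * h x y + (\<integral>z. ?G y z \<partial>M) \<partial>M)"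
      unfolding int_op_def by (rule integral_cong_AE) (use AEy in auto)
    also have "\<dots> = (\<integral>y. f y * h x y \<partial>M) + (\<integral>y. (\<integral>z. ?G y z \<partial>M) \<partial>M)"
      using i_h i_fst by (rule Bochner_Integration.integral_add)
    also have "(\<integral>y. (\<integral>z. ?G y z \<partial>M) \<partial>M) = (\<integral>z. (\<integral>y. ?G y z \<partial>M) \<partial>M)"
      by (rule P.Fubini_integral[OF G, symmetric])
    also have "(\<integral>y. f y * h x y \<partial>M) + \<dots> = (\<integral>z. f z * h x z + (\<integral>y. ?G y z \<partial>M) \<partial>M)"
      using i_h i_snd by (rule Bochner_Integration.integral_add[symmetric])
    also have "\<dots> = int_op M h (\<lambda>z. f z + q z * int_op M res_kernel f z) x"
    proof -
      have "(\<integral>y. ?G y z \<partial>M) = q z * int_op M res_kernel f z * h x z" for z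
      proof -
        have "(\<integral>y. ?G y z \<partial>M) = (\<integral>y. (q z * h x z) * (f y * res_kernel z y) \<partial>M)"
          by (simp add: mult_ac)
        also have "\<dots> = (q z * h x z) * (\<integral>y. f y * res_kernel z y \<partial>M)"
          by (rule integral_mult_right_zero)
        finally show ?thesis by (simp add: int_op_def mult_ac)
      qed
      then show ?thesis by (simp add: int_op_def distrib_right)
    qed
    finally show ?case .
  qed
qed

end

section \<open>The solution operator and uniqueness in the weighted norm\<close>

context contracting_kernel
begin

text \<open>The inverse of I - q H on L^1, expressed through the resolvent kernel:
  \<open>sol_eq\<close> gives existence, \<open>sol_unique\<close> uniqueness.\<close>

definition sol :: "('a \<Rightarrow> complex) \<Rightarrow> 'a \<Rightarrow> complex" where
  "sol g x = g x + q x * int_op M res_kernel g x"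

lemma q_mult_integrable:
  assumes g: "integrable M g"
  shows "integrable M (\<lambda>x. q x * g x)"
proof (rule Bochner_Integration.integrable_bound)
  show "integrable M (\<lambda>x. B * cmod (g x))"
    using g by auto
  show "AE x in M. norm (q x * g x) \<le> norm (B * cmod (g x))"
    using AE_space
  proof eventually_elim
    case (elim x)
    then have "cmod (q x) \<le> \<bar>B\<bar>" using q_le by (meson abs_ge_self order_trans)
    then show ?case by (simp add: norm_mult abs_mult mult_right_mono)
  qed
qed (use g in auto)

lemma sol_integrable:
  assumes "integrable M g"
  shows "integrable M (sol g)"
  unfolding sol_def[abs_def]
  using assms by (intro Bochner_Integration.integrable_add q_mult_integrable int_op_integrable[OF res_kernel_L1inf])

lemma int_op_sol:
  assumes "integrable M g"
  shows "AE x in M. int_op M res_kernel g x = int_op M h (sol g) x"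
  using res_op_eq[OF assms] by (simp add: sol_def[abs_def])

lemma sol_eq:
  assumes "integrable M g"
  shows "AE x in M. sol g x = g x + q x * int_op M h (sol g) x"
  using int_op_sol[OF assms] by eventually_elim (simp add: sol_def)

definition wnorm :: "('a \<Rightarrow> complex) \<Rightarrow> real" where
  "wnorm u = (\<integral>x. W x * cmod (u x) \<partial>M)"

lemma wnorm_integrable:
  assumes u: "integrable M u"
  shows "integrable M (\<lambda>x. W x * cmod (u x))"
proof (rule Bochner_Integration.integrable_bound)
  show "integrable M (\<lambda>x. cmod (u x))"
    using u by auto
  show "AE x in M. norm (W x * cmod (u x)) \<le> norm (cmod (u x))"
    using AE_space
  proof eventually_elim
    case (elim x)
    then show ?case
      using mult_right_mono[of "W x" 1 "cmod (u x)"] W_le[of x] W_ge[of x] b by (simp add: abs_mult)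
  qed
qed (use u in auto)

lemma wnorm_le:
  assumes u: "integrable M u"
  shows "wnorm u \<le> norm_L1 M u" "b * norm_L1 M u \<le> wnorm u"
proof -
  have "W x * cmod (u x) \<le> 1 * cmod (u x)" "b * cmod (u x) \<le> W x * cmod (u x)" if "x \<in> space M" for x
    by (intro mult_right_mono W_le W_ge norm_ge_zero that)+
  then have "wnorm u \<le> (\<integral>x. 1 * cmod (u x) \<partial>M)" "(\<integral>x. b * cmod (u x) \<partial>M) \<le> wnorm u"
    unfolding wnorm_def using u wnorm_integrable[OF u] by (intro integral_mono; simp)+
  then show "wnorm u \<le> norm_L1 M u" "b * norm_L1 M u \<le> wnorm u"
    by (simp_all add: norm_L1_def)
qed

lemma wnorm_add:
  assumes u: "integrable M u" "integrable M v"
  shows "wnorm (\<lambda>x. u x + v x) \<le> wnorm u + wnorm v"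
proof -
  have "wnorm (\<lambda>x. u x + v x) \<le> (\<integral>x. W x * cmod (u x) + W x * cmod (v x) \<partial>M)"
    unfolding wnorm_def
  proof (rule integral_mono)
    fix x assume "x \<in> space M"
    then show "W x * cmod (u x + v x) \<le> W x * cmod (u x) + W x * cmod (v x)"
      using W_ge[of x] b unfolding distrib_left[symmetric] by (intro mult_left_mono norm_triangle_ineq) auto
  qed (use u in \<open>auto intro!: wnorm_integrable\<close>)
  then show ?thesis
    using u by (simp add: wnorm_def wnorm_integrable)
qed

lemma wnorm_cong_AE:
  assumes "integrable M u" "integrable M v" "AE x in M. u x = v x"
  shows "wnorm u = wnorm v"
  unfolding wnorm_def using assms by (intro integral_cong_AE) auto

text \<open>The support hypothesis pays for \<open>contr\<close> being limited to columns with q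
  nonzero. It holds for solutions of u = q H u and for differences of solutions with a common datum,
  the two kinds of functions to which the lemma is applied.\<close>

lemma wnorm_contract:
  assumes u: "integrable M u" and supp: "AE x in M. q x = 0 \<longrightarrow> u x = 0"
  shows "wnorm (\<lambda>x. q x * int_op M h u x) \<le> wnorm u / 2"
proof -
  have [measurable]: "u \<in> borel_measurable M"
    using u by auto
  have i: "integrable M (\<lambda>x. q x * int_op M h u x)"
    using u by (intro q_mult_integrable int_op_integrable h)
  have nonneg: "AE x in M. 0 \<le> W x * cmod (v x)" for v
    using AE_space
  proof eventually_elim
    case (elim x)
    then show ?case using W_ge[of x] b by auto
  qed
  have "ennreal (wnorm (\<lambda>x. q x * int_op M h u x)) = (\<integral>\<^sup>+x. ennreal (W x * cmod (q x * int_op M h u x)) \<partial>M)"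
    unfolding wnorm_def by (rule nn_integral_eq_integral[symmetric, OF wnorm_integrable[OF i] nonneg])
  also have "\<dots> \<le> (\<integral>\<^sup>+x. ennreal (W x * cmod (q x)) *
      (\<integral>\<^sup>+y. ennreal (cmod (u y)) * ennreal (cmod (h x y)) \<partial>M) \<partial>M)"
  proof (rule nn_integral_mono)
    fix x assume x: "x \<in> space M"
    have "ennreal (W x * cmod (q x * int_op M h u x)) = ennreal (W x * cmod (q x)) * ennreal (cmod (int_op M h u x))"
      using W_ge[OF x] b by (simp add: norm_mult ennreal_mult mult.assoc)
    also have "\<dots> \<le> ennreal (W x * cmod (q x)) * (\<integral>\<^sup>+y. ennreal (cmod (u y)) * ennreal (cmod (h x y)) \<partial>M)"
      by (intro mult_left_mono int_op_norm_le) auto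
    finally show "ennreal (W x * cmod (q x * int_op M h u x)) \<le> \<dots>" .
  qed
  also have "\<dots> = (\<integral>\<^sup>+y. ennreal (cmod (u y)) *
      (\<integral>\<^sup>+x. ennreal (W x * cmod (q x)) * ennreal (cmod (h x y)) \<partial>M) \<partial>M)"
    by (rule nn_integral_swap) measurable
  also have "\<dots> \<le> (\<integral>\<^sup>+y. ennreal (1/2) * ennreal (W y * cmod (u y)) \<partial>M)"
  proof (rule nn_integral_mono_AE)
    show "AE y in M. ennreal (cmod (u y)) * (\<integral>\<^sup>+x. ennreal (W x * cmod (q x)) * ennreal (cmod (h x y)) \<partial>M)
        \<le> ennreal (1/2) * ennreal (W y * cmod (u y))"
      using contr supp AE_space
    proof eventually_elim
      case (elim y)
      show ?case
      proof (cases "q y = 0")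
        case False
        then have "ennreal (cmod (u y)) * (\<integral>\<^sup>+x. ennreal (W x * cmod (q x)) * ennreal (cmod (h x y)) \<partial>M)
            \<le> ennreal (cmod (u y)) * (ennreal (1/2) * ennreal (W y))"
          using elim by (intro mult_left_mono) auto
        also have "\<dots> = ennreal (1/2) * ennreal (W y * cmod (u y))"
          using W_ge[OF elim(3)] b by (simp add: ennreal_mult mult_ac)
        finally show ?thesis .
      qed (use elim in simp)
    qed
  qed
  also have "\<dots> = ennreal (1/2) * ennreal (wnorm u)"
    unfolding wnorm_def
    by (subst nn_integral_cmult) (simp_all add: nn_integral_eq_integral[OF wnorm_integrable[OF u] nonneg])
  also have "\<dots> = ennreal (wnorm u / 2)"
    by (subst ennreal_mult'[symmetric]) auto
  finally show ?thesis
    using wnorm_le(2)[OF u] b norm_L1_nonneg[of M u]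
    by (subst (asm) ennreal_le_iff) (auto intro: order_trans[rotated])
qed

lemma fixpoint_zero:
  assumes u: "integrable M u" and eq: "AE x in M. u x = q x * int_op M h u x"
  shows "AE x in M. u x = 0"
proof -
  have "wnorm u = wnorm (\<lambda>x. q x * int_op M h u x)"
    using u eq by (intro wnorm_cong_AE q_mult_integrable int_op_integrable h)
  also have "\<dots> \<le> wnorm u / 2"
    by (rule wnorm_contract[OF u]) (use eq in eventually_elim, auto)
  finally have "b * norm_L1 M u \<le> 0"
    using wnorm_le(2)[OF u] by simp
  then have "norm_L1 M u = 0"
    using b norm_L1_nonneg[of M u] by (simp add: mult_le_0_iff)
  then show ?thesis by (rule norm_L1_eq_0[OF u])
qed

lemma sol_unique:
  assumes g: "integrable M g" and u: "integrable M u"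
    and eq: "AE x in M. u x = g x + q x * int_op M h u x"
  shows "AE x in M. u x = sol g x"
proof -
  have "AE x in M. u x - sol g x = q x * int_op M h (\<lambda>x. u x - sol g x) x"
    using eq sol_eq[OF g] int_op_diff[OF h u sol_integrable[OF g]]
  proof eventually_elim
    case (elim x)
    have "u x - sol g x = q x * (int_op M h u x - int_op M h (sol g) x)"
      unfolding right_diff_distrib using elim(1,2) by simp
    then show ?case
      using elim(3) by simp
  qed
  then have "AE x in M. u x - sol g x = 0"
    using u sol_integrable[OF g] by (intro fixpoint_zero) auto
  then show ?thesis by eventually_elim simp
qed

lemma sol_add:
  assumes "integrable M f" "integrable M g"
  shows "AE x in M. sol (\<lambda>x. f x + g x) x = sol f x + sol g x"
  using int_op_add[OF res_kernel_L1inf assms] by eventually_elim (simp add: sol_def distrib_left)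

lemma sol_cmult: "sol (\<lambda>x. c * f x) x = c * sol f x"
  by (simp add: sol_def int_op_cmult distrib_left)

lemma q_mult_norm_le:
  assumes f: "integrable M f"
  shows "norm_L1 M (\<lambda>x. q x * f x) \<le> \<bar>B\<bar> * norm_L1 M f"
proof -
  have "norm_L1 M (\<lambda>x. q x * f x) \<le> (\<integral>x. \<bar>B\<bar> * cmod (f x) \<partial>M)"
    unfolding norm_L1_def
  proof (rule integral_mono)
    fix x assume "x \<in> space M"
    then have "cmod (q x) \<le> \<bar>B\<bar>" using q_le by (meson abs_ge_self order_trans)
    then show "cmod (q x * f x) \<le> \<bar>B\<bar> * cmod (f x)"
      by (simp add: norm_mult mult_right_mono)
  qed (use f q_mult_integrable[OF f] in auto)
  then show ?thesis
    by (simp add: norm_L1_def)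
qed

lemma sol_bounded: "\<exists>C\<ge>0. \<forall>f. integrable M f \<longrightarrow> norm_L1 M (sol f) \<le> C * norm_L1 M f"
proof -
  obtain Cr where Cr: "0 \<le> Cr" "\<And>f. integrable M f \<Longrightarrow> norm_L1 M (int_op M res_kernel f) \<le> Cr * norm_L1 M f"
    using int_op_L1[OF res_kernel_L1inf] by blast
  define Cq where "Cq = \<bar>B\<bar>"
  have Cq: "0 \<le> Cq" "\<And>f. integrable M f \<Longrightarrow> norm_L1 M (\<lambda>x. q x * f x) \<le> Cq * norm_L1 M f"
    using q_mult_norm_le by (simp_all add: Cq_def)
  have "norm_L1 M (sol f) \<le> (1 + Cq * Cr) * norm_L1 M f" if f: "integrable M f" for f
  proof -
    note R = int_op_integrable[OF res_kernel_L1inf f]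
    have "norm_L1 M (sol f) \<le> norm_L1 M f + norm_L1 M (\<lambda>x. q x * int_op M res_kernel f x)"
      unfolding sol_def[abs_def] by (rule norm_L1_add[OF f q_mult_integrable[OF R]])
    also have "norm_L1 M (\<lambda>x. q x * int_op M res_kernel f x) \<le> Cq * (Cr * norm_L1 M f)"
      using Cq(2)[OF R] mult_left_mono[OF Cr(2)[OF f] Cq(1)] by linarith
    finally show ?thesis by (simp add: algebra_simps)
  qed
  with Cr(1) Cq(1) show ?thesis
    by (intro exI[of _ "1 + Cq * Cr"]) auto
qed

end

section \<open>Weights adapted to structural sets\<close>

text \<open>The definition extends a path at its end; an induction over the starting point has to
  peel off the first step instead.\<close>

lemma phi_iter_Suc_head: "phi_iter N h S (Suc n) x = (\<Union>y\<in>phi N h S x. phi_iter N h S n y)"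
  by (induction n) (simp, auto)

lemma layer_mono: "m \<le> n \<Longrightarrow> layer N L S m \<subseteq> layer N L S n"
  by (rule lift_Suc_mono_le) auto

lemma layer_Least:
  assumes "z \<in> layer N L S m"
  shows "z \<in> layer N L S (LEAST m. z \<in> layer N L S m)" "(LEAST m. z \<in> layer N L S m) \<le> m"
  using assms by (auto intro: LeastI Least_le)

section \<open>Layers, levels and domination for type B kernels\<close>

context sigma_finite_measure
begin

text \<open>The averages of g, cut off to A, over sets of finite positive measure lie in the closed
  ball of radius c, and hence so do almost all values.\<close>

lemma density_cmod_le:
  fixes g :: "'a \<Rightarrow> complex"
  assumes g: "integrable M g" and A[measurable]: "A \<in> sets M" and c: "0 \<le> c"
    and le: "\<And>B. B \<in> sets M \<Longrightarrow> B \<subseteq> A \<Longrightarrow> ennreal (cmod (LINT y:B|M. g y)) \<le> ennreal c * emeasure M B"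
  shows "AE y in M. y \<in> A \<longrightarrow> cmod (g y) \<le> c"
proof -
  have "AE y in M. indicator A y *\<^sub>R g y \<in> cball 0 c"
  proof (rule averaging_theorem)
    show "integrable M (\<lambda>y. indicator A y *\<^sub>R g y)"
      using g by (simp add: integrable_mult_indicator)
    fix E assume E[measurable]: "E \<in> sets M" and pos: "0 < measure M E"
    \<comment> \<open>Positivity of the real-valued \<open>measure\<close> excludes infinite
      \<open>emeasure\<close>, for which \<open>measure\<close> is 0.\<close>
    then have fin: "emeasure M E = ennreal (measure M E)"
      by (metis emeasure_eq_ennreal_measure less_irrefl measure_def enn2real_top)
    have "(LINT y:E|M. indicator A y *\<^sub>R g y) = (LINT y:E \<inter> A|M. g y)"
      unfolding set_lebesgue_integral_def by (simp only: scaleR_scaleR indicator_inter_arith)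
    then have "ennreal (cmod (LINT y:E|M. indicator A y *\<^sub>R g y)) \<le> ennreal c * emeasure M (E \<inter> A)"
      using le[of "E \<inter> A"] by simp
    also have "\<dots> \<le> ennreal c * emeasure M E"
      by (intro mult_left_mono emeasure_mono) auto
    also have "\<dots> = ennreal (c * measure M E)"
      using c fin by (simp add: ennreal_mult)
    finally have "cmod (LINT y:E|M. indicator A y *\<^sub>R g y) \<le> c * measure M E"
      using c by (simp add: ennreal_le_iff)
    then show "(1 / measure M E) *\<^sub>R (LINT y:E|M. indicator A y *\<^sub>R g y) \<in> cball 0 c"
      using pos by (simp add: field_simps)
  qed auto
  then show ?thesis
    by eventually_elim auto
qed

text \<open>Zero variation is tested on partitions with the two pieces B and A - B only. This makes
  the integral over every B inside A vanish, and the density bound with c = 0 applies.\<close>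

lemma total_variation_eq_0_iff:
  fixes g :: "'a \<Rightarrow> complex"
  assumes g: "integrable M g" and \<nu>: "\<And>B. B \<in> sets M \<Longrightarrow> \<nu> B = (LINT y:B|M. g y)"
    and A[measurable]: "A \<in> sets M"
  shows "total_variation M \<nu> A = 0 \<longleftrightarrow> (AE y in M. y \<in> A \<longrightarrow> g y = 0)"
proof
  assume tv: "total_variation M \<nu> A = 0"
  have "AE y in M. y \<in> A \<longrightarrow> cmod (g y) \<le> 0"
  proof (rule density_cmod_le[OF g A])
    fix B assume B: "B \<in> sets M" "B \<subseteq> A"
    define P :: "nat \<Rightarrow> 'a set" where "P = (\<lambda>n. {})(0 := B, 1 := A - B)"
    have "P \<in> {P. range P \<subseteq> sets M \<and> disjoint_family P \<and> (\<Union>i. P i) = A}"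
      using A B by (auto simp: P_def disjoint_family_on_def)
    then have "(\<Sum>i. ennreal (cmod (\<nu> (P i)))) \<le> total_variation M \<nu> A"
      unfolding total_variation_def by (rule SUP_upper)
    then have "(\<Sum>i. ennreal (cmod (\<nu> (P i)))) = 0"
      using tv by simp
    then have "ennreal (cmod (\<nu> (P 0))) = 0"
      by (metis ennreal_suminf_lessD not_less zero_less_iff_neq_zero le_zero_eq order.refl)
    then show "ennreal (cmod (LINT y:B|M. g y)) \<le> ennreal 0 * emeasure M B"
      using B \<nu> by (simp add: P_def)
  qed simp
  then show "AE y in M. y \<in> A \<longrightarrow> g y = 0"
    by eventually_elim auto
next
  assume ae: "AE y in M. y \<in> A \<longrightarrow> g y = 0"
  have z: "\<nu> B = 0" if "B \<in> sets M" "B \<subseteq> A" for B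
  proof -
    have "(LINT y:B|M. g y) = 0"
      unfolding set_lebesgue_integral_def
      by (rule integral_eq_zero_AE) (use ae in eventually_elim, use that in \<open>auto simp: indicator_def\<close>)
    then show ?thesis using \<nu> that by simp
  qed
  have "(\<Sum>i. ennreal (cmod (\<nu> (P i)))) = 0"
    if "range P \<subseteq> sets M" "(\<Union>i. P i) = A" for P :: "nat \<Rightarrow> 'a set"
  proof -
    have "\<nu> (P i) = 0" for i using that by (intro z) auto
    then show ?thesis by simp
  qed
  then have "total_variation M \<nu> A \<le> 0"
    unfolding total_variation_def by (intro SUP_least) (metis (mono_tags, lifting) mem_Collect_eq order.refl)
  then show "total_variation M \<nu> A = 0"
    by simp
qed

lemma kernel_1infD:
  assumes "kernel_1inf M L l"
  shows "l \<in> L1inf M" "case_prod l \<in> borel_measurable (M \<Otimes>\<^sub>M M)"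
    and "x \<in> space M \<Longrightarrow> integrable M (l x)"
    and "x \<in> space M \<Longrightarrow> B \<in> sets M \<Longrightarrow> L x B = (LINT y:B|M. l x y)"
  using assms L1infD(1) unfolding kernel_1inf_def by auto

lemma layer_Suc_iff:
  assumes L: "kernel_1inf M L l" and m: "layer M L S m \<in> sets M" and x: "x \<in> space M"
  shows "x \<in> layer M L S (Suc m) \<longleftrightarrow>
    x \<in> layer M L S m \<or> (AE y in M. y \<notin> layer M L S m \<longrightarrow> l x y = 0)"
proof -
  have "total_variation M (L x) (space M - layer M L S m) = 0
      \<longleftrightarrow> (AE y in M. y \<in> space M - layer M L S m \<longrightarrow> l x y = 0)"
    using kernel_1infD[OF L] x m by (intro total_variation_eq_0_iff) auto
  also have "\<dots> \<longleftrightarrow> (AE y in M. y \<notin> layer M L S m \<longrightarrow> l x y = 0)"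
    by (rule AE_cong) simp
  finally show ?thesis using x by auto
qed

text \<open>Total variation is a supremum over uncountably many partitions, so measurability in x
  cannot be seen from the definition. The vanishing of the integral of |l x y| over the complement
  of the previous layer is measurable in x.\<close>

lemma layer_sets:
  assumes L: "kernel_1inf M L l" and S: "S \<in> sets M"
  shows "layer M L S m \<in> sets M"
proof (induction m)
  case (Suc m)
  note Suc[measurable] kernel_1infD(2)[OF L, measurable]
  have "layer M L S (Suc m) = layer M L S m \<union>
      {x\<in>space M. (\<integral>\<^sup>+y. ennreal (cmod (l x y)) * indicator (space M - layer M L S m) y \<partial>M) = 0}"
  proof -
    have "x \<in> layer M L S (Suc m) \<longleftrightarrow> x \<in> layer M L S m \<or>
       (\<integral>\<^sup>+y. ennreal (cmod (l x y)) * indicator (space M - layer M L S m) y \<partial>M) = 0"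
      if x[measurable]: "x \<in> space M" for x
      unfolding layer_Suc_iff[OF L Suc x]
      by (subst nn_integral_0_iff_AE, measurable, intro disj_cong refl AE_cong) (auto simp: indicator_def)
    moreover have "layer M L S m \<subseteq> space M"
      by (rule sets.sets_into_space[OF Suc])
    ultimately show ?thesis by auto
  qed
  then show ?case by simp
qed (simp add: S)

lemma layer_zero:
  assumes L: "kernel_1inf M L l" and S: "S \<in> sets M"
    and x: "x \<in> layer M L S (Suc m)" "x \<notin> layer M L S m"
  shows "AE y in M. y \<notin> layer M L S m \<longrightarrow> l x y = 0"
proof -
  have "x \<in> space M"
    using sets.sets_into_space[OF layer_sets[OF L S]] x(1) by blast
  then show ?thesis
    using layer_Suc_iff[OF L layer_sets[OF L S]] x by blast
qed

text \<open>\<open>phi\<close> works with pointwise supports and the layers with almost-everywhere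
  vanishing, hence an implication in one direction. A point y off S with \<open>l x y\<close>
  nonzero is the first step of a path from x, so its own iterates are empty after n steps and the
  induction hypothesis puts it into layer n.\<close>

lemma phi_iter_empty_layer:
  assumes L: "kernel_1inf M L l" and S: "S \<in> sets M"
  shows "x \<in> space M - S \<Longrightarrow> phi_iter M l S n x = {} \<Longrightarrow> x \<in> layer M L S n"
proof (induction n arbitrary: x)
  case (Suc n)
  have "l x y = 0" if y: "y \<in> space M" "y \<notin> layer M L S n" for y
  proof (rule ccontr)
    assume "l x y \<noteq> 0"
    moreover have "y \<notin> S" using y layer_mono[of 0 n M L S] by auto
    ultimately have "y \<in> phi M l S x" using y by (auto simp: phi_def)
    then have "phi_iter M l S n y = {}"
      using Suc.prems(2) unfolding phi_iter_Suc_head by blast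
    then show False
      using Suc.IH[of y] y \<open>y \<notin> S\<close> by blast
  qed
  then have "AE y in M. y \<notin> layer M L S n \<longrightarrow> l x y = 0"
    by (intro AE_I2) blast
  then show ?case
    using layer_Suc_iff[OF L layer_sets[OF L S]] Suc.prems(1) by blast
qed simp

lemma structural_B_layer:
  assumes L: "kernel_1inf M L l" and S: "S \<in> sets M" and B: "structural_B M L l S"
    and x: "x \<in> space M"
  shows "\<exists>m. x \<in> layer M L S m"
proof (cases "x \<in> S")
  case True
  then show ?thesis by (intro exI[of _ 0]) simp
next
  case False
  then obtain n where "phi_iter M l S n x = {}"
    using B x unfolding structural_B_def by blast
  then show ?thesis
    using phi_iter_empty_layer[OF L S] x False by blast
qed

text \<open>The level is the index of the first layer containing the point. A point off S has level
  j + 1 for some j, and by the definition of layers its row vanishes almost everywhere outside layer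
  j, so the points that it charges have level at most j.\<close>

lemma structural_B_level:
  assumes L: "kernel_1inf M L l" and S: "S \<in> sets M" and B: "structural_B M L l S"
  shows "\<exists>lev :: 'a \<Rightarrow> nat. lev \<in> measurable M (count_space UNIV) \<and>
    (\<forall>x\<in>space M - S. AE y in M. l x y \<noteq> 0 \<longrightarrow> lev y < lev x)"
proof (intro exI[of _ "\<lambda>x. LEAST m. x \<in> layer M L S m"] conjI ballI)
  note layer_sets[OF L S, measurable]
  show "(\<lambda>x. LEAST m. x \<in> layer M L S m) \<in> measurable M (count_space UNIV)"
    by measurable
  fix x assume x: "x \<in> space M - S"
  define k where "k = (LEAST m. x \<in> layer M L S m)"
  obtain m where m: "x \<in> layer M L S m"
    using structural_B_layer[OF L S B, of x] x by blast
  have k: "x \<in> layer M L S k"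
    unfolding k_def using m by (rule layer_Least)
  then obtain j where j: "k = Suc j"
    using x by (cases k) auto
  have "x \<notin> layer M L S j"
    using not_less_Least[of j "\<lambda>m. x \<in> layer M L S m"] j k_def by auto
  then have "AE y in M. y \<notin> layer M L S j \<longrightarrow> l x y = 0"
    using k j by (intro layer_zero[OF L S]) auto
  then show "AE y in M. l x y \<noteq> 0 \<longrightarrow> (LEAST m. y \<in> layer M L S m) < (LEAST m. x \<in> layer M L S m)"
    unfolding k_def[symmetric] j
    by eventually_elim (auto simp: less_Suc_eq_le intro: layer_Least)
qed

text \<open>Off S the number \<open>n_S\<close> is at least 1, because the zeroth iterate is the
  nonempty set {x}; integrability of \<open>n_S\<close> times the bound therefore contains
  integrability of the bound itself, which is then extended by 0 to S.\<close>

lemma structural_B_dominated: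
  assumes L: "kernel_1inf M L l" and S: "S \<in> sets M" and B: "structural_B M L l S"
  shows "\<exists>D :: 'a \<Rightarrow> real. integrable M D \<and> (\<forall>x. 0 \<le> D x) \<and>
    (\<forall>x\<in>space M - S. AE y in M. y \<notin> S \<longrightarrow> cmod (l x y) \<le> D x)"
proof -
  obtain D :: "'a \<Rightarrow> real" where
    D: "D \<in> borel_measurable (restrict_space M (space M - S))" "\<forall>x\<in>space M - S. D x \<ge> 0"
      "\<forall>x\<in>space M - S. \<forall>B\<in>sets M. B \<subseteq> space M - S \<longrightarrow>
           ennreal (cmod (L x B)) \<le> ennreal (D x) * emeasure M B"
      "(\<integral>\<^sup>+x\<in>space M - S. ennreal (real (n_S M l S x) * D x) \<partial>M) < \<infinity>"
    and ex: "\<forall>x\<in>space M - S. \<exists>n. phi_iter M l S n x = {}"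
    using B unfolding structural_B_def by blast
  define D' where "D' x = indicator (space M - S) x *\<^sub>R D x" for x
  have [measurable]: "D' \<in> borel_measurable M"
    using D(1) S unfolding D'_def[abs_def] by (subst (asm) borel_measurable_restrict_space_iff) auto
  have n_S: "1 \<le> n_S M l S x" if "x \<in> space M - S" for x
  proof (rule ccontr)
    assume "\<not> 1 \<le> n_S M l S x"
    then have "n_S M l S x = 0" by simp
    moreover have "phi_iter M l S (n_S M l S x) x = {}"
      unfolding n_S_def using ex that by (metis (mono_tags, lifting) LeastI_ex)
    ultimately show False by simp
  qed
  have "(\<integral>\<^sup>+x. ennreal (cmod (complex_of_real (D' x))) \<partial>M) \<le> (\<integral>\<^sup>+x\<in>space M - S. ennreal (real (n_S M l S x) * D x) \<partial>M)"
  proof (rule nn_integral_mono)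
    fix x assume "x \<in> space M"
    have "D x \<le> real (n_S M l S x) * D x" if x: "x \<in> space M - S"
      using mult_right_mono[of 1 "real (n_S M l S x)" "D x"] n_S[OF x] D(2) x by auto
    then show "ennreal (cmod (complex_of_real (D' x))) \<le> ennreal (real (n_S M l S x) * D x) * indicator (space M - S) x"
      using D(2) by (auto simp: D'_def indicator_def intro!: ennreal_leI)
  qed
  also have "\<dots> < \<infinity>" by fact
  finally have "integrable M D'"
    by (intro integrableI_bounded) auto
  moreover have "0 \<le> D' x" for x
    using D(2) by (auto simp: D'_def indicator_def)
  moreover have "AE y in M. y \<notin> S \<longrightarrow> cmod (l x y) \<le> D' x" if x: "x \<in> space M - S" for x
  proof -
    have "AE y in M. y \<in> space M - S \<longrightarrow> cmod (l x y) \<le> D x"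
    proof (rule density_cmod_le)
      fix B assume "B \<in> sets M" "B \<subseteq> space M - S"
      with D(3) x have "ennreal (cmod (L x B)) \<le> ennreal (D x) * emeasure M B"
        by blast
      then show "ennreal (cmod (LINT y:B|M. l x y)) \<le> ennreal (D x) * emeasure M B"
        using kernel_1infD(4)[OF L, of x B] x \<open>B \<in> sets M\<close> by simp
    qed (use x D(2) S kernel_1infD(3)[OF L, of x] in auto)
    then show ?thesis
      using AE_space by eventually_elim (use x in \<open>auto simp: D'_def\<close>)
  qed
  ultimately show ?thesis by blast
qed

text \<open>\<open>E m\<close> is exp (- c s) with s the D-mass of the levels up to m, and the
  integral bound is the discrete form of: the integral of exp (- c t) over t >= s equals exp (- c s)
  / c. The lower bound involves the total mass of D but not the levels, so \<open>lev\<close> may be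
  chosen after D.\<close>

lemma level_weight:
  fixes D :: "'a \<Rightarrow> real" and lev :: "'a \<Rightarrow> nat"
  assumes D: "integrable M D" "\<And>x. 0 \<le> D x"
    and lev[measurable]: "lev \<in> measurable M (count_space UNIV)" and c: "0 < c"
  shows "\<exists>E :: nat \<Rightarrow> real. decseq E \<and> (\<forall>m. exp (- c * (\<integral>x. D x \<partial>M)) \<le> E m \<and> E m \<le> 1) \<and>
    (\<forall>a. (\<integral>\<^sup>+x. ennreal (E (lev x) * D x) * indicator {x. a < lev x} x \<partial>M) \<le> ennreal (E a / c))"
proof -
  have [measurable]: "D \<in> borel_measurable M"
    using D by auto
  define \<Delta> where "\<Delta> i = (\<integral>x. D x * indicator {x. lev x = i} x \<partial>M)" for i
  have i: "integrable M (\<lambda>x. D x * indicator {x. lev x = i} x)" for i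
    by (rule Bochner_Integration.integrable_bound[OF D(1)]) (auto simp: indicator_def)
  have \<Delta>0: "0 \<le> \<Delta> i" for i
    unfolding \<Delta>_def using D(2) by (intro integral_nonneg_AE) auto
  define E where "E m = exp (- c * (\<Sum>i\<le>m. \<Delta> i))" for m
  have dec: "decseq E"
    unfolding E_def using c \<Delta>0 by (intro decseq_SucI) simp
  have le: "(\<Sum>i\<le>m. \<Delta> i) \<le> (\<integral>x. D x \<partial>M)" for m
  proof -
    have "(\<Sum>i\<le>m. \<Delta> i) = (\<integral>x. (\<Sum>i\<le>m. D x * indicator {x. lev x = i} x) \<partial>M)"
      unfolding \<Delta>_def using i by (intro Bochner_Integration.integral_sum[symmetric]) auto
    also have "\<dots> \<le> (\<integral>x. D x \<partial>M)"
    proof (rule integral_mono)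
      fix x
      have "(\<Sum>i\<le>m. D x * indicator {x. lev x = i} x) = D x * (\<Sum>i\<le>m. if i = lev x then 1 else 0)"
        unfolding sum_distrib_left by (intro sum.cong) (auto simp: indicator_def)
      also have "\<dots> \<le> D x"
        using D(2) by simp
      finally show "(\<Sum>i\<le>m. D x * indicator {x. lev x = i} x) \<le> D x" .
    qed (rule Bochner_Integration.integrable_sum, rule i, rule D(1))
    finally show ?thesis .
  qed
  \<comment> \<open>One telescoping step, from exp t >= 1 + t with t =
    \<open>c * \<Delta> (Suc n)\<close>.\<close>
  have t_le: "E (Suc n) * \<Delta> (Suc n) \<le> (E n - E (Suc n)) / c" for n
  proof -
    have "E n = E (Suc n) * exp (c * \<Delta> (Suc n))"
      unfolding E_def by (simp add: exp_add[symmetric] algebra_simps)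
    moreover have "E (Suc n) * (1 + c * \<Delta> (Suc n)) \<le> E (Suc n) * exp (c * \<Delta> (Suc n))"
      by (intro mult_left_mono exp_ge_add_one_self) (simp add: E_def)
    ultimately have "c * (E (Suc n) * \<Delta> (Suc n)) \<le> E n - E (Suc n)"
      by (simp add: algebra_simps)
    then show ?thesis
      using c by (simp add: field_simps)
  qed
  \<comment> \<open>\<open>max a n\<close> absorbs the case n <= a, where the sum has no nonzero
    terms and the right-hand side is 0.\<close>
  have sum_le: "(\<Sum>i\<le>n. if a < i then E i * \<Delta> i else 0) \<le> (E a - E (max a n)) / c" for a n
  proof (induction n)
    case (Suc n)
    show ?case
    proof (cases "a < Suc n")
      case True
      then have "max a n = n" "max a (Suc n) = Suc n" by auto
      then show ?thesis
        using Suc t_le[of n] True by (simp add: diff_divide_distrib)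
    next
      case False
      then have "max a n = max a (Suc n)" by auto
      then show ?thesis using Suc False by simp
    qed
  qed simp
  have "(\<integral>\<^sup>+x. ennreal (E (lev x) * D x) * indicator {x. a < lev x} x \<partial>M) \<le> ennreal (E a / c)" for a
  proof -
    have "(\<integral>\<^sup>+x. ennreal (E (lev x) * D x) * indicator {x. a < lev x} x \<partial>M)
        = (\<integral>\<^sup>+x. (\<Sum>i. (if a < i then ennreal (E i) else 0) * ennreal (D x * indicator {x. lev x = i} x)) \<partial>M)"
    proof (rule nn_integral_cong)
      fix x
      have "(\<Sum>i. (if a < i then ennreal (E i) else 0) * ennreal (D x * indicator {x. lev x = i} x))
          = (\<Sum>i\<in>{lev x}. (if a < i then ennreal (E i) else 0) * ennreal (D x * indicator {x. lev x = i} x))"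
        by (rule suminf_finite) auto
      also have "\<dots> = ennreal (E (lev x) * D x) * indicator {x. a < lev x} x"
        using D(2) by (simp add: E_def ennreal_mult indicator_def)
      finally show "ennreal (E (lev x) * D x) * indicator {x. a < lev x} x
        = (\<Sum>i. (if a < i then ennreal (E i) else 0) * ennreal (D x * indicator {x. lev x = i} x))" ..
    qed
    also have "\<dots> = (\<Sum>i. \<integral>\<^sup>+x. (if a < i then ennreal (E i) else 0) * ennreal (D x * indicator {x. lev x = i} x) \<partial>M)"
      by (rule nn_integral_suminf) measurable
    also have "\<dots> = (\<Sum>i. ennreal (if a < i then E i * \<Delta> i else 0))"
    proof (rule suminf_cong)
      fix i
      have "(\<integral>\<^sup>+x. ennreal (D x * indicator {x. lev x = i} x) \<partial>M) = ennreal (\<Delta> i)"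
        unfolding \<Delta>_def using i D(2) by (intro nn_integral_eq_integral) auto
      then show "(\<integral>\<^sup>+x. (if a < i then ennreal (E i) else 0) * ennreal (D x * indicator {x. lev x = i} x) \<partial>M)
          = ennreal (if a < i then E i * \<Delta> i else 0)"
        using \<Delta>0 by (subst nn_integral_cmult) (auto simp: ennreal_mult E_def)
    qed
    also have "\<dots> \<le> ennreal (E a / c)"
    proof (rule suminf_le_const[OF summableI])
      fix n
      have "(\<Sum>i<n. ennreal (if a < i then E i * \<Delta> i else 0)) \<le> (\<Sum>i\<le>n. ennreal (if a < i then E i * \<Delta> i else 0))"
        by (rule sum_mono2) auto
      also have "\<dots> = ennreal (\<Sum>i\<le>n. if a < i then E i * \<Delta> i else 0)"
        using \<Delta>0 by (intro sum_ennreal) (simp add: E_def)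
      also have "\<dots> \<le> ennreal (E a / c)"
      proof (rule ennreal_leI)
        have "(E a - E (max a n)) / c \<le> E a / c"
          using c by (intro divide_right_mono) (auto simp: E_def)
        then show "(\<Sum>i\<le>n. if a < i then E i * \<Delta> i else 0) \<le> E a / c"
          using sum_le[of a n] by linarith
      qed
      finally show "(\<Sum>i<n. ennreal (if a < i then E i * \<Delta> i else 0)) \<le> ennreal (E a / c)" .
    qed
    finally show ?thesis .
  qed
  moreover have "exp (- c * (\<integral>x. D x \<partial>M)) \<le> E m" "E m \<le> 1" for m
    using le[of m] c \<Delta>0 by (auto simp: E_def sum_nonneg)
  ultimately show ?thesis
    using dec by blast
qed

end

section \<open>A contracting weight for quasi-B kernels\<close>

context sigma_finite_measure
begin

lemma norm_1inf_le:
  assumes "norm_1inf M k \<le> ennreal C" "y \<in> space M"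
  shows "(\<integral>\<^sup>+x. ennreal (cmod (k x y)) \<partial>M) \<le> ennreal C"
  using assms(1) SUP_upper[OF assms(2), of "\<lambda>y. \<integral>\<^sup>+x. ennreal (cmod (k x y)) \<partial>M"]
  unfolding norm_1inf_def by order

lemma B_approximation_close:
  assumes B: "B_approximation M h S Kn hn" and "0 < e"
  shows "\<exists>n. norm_1inf M (\<lambda>x y. h x y - hn n x y) \<le> ennreal e"
proof -
  have "(\<lambda>n. norm_1inf M (\<lambda>x y. h x y - hn n x y)) \<longlonglongrightarrow> 0"
    using B by (simp add: B_approximation_def)
  then have "\<forall>\<^sub>F n in sequentially. norm_1inf M (\<lambda>x y. h x y - hn n x y) < ennreal e"
    using \<open>0 < e\<close> by (intro order_tendstoD) auto
  then obtain n where "norm_1inf M (\<lambda>x y. h x y - hn n x y) < ennreal e"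
    by (auto simp: eventually_sequentially)
  then show ?thesis by (auto intro: less_imp_le)
qed

text \<open>With \<open>n\<^sub>1\<close> chosen first, \<open>D\<close> dominating \<open>h\<^sub>1\<close> and then a much better approximation \<open>h\<^sub>2\<close>,
  the pointwise bound
  \<open>\<bar>h\<bar> \<le> 1\<^bsub>h\<^sub>2\<noteq>0\<^esub> \<bar>h - h\<^sub>1\<bar> + 1\<^bsub>h\<^sub>2\<noteq>0\<^esub> D(x) + \<bar>h - h\<^sub>2\<bar>\<close> is integrated against a weight that decreases along
  the levels of \<open>h\<^sub>2\<close>. The lower bound of the weight depends on \<open>D\<close> but not on \<open>h\<^sub>2\<close>, so it can absorb the
  last term.\<close>

lemma quasi_B_weight:
  assumes K: "kernel_1inf M K h" and S[measurable]: "S \<in> sets M"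
    and approx: "B_approximation M h S Kn hn" and \<rho>: "0 < \<rho>"
  shows "\<exists>W b. W \<in> borel_measurable M \<and> 0 < b \<and> (\<forall>z. b \<le> W z \<and> W z \<le> 1) \<and>
    (AE y in M. y \<notin> S \<longrightarrow>
      (\<integral>\<^sup>+x. ennreal (W x) * indicator (space M - S) x * ennreal (cmod (h x y)) \<partial>M) \<le> ennreal (\<rho> * W y))"
proof -
  interpret P: pair_sigma_finite M M by (rule pair_sf)
  have kn: "kernel_1inf M (Kn n) (hn n)" "structural_B M (Kn n) (hn n) S" for n
    using approx by (simp_all add: B_approximation_def)
  note kernel_1infD(2)[OF K, measurable]
  obtain n1 where "norm_1inf M (\<lambda>x y. h x y - hn n1 x y) \<le> ennreal (\<rho> / 3)"
    using B_approximation_close[OF approx] \<rho> by (metis divide_pos_pos zero_less_numeral)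
  moreover define h1 where "h1 = hn n1"
  ultimately have n1: "norm_1inf M (\<lambda>x y. h x y - h1 x y) \<le> ennreal (\<rho> / 3)"
    by simp
  have h1: "kernel_1inf M (Kn n1) h1" "structural_B M (Kn n1) h1 S"
    unfolding h1_def by (rule kn)+
  note kernel_1infD(2)[OF h1(1), measurable]
  obtain D :: "'a \<Rightarrow> real" where D: "integrable M D" "\<And>x. 0 \<le> D x"
    and D_le: "\<And>x. x \<in> space M - S \<Longrightarrow> AE y in M. y \<notin> S \<longrightarrow> cmod (h1 x y) \<le> D x"
    using structural_B_dominated[OF h1(1) S h1(2)] by metis
  have [measurable]: "D \<in> borel_measurable M"
    using D by auto
  \<comment> \<open>The target \<open>\<rho> * W y\<close> is divided into three equal shares: h -
    h1 has column norm at most \<open>\<rho> / 3\<close>; the choice of c turns E / c into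
    \<open>\<rho> / 3\<close> times the weight; and h - h2 is made smaller than
    \<open>\<rho> / 3 * b\<close>, where b bounds the weight from below.\<close>
  define c where "c = 3 / \<rho>"
  define b where "b = exp (- c * (\<integral>x. D x \<partial>M))"
  have c: "0 < c" using \<rho> by (simp add: c_def)
  have b: "0 < b" by (simp add: b_def)
  obtain n2 where "norm_1inf M (\<lambda>x y. h x y - hn n2 x y) \<le> ennreal (\<rho> / 3 * b)"
    using B_approximation_close[OF approx] \<rho> b by (metis divide_pos_pos zero_less_numeral mult_pos_pos)
  moreover define h2 where "h2 = hn n2"
  ultimately have n2: "norm_1inf M (\<lambda>x y. h x y - h2 x y) \<le> ennreal (\<rho> / 3 * b)"
    by simp
  have h2: "kernel_1inf M (Kn n2) h2" "structural_B M (Kn n2) h2 S"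
    unfolding h2_def by (rule kn)+
  note kernel_1infD(2)[OF h2(1), measurable]
  obtain lev :: "'a \<Rightarrow> nat" where lev[measurable]: "lev \<in> measurable M (count_space UNIV)"
    and lev_less: "\<And>x. x \<in> space M - S \<Longrightarrow> AE y in M. h2 x y \<noteq> 0 \<longrightarrow> lev y < lev x"
    using structural_B_level[OF h2(1) S h2(2)] by metis
  obtain E :: "nat \<Rightarrow> real" where E: "decseq E" "\<And>m. b \<le> E m" "\<And>m. E m \<le> 1"
    and E_int: "\<And>a. (\<integral>\<^sup>+x. ennreal (E (lev x) * D x) * indicator {x. a < lev x} x \<partial>M) \<le> ennreal (E a / c)"
    using level_weight[OF D lev c] unfolding b_def[symmetric] by blast
  define W where "W x = E (lev x)" for x
  have [measurable]: "W \<in> borel_measurable M"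
    unfolding W_def[abs_def] by measurable
  have W0: "0 \<le> W x" for x
    using E(2)[of "lev x"] b by (simp add: W_def)
  define I where "I x = (indicator (space M - S) x :: ennreal)" for x
  have I[measurable]: "I \<in> borel_measurable M"
    unfolding I_def[abs_def] by measurable
  have I_cases: "I x = 0 \<or> I x = 1" for x
    by (simp add: I_def indicator_def)
  \<comment> \<open>Domination and level drop are known for each row x and almost every y, while the
    estimate concerns columns. As one measurable condition on the product they allow the two
    almost-everywhere quantifiers to be exchanged.\<close>
  define good where "good x y \<longleftrightarrow> x \<in> S \<or>
    ((y \<notin> S \<longrightarrow> cmod (h1 x y) \<le> D x) \<and> (h2 x y \<noteq> 0 \<longrightarrow> real (lev y) < real (lev x)))" for x y
  have "AE x in M. AE y in M. good x y"
    using AE_space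
  proof eventually_elim
    case (elim x)
    show ?case
    proof (cases "x \<in> S")
      case False
      then have "x \<in> space M - S" using elim by simp
      from D_le[OF this] lev_less[OF this] show ?thesis
        by eventually_elim (simp add: good_def)
    qed (simp add: good_def)
  qed
  moreover have "{p \<in> space (M \<Otimes>\<^sub>M M). good (fst p) (snd p)} \<in> sets (M \<Otimes>\<^sub>M M)"
    unfolding good_def by measurable
  ultimately have good: "AE y in M. AE x in M. good x y"
    using P.AE_commute[of good] by blast
  have "AE y in M. y \<notin> S \<longrightarrow>
      (\<integral>\<^sup>+x. ennreal (W x) * indicator (space M - S) x * ennreal (cmod (h x y)) \<partial>M) \<le> ennreal (\<rho> * W y)"
    using good AE_space
  proof eventually_elim
    case (elim y)
    note y[measurable] = elim(2)
    have [measurable]: "(\<lambda>x. h x y) \<in> borel_measurable M" "(\<lambda>x. h1 x y) \<in> borel_measurable M"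
      "(\<lambda>x. h2 x y) \<in> borel_measurable M"
      by measurable
    show ?case
    proof
      assume yS: "y \<notin> S"
      let ?t1 = "\<lambda>x. ennreal (W y) * ennreal (cmod (h x y - h1 x y))"
      let ?t2 = "\<lambda>x. ennreal (E (lev x) * D x) * indicator {x. lev y < lev x} x"
      let ?t3 = "\<lambda>x. ennreal (cmod (h x y - h2 x y))"
      have "(\<integral>\<^sup>+x. ennreal (W x) * I x * ennreal (cmod (h x y)) \<partial>M)
          \<le> (\<integral>\<^sup>+x. ?t1 x + ?t2 x + ?t3 x \<partial>M)"
      proof (rule nn_integral_mono_AE)
        show "AE x in M. ennreal (W x) * I x * ennreal (cmod (h x y)) \<le> ?t1 x + ?t2 x + ?t3 x"
          using elim(1)
        proof eventually_elim
          case (elim x)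
          show ?case
          proof (cases "I x = 0")
            case False
            then have Ix: "I x = 1" and xS: "x \<notin> S"
              using I_cases[of x] by (auto simp: I_def)
            have Wx: "0 \<le> W x" "W x \<le> 1" "0 \<le> W y" using W0 E(3) by (auto simp: W_def)
            show ?thesis
            proof (cases "h2 x y = 0")
              case True
              have "W x * cmod (h x y) \<le> 1 * cmod (h x y)"
                using Wx by (intro mult_right_mono) auto
              then have "ennreal (W x) * I x * ennreal (cmod (h x y)) \<le> ?t3 x"
                using Wx True Ix by (simp add: ennreal_mult[symmetric] ennreal_leI)
              also have "\<dots> \<le> ?t1 x + ?t2 x + ?t3 x" by simp
              finally show ?thesis .
            next
              case False
              then have l: "lev y < lev x" and d: "cmod (h1 x y) \<le> D x"
                using elim xS yS by (auto simp: good_def)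
              have "W x \<le> W y"
                using E(1) l by (simp add: W_def decseq_def)
              have "cmod (h x y) \<le> cmod (h x y - h1 x y) + cmod (h1 x y)"
                using norm_triangle_ineq[of "h x y - h1 x y" "h1 x y"] by simp
              then have "W x * cmod (h x y) \<le> W x * (cmod (h x y - h1 x y) + D x)"
                using d Wx by (intro mult_left_mono) auto
              also have "\<dots> \<le> W y * cmod (h x y - h1 x y) + E (lev x) * D x"
                unfolding distrib_left using \<open>W x \<le> W y\<close>
                by (intro add_mono mult_right_mono) (auto simp: W_def D(2))
              finally have "ennreal (W x * cmod (h x y)) \<le> ennreal (W y * cmod (h x y - h1 x y) + E (lev x) * D x)"
                by (rule ennreal_leI)
              also have "\<dots> = ?t1 x + ?t2 x"
                using Wx D(2) l by (simp add: ennreal_mult W_def)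
              finally have "ennreal (W x) * I x * ennreal (cmod (h x y)) \<le> ?t1 x + ?t2 x"
                using Wx Ix by (simp add: ennreal_mult)
              also have "\<dots> \<le> ?t1 x + ?t2 x + ?t3 x" by simp
              finally show ?thesis .
            qed
          qed simp
        qed
      qed
      also have "\<dots> = (\<integral>\<^sup>+x. ?t1 x \<partial>M) + (\<integral>\<^sup>+x. ?t2 x \<partial>M) + (\<integral>\<^sup>+x. ?t3 x \<partial>M)"
      proof -
        have "(\<lambda>x. E (lev x) :: real) \<in> borel_measurable M"
          "(\<lambda>x. indicator {i. lev y < i} (lev x) :: ennreal) \<in> borel_measurable M"
          by (rule measurable_compose[OF lev], simp)+
        then have "?t2 \<in> borel_measurable M"
          by (simp add: indicator_def) measurable
        moreover have "?t1 \<in> borel_measurable M" "?t3 \<in> borel_measurable M"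
          by measurable
        ultimately show ?thesis
          by (simp only: nn_integral_add borel_measurable_add)
      qed
      also have "\<dots> \<le> ennreal (W y) * ennreal (\<rho> / 3) + ennreal (E (lev y) / c) + ennreal (\<rho> / 3 * b)"
      proof (intro add_mono E_int)
        show "(\<integral>\<^sup>+x. ?t1 x \<partial>M) \<le> ennreal (W y) * ennreal (\<rho> / 3)"
          by (subst nn_integral_cmult, measurable) (intro mult_left_mono norm_1inf_le[OF n1 y] zero_le)
        show "(\<integral>\<^sup>+x. ?t3 x \<partial>M) \<le> ennreal (\<rho> / 3 * b)"
          by (rule norm_1inf_le[OF n2 y])
      qed
      also have "\<dots> = ennreal (W y * (\<rho> / 3) + E (lev y) / c + \<rho> / 3 * b)"
        using W0[of y] \<rho> b c by (simp add: ennreal_mult[symmetric] W_def)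
      also have "\<dots> \<le> ennreal (\<rho> * W y)"
      proof (rule ennreal_leI)
        have "\<rho> / 3 * b \<le> \<rho> / 3 * W y"
          using E(2)[of "lev y"] \<rho> by (intro mult_left_mono) (auto simp: W_def)
        moreover have "E (lev y) / c = \<rho> / 3 * W y"
          using \<rho> by (simp add: c_def W_def)
        ultimately show "W y * (\<rho> / 3) + E (lev y) / c + \<rho> / 3 * b \<le> \<rho> * W y"
          by (simp add: algebra_simps)
      qed
      finally show "(\<integral>\<^sup>+x. ennreal (W x) * indicator (space M - S) x * ennreal (cmod (h x y)) \<partial>M) \<le> ennreal (\<rho> * W y)"
        by (simp only: I_def)
    qed
  qed
  moreover have "\<forall>z. b \<le> W z \<and> W z \<le> 1"
    using E by (simp add: W_def)
  ultimately show ?thesis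
    using b \<open>W \<in> borel_measurable M\<close> by blast
qed

end

section \<open>The reduced kernel as a resolvent kernel\<close>

text \<open>Elements of L^1(S) are represented by functions on the whole type with arbitrary values
  off S. Extension by zero discards these values and turns integrals over S into integrals over
  V.\<close>

definition zero_ext :: "'a set \<Rightarrow> ('a \<Rightarrow> complex) \<Rightarrow> 'a \<Rightarrow> complex" where
  "zero_ext S f x = indicator S x * f x"

lemma zero_ext_simps [simp]: "x \<in> S \<Longrightarrow> zero_ext S f x = f x" "x \<notin> S \<Longrightarrow> zero_ext S f x = 0"
  by (simp_all add: zero_ext_def)

lemma zero_ext_scaleR: "zero_ext S f = (\<lambda>x. indicator S x *\<^sub>R f x)"
  by (auto simp: zero_ext_def indicator_def)

lemma L1_restrict_iff:
  assumes "S \<in> sets N"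
  shows "f \<in> L1 (restrict_space N S) \<longleftrightarrow> integrable N (zero_ext S f)"
  unfolding L1_def zero_ext_scaleR using assms by (simp add: integrable_restrict_space)

lemma norm_L1_restrict:
  assumes "S \<in> sets N"
  shows "norm_L1 (restrict_space N S) f = norm_L1 N (zero_ext S f)"
  unfolding norm_L1_def using assms
  by (subst integral_restrict_space) (auto intro!: Bochner_Integration.integral_cong simp: zero_ext_def indicator_def)

lemma AE_restrict_iff:
  assumes "S \<in> sets N"
  shows "(AE x in restrict_space N S. P x) \<longleftrightarrow> (AE x in N. x \<in> S \<longrightarrow> P x)"
  using assms by (intro AE_restrict_space_iff) simp

lemma zero_ext_integrable:
  assumes "S \<in> sets N" "integrable N f"
  shows "integrable N (zero_ext S f)"
  using assms by (simp add: zero_ext_scaleR integrable_mult_indicator)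

lemma norm_L1_zero_ext_le:
  assumes "S \<in> sets N" "integrable N f"
  shows "norm_L1 N (zero_ext S f) \<le> norm_L1 N f"
  unfolding norm_L1_def
proof (rule integral_mono)
  show "cmod (zero_ext S f x) \<le> cmod (f x)" for x
    by (cases "x \<in> S") simp_all
qed (use zero_ext_integrable[OF assms] assms(2) in auto)

lemma Linf_D:
  assumes "d \<in> Linf N"
  shows "d \<in> borel_measurable N" "\<exists>C. \<forall>x\<in>space N. cmod (d x) \<le> C"
  using assms by (auto simp: Linf_def bounded_iff)

text \<open>The indicator builds the restriction to V - S into the factor, so that iterated
  integrals over V - S become compositions of integral operators on all of V.\<close>

definition off_weight :: "'a measure \<Rightarrow> ('a \<Rightarrow> complex) \<Rightarrow> 'a set \<Rightarrow> complex \<Rightarrow> 'a \<Rightarrow> complex" where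
  "off_weight N d S \<zeta> z = indicator (space N - S) z * (1 / (\<zeta> - d z))"

text \<open>Staying off the closure, and not merely off the range of d, is what bounds 1 /
  (\<open>\<zeta>\<close> - d) on V - S.\<close>

lemma off_Sigma_d:
  assumes "\<zeta> \<notin> Sigma_d N d S"
  shows "\<exists>\<delta>>0. \<forall>z\<in>space N - S. \<delta> \<le> cmod (\<zeta> - d z)"
proof -
  obtain \<delta> where "\<delta> > 0" and \<delta>: "\<not> (\<exists>y\<in>d ` (space N - S). dist y \<zeta> < \<delta>)"
    using assms unfolding Sigma_d_def closure_approachable by blast
  then show ?thesis
    by (intro exI[of _ \<delta>]) (auto simp: dist_norm norm_minus_commute not_less)
qed

locale reduction = contracting_kernel M h q W b Q
  for M :: "'a measure" and h q W b Q +
  fixes K :: "'a \<Rightarrow> 'a set \<Rightarrow> complex" and d :: "'a \<Rightarrow> complex" and S :: "'a set" and \<zeta> :: complex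
  assumes K: "kernel_1inf M K h"
    and d: "d \<in> Linf M"
    and S [measurable]: "S \<in> sets M"
    and \<zeta>: "\<zeta> \<notin> Sigma_d M d S"
    and q_def: "q = off_weight M d S \<zeta>"
begin

lemma d_measurable [measurable]: "d \<in> borel_measurable M"
  using Linf_D[OF d] by blast

lemma q_in [simp]: "x \<in> S \<Longrightarrow> q x = 0"
  by (simp add: q_def off_weight_def)

lemma q_off: "x \<in> space M \<Longrightarrow> x \<notin> S \<Longrightarrow> q x = 1 / (\<zeta> - d x)"
  by (simp add: q_def off_weight_def)

lemma \<zeta>_neq: "x \<in> space M \<Longrightarrow> x \<notin> S \<Longrightarrow> \<zeta> - d x \<noteq> 0"
  using off_Sigma_d[OF \<zeta>] by force

text \<open>Measurability is asked only of the cut-off to A, because f may be a reconstruction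
  stage, whose values off its layer are meaningless. Replacing f by the cut-off first makes the
  density formula applicable.\<close>

lemma cm_integral_kernel:
  assumes "x \<in> space M" "A \<in> sets M" "(\<lambda>y. indicator A y * f y) \<in> borel_measurable M"
  shows "cm_integral M (K x) A f = int_op M h (\<lambda>y. indicator A y * f y) x"
proof -
  have "cm_integral M (K x) A f = cm_integral M (K x) A (\<lambda>y. indicator A y * f y)"
    unfolding cm_integral_def set_lebesgue_integral_def
    by (intro Bochner_Integration.integral_cong) (auto simp: indicator_def)
  also have "\<dots> = (LINT y:A|M. (indicator A y * f y) * h x y)"
    using kernel_1inf_has_density[OF K assms(1)] assms(2,3) sigma_finite_measure_axioms by (rule cm_integral_eq)
  also have "\<dots> = int_op M h (\<lambda>y. indicator A y * f y) x"
    unfolding int_op_def set_lebesgue_integral_def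
    by (intro Bochner_Integration.integral_cong) (auto simp: indicator_def)
  finally show ?thesis .
qed

lemma kernel_operator_eq:
  assumes x: "x \<in> space M" and f: "f \<in> borel_measurable M"
  shows "kernel_operator M d K f x = d x * f x + int_op M h f x"
proof -
  have "cm_integral M (K x) (space M) f = int_op M h (\<lambda>y. indicator (space M) y * f y) x"
    using x f by (intro cm_integral_kernel) auto
  also have "\<dots> = int_op M h f x"
    unfolding int_op_def by (intro Bochner_Integration.integral_cong) auto
  finally show ?thesis by (simp add: kernel_operator_def)
qed

abbreviation chain :: "nat \<Rightarrow> 'a \<Rightarrow> 'a set \<Rightarrow> complex" where
  "chain \<equiv> chain_kernel M K S (\<lambda>z. 1 / (\<zeta> - d z))"

text \<open>Both claims are proved together: rewriting the next chain as an \<open>int_op\<close>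
  needs measurability of the current one, and the rewritten form in turn gives measurability of the
  next.\<close>

lemma chain_Suc_measurable:
  assumes B: "B \<in> sets M"
  shows "(\<forall>x\<in>space M. chain (Suc n) x B = int_op M h (\<lambda>z. q z * chain n z B) x) \<and>
    (\<lambda>x. chain n x B) \<in> borel_measurable M"
proof (induction n)
  case 0
  have 0: "(\<lambda>x. chain 0 x B) \<in> borel_measurable M"
    using K B by (simp add: kernel_1inf_def is_kernel_def)
  note 0[measurable]
  have "chain (Suc 0) x B = int_op M h (\<lambda>z. q z * chain 0 z B) x" if "x \<in> space M" for x
    unfolding chain_kernel.simps
    by (subst cm_integral_kernel[OF that]) (use 0 in \<open>auto simp: q_def off_weight_def[abs_def] mult.assoc\<close>)
  with 0 show ?case by blast
next
  case (Suc n)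
  then have [measurable]: "(\<lambda>x. chain n x B) \<in> borel_measurable M" by blast
  have m: "(\<lambda>x. chain (Suc n) x B) \<in> borel_measurable M"
    using Suc by (subst measurable_cong[where g="int_op M h (\<lambda>z. q z * chain n z B)"]) auto
  have "chain (Suc (Suc n)) x B = int_op M h (\<lambda>z. q z * chain (Suc n) z B) x" if "x \<in> space M" for x
    unfolding chain_kernel.simps(2)[of M K S _ "Suc n"]
    by (subst cm_integral_kernel[OF that]) (use m in \<open>auto simp: q_def off_weight_def[abs_def] mult.assoc simp del: chain_kernel.simps\<close>)
  with m show ?case by blast
qed

lemma chain_Suc:
  "B \<in> sets M \<Longrightarrow> x \<in> space M \<Longrightarrow> chain (Suc n) x B = int_op M h (\<lambda>z. q z * chain n z B) x"
  using chain_Suc_measurable by blast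

lemma chain_measurable: "B \<in> sets M \<Longrightarrow> (\<lambda>x. chain n x B) \<in> borel_measurable M"
  using chain_Suc_measurable by blast

text \<open>Meant for an exhausting sequence of sets of finite measure. The integral of a row of
  \<open>a_total\<close> over the whole space may be infinite, which is why the densities of the
  reduced kernel are handled locally.\<close>

definition fin_on :: "(nat \<Rightarrow> 'a set) \<Rightarrow> 'a \<Rightarrow> bool" where
  "fin_on V x \<longleftrightarrow> (\<forall>j. (\<integral>\<^sup>+y. indicator (V j) y * a_total x y \<partial>M) < \<infinity>)"

lemma AE_fin_on:
  assumes V: "range V \<subseteq> sets M" "\<And>j. emeasure M (V j) \<noteq> \<infinity>"
  shows "AE x in M. fin_on V x"
proof -
  obtain C where C: "\<forall>y\<in>space M. (\<integral>\<^sup>+x. a_total x y \<partial>M) \<le> ennreal C"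
    using a_total_bound by blast
  have "AE x in M. (\<integral>\<^sup>+y. indicator (V j) y * a_total x y \<partial>M) < \<infinity>" for j
  proof (rule nn_kernel_AE_finite[of _ C])
    show "indicator (V j) \<in> borel_measurable M" "(\<integral>\<^sup>+y. indicator (V j) y \<partial>M) < \<infinity>"
      using V by (auto simp: less_top)
  qed (use C in auto)
  then show ?thesis
    unfolding fin_on_def by (simp add: AE_all_countable)
qed

lemma a_iter_le_total: "a_iter n x y \<le> a_total x y"
  unfolding a_total_def using sum_le_suminf[of "\<lambda>n. a_iter n x y" "{n}"] by (simp add: summableI)

text \<open>Fubini exchanges the integration over B with that over the first intermediate point z.
  The induction hypothesis is available only at z satisfying \<open>fin_on\<close>, that is almost
  everywhere, which suffices under the integral.\<close>

lemma chain_density: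
  assumes V: "range V \<subseteq> sets M" "\<And>j. emeasure M (V j) \<noteq> \<infinity>"
    and B[measurable]: "B \<in> sets M" and BV: "B \<subseteq> V j"
  shows "x \<in> space M \<Longrightarrow> fin_on V x \<Longrightarrow> chain n x B = (LINT y:B|M. k_iter n x y)"
proof (induction n arbitrary: x)
  case 0
  then show ?case using kernel_1infD(4)[OF K] B by simp
next
  case (Suc n)
  note x[measurable] = Suc.prems(1)
  have [measurable]: "h x \<in> borel_measurable M" by measurable
  interpret P: pair_sigma_finite M M by (rule pair_sf)
  let ?G = "\<lambda>y z. indicator B y * (q z * k_iter n z y * h x z)"
  have G: "integrable (M \<Otimes>\<^sub>M M) (case_prod ?G)"
  proof (rule integrableI_bounded)
    have "(\<integral>\<^sup>+p. ennreal (cmod (case_prod ?G p)) \<partial>(M \<Otimes>\<^sub>M M)) = (\<integral>\<^sup>+y. (\<integral>\<^sup>+z. ennreal (cmod (?G y z)) \<partial>M) \<partial>M)"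
      by (subst nn_integral_fst[symmetric]) auto
    also have "\<dots> \<le> (\<integral>\<^sup>+y. indicator (V j) y * a_total x y \<partial>M)"
    proof (rule nn_integral_mono)
      fix y assume y: "y \<in> space M"
      have "(\<integral>\<^sup>+z. ennreal (cmod (q z * k_iter n z y * h x z)) \<partial>M) \<le> a_iter (Suc n) x y"
        by (simp add: norm_mult ennreal_mult) (intro nn_integral_mono mult_right_mono mult_left_mono k_iter_le; simp)
      then have "(\<integral>\<^sup>+z. ennreal (cmod (q z * k_iter n z y * h x z)) \<partial>M) \<le> a_total x y"
        using a_iter_le_total[of "Suc n" x y] by (rule order_trans)
      then show "(\<integral>\<^sup>+z. ennreal (cmod (?G y z)) \<partial>M) \<le> indicator (V j) y * a_total x y"
        using BV by (cases "y \<in> B") (auto simp: indicator_def)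
    qed
    also have "\<dots> < \<infinity>"
      using Suc.prems(2) by (simp add: fin_on_def)
    finally show "(\<integral>\<^sup>+p. ennreal (cmod (case_prod ?G p)) \<partial>(M \<Otimes>\<^sub>M M)) < \<infinity>" .
  qed measurable
  note [measurable] = chain_measurable[OF B]
  have "chain (Suc n) x B = (\<integral>z. q z * chain n z B * h x z \<partial>M)"
    using chain_Suc[OF B x] by (simp add: int_op_def del: chain_kernel.simps)
  also have "\<dots> = (\<integral>z. (\<integral>y. ?G y z \<partial>M) \<partial>M)"
  proof (rule integral_cong_AE)
    show "AE z in M. q z * chain n z B * h x z = (\<integral>y. ?G y z \<partial>M)"
      using AE_fin_on[OF V] AE_space
    proof eventually_elim
      case (elim z)
      have "(\<integral>y. ?G y z \<partial>M) = (\<integral>y. (q z * h x z) * (indicator B y *\<^sub>R k_iter n z y) \<partial>M)"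
        by (intro Bochner_Integration.integral_cong) (auto simp: indicator_def)
      also have "\<dots> = (q z * h x z) * (LINT y:B|M. k_iter n z y)"
        unfolding set_lebesgue_integral_def by (rule integral_mult_right_zero)
      finally show ?case
        unfolding Suc.IH[OF elim(2,1)] by (simp only: mult_ac)
    qed
  qed measurable
  also have "\<dots> = (\<integral>y. (\<integral>z. ?G y z \<partial>M) \<partial>M)"
    by (rule P.Fubini_integral[OF G])
  also have "\<dots> = (LINT y:B|M. k_iter (Suc n) x y)"
    unfolding set_lebesgue_integral_def
    by (intro Bochner_Integration.integral_cong) (auto simp: indicator_def int_op_def)
  finally show ?case .
qed

text \<open>The chain densities are summed under the integral over B, with \<open>a_total x\<close>
  as integrable majorant. By the index shifts in \<open>K_iter\<close> and \<open>R_kernel\<close>,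
  summand n is the chain with n intermediate points.\<close>

lemma R_kernel_density:
  assumes V: "range V \<subseteq> sets M" "\<And>j. emeasure M (V j) \<noteq> \<infinity>"
    and B[measurable]: "B \<in> sets M" and BV: "B \<subseteq> V j" and x[measurable]: "x \<in> space M" and fin: "fin_on V x"
  shows "set_integrable M B (res_kernel x)" "R_kernel M d K S \<zeta> x B = (LINT y:B|M. res_kernel x y)"
proof -
  let ?f = "\<lambda>n y. indicator B y *\<^sub>R k_iter n x y"
  have [measurable]: "k_iter n x \<in> borel_measurable M" "a_iter n x \<in> borel_measurable M"
    "a_total x \<in> borel_measurable M" "res_kernel x \<in> borel_measurable M" for n
    by measurable
  have fin': "(\<integral>\<^sup>+y. indicator B y * a_total x y \<partial>M) < \<infinity>"
  proof (rule order_le_less_trans)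
    show "(\<integral>\<^sup>+y. indicator B y * a_total x y \<partial>M) \<le> (\<integral>\<^sup>+y. indicator (V j) y * a_total x y \<partial>M)"
      using BV by (intro nn_integral_mono) (auto simp: indicator_def)
  qed (use fin in \<open>simp add: fin_on_def\<close>)
  have le: "(\<integral>\<^sup>+y. ennreal (cmod (?f n y)) \<partial>M) \<le> (\<integral>\<^sup>+y. indicator B y * a_iter n x y \<partial>M)" for n
    by (intro nn_integral_mono) (auto simp: indicator_def k_iter_le)
  have sum_eq: "(\<Sum>n. \<integral>\<^sup>+y. indicator B y * a_iter n x y \<partial>M) = (\<integral>\<^sup>+y. indicator B y * a_total x y \<partial>M)"
    unfolding a_total_def ennreal_suminf_cmult[symmetric]
    by (rule nn_integral_suminf[symmetric]) measurable
  have i: "integrable M (?f n)" for n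
  proof (rule integrableI_bounded)
    have "(\<integral>\<^sup>+y. ennreal (cmod (?f n y)) \<partial>M) \<le> (\<integral>\<^sup>+y. indicator B y * a_total x y \<partial>M)"
      using le[of n] by (rule order_trans) (intro nn_integral_mono mult_left_mono a_iter_le_total; simp)
    then show "(\<integral>\<^sup>+y. ennreal (cmod (?f n y)) \<partial>M) < \<infinity>"
      using fin' by (rule order_le_less_trans)
  qed measurable
  have AEfin: "AE y in M. y \<in> B \<longrightarrow> a_total x y < \<infinity>"
  proof -
    have "AE y in M. indicator B y * a_total x y \<noteq> \<infinity>"
      using fin' by (intro nn_integral_PInf_AE) (auto simp: less_top)
    then show ?thesis
      by eventually_elim (auto simp: less_top)
  qed
  have sn: "AE y in M. summable (\<lambda>n. norm (?f n y))"
    using AEfin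
  proof eventually_elim
    case (elim y)
    then show ?case
      using res_kernel_summable(1)[of x y] by (cases "y \<in> B") auto
  qed
  have "(\<Sum>n. ennreal (\<integral>y. norm (?f n y) \<partial>M)) \<le> (\<Sum>n. \<integral>\<^sup>+y. indicator B y * a_iter n x y \<partial>M)"
  proof (rule suminf_le)
    fix n
    have "ennreal (\<integral>y. norm (?f n y) \<partial>M) = (\<integral>\<^sup>+y. ennreal (norm (?f n y)) \<partial>M)"
      by (rule nn_integral_eq_integral[OF integrable_norm[OF i], symmetric]) simp
    also note le[of n]
    finally show "ennreal (\<integral>y. norm (?f n y) \<partial>M) \<le> (\<integral>\<^sup>+y. indicator B y * a_iter n x y \<partial>M)" .
  qed auto
  then have si: "summable (\<lambda>n. \<integral>y. norm (?f n y) \<partial>M)"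
    using fin' unfolding sum_eq by (intro summable_suminf_not_top) (auto simp: less_top top_unique)
  have AEsum: "AE y in M. (\<Sum>n. ?f n y) = indicator B y *\<^sub>R res_kernel x y"
  proof (rule AE_I2)
    fix y
    show "(\<Sum>n. ?f n y) = indicator B y *\<^sub>R res_kernel x y"
      by (cases "y \<in> B") (simp_all add: res_kernel_def)
  qed
  have "integrable M (\<lambda>y. \<Sum>n. ?f n y)"
    by (rule integrable_suminf[OF i sn si])
  then show "set_integrable M B (res_kernel x)"
    unfolding set_integrable_def by (rule integrable_cong_AE_imp) (use AEsum in auto)
  have "R_kernel M d K S \<zeta> x B = (\<Sum>n. chain n x B)"
    by (simp add: R_kernel_def K_iter_def)
  also have "\<dots> = (\<Sum>n. integral\<^sup>L M (?f n))"
    using chain_density[OF V B BV x fin] by (simp add: set_lebesgue_integral_def)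
  also have "\<dots> = (\<integral>y. (\<Sum>n. ?f n y) \<partial>M)"
    by (rule integral_suminf[OF i sn si, symmetric])
  also have "\<dots> = (LINT y:B|M. res_kernel x y)"
    unfolding set_lebesgue_integral_def by (rule integral_cong_AE) (use AEsum in auto)
  finally show "R_kernel M d K S \<zeta> x B = (LINT y:B|M. res_kernel x y)" .
qed

text \<open>For almost every x the sets S intersected with V j witness that
  \<open>res_kernel x\<close> is a density of R(x,.) on S. Uniqueness of densities then lets it
  replace the one chosen by \<open>SOME\<close> inside \<open>cm_integral\<close>.\<close>

lemma reduced_operator_eq:
  assumes f: "f \<in> L1 (restrict_space M S)"
  shows "AE x in M. x \<in> S \<longrightarrow> reduced_operator M d K S \<zeta> f x = d x * f x + int_op M res_kernel (zero_ext S f) x"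
proof -
  obtain V :: "nat \<Rightarrow> 'a set" where V: "range V \<subseteq> sets M" "(\<Union>i. V i) = space M"
    "\<And>i. emeasure M (V i) \<noteq> \<infinity>" "incseq V"
    using sigma_finite_incseq by blast
  have sub: "S \<inter> space M = S"
    using sets.sets_into_space[OF S] by blast
  then have sp: "space (restrict_space M S) = S"
    by (simp add: space_restrict_space)
  show ?thesis
    using AE_fin_on[OF V(1,3)] AE_space
  proof eventually_elim
    case (elim x)
    have "has_density (restrict_space M S) (R_kernel M d K S \<zeta> x) (res_kernel x)"
      unfolding has_density_def
    proof (intro exI[of _ "\<lambda>j. S \<inter> V j"] conjI allI ballI impI)
      show "range (\<lambda>j. S \<inter> V j) \<subseteq> sets (restrict_space M S)"
        using V(1) by (auto simp: sets_restrict_space)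
      show "incseq (\<lambda>j. S \<inter> V j)"
        using V(4) by (auto simp: incseq_def)
      show "(\<Union>j. S \<inter> V j) = space (restrict_space M S)"
        unfolding sp using V(2) sub by blast
      fix j B assume B: "B \<in> sets (restrict_space M S)" "B \<subseteq> S \<inter> V j"
      then have BM: "B \<in> sets M" "B \<subseteq> V j"
        using S by (auto simp: sets_restrict_space_iff)
      note den = R_kernel_density[OF V(1,3) BM elim(2,1)]
      have eq: "indicator S y *\<^sub>R (indicator B y *\<^sub>R res_kernel x y) = indicator B y *\<^sub>R res_kernel x y" for y
        using B(2) by (auto simp: indicator_def)
      show "set_integrable (restrict_space M S) B (res_kernel x)"
        using den(1) S unfolding set_integrable_def by (simp add: integrable_restrict_space eq del: scaleR_scaleR)
      show "R_kernel M d K S \<zeta> x B = (LINT y:B|restrict_space M S. res_kernel x y)"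
        using den(2) S unfolding set_lebesgue_integral_def by (simp add: integral_restrict_space eq del: scaleR_scaleR)
    qed
    then have "cm_integral (restrict_space M S) (R_kernel M d K S \<zeta> x) (space (restrict_space M S)) f
        = (LINT y:space (restrict_space M S)|restrict_space M S. f y * res_kernel x y)"
      using f sigma_finite_measure_restrict_space[OF sigma_finite_measure_axioms S]
        sets.top[of "restrict_space M S", unfolded sp]
      by (intro cm_integral_eq) (auto simp: L1_def simp del: space_restrict_space)
    also have "\<dots> = int_op M res_kernel (zero_ext S f) x"
      unfolding set_lebesgue_integral_def int_op_def sp using S
      by (subst integral_restrict_space)
         (auto intro!: Bochner_Integration.integral_cong simp: zero_ext_def indicator_def)
    finally show ?case
      by (simp add: reduced_operator_def kernel_operator_def)
  qed
qed

end

section \<open>Spectral correspondence\<close>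

lemma (in contracting_kernel) sol_cong_AE:
  assumes "integrable M f" "integrable M g" "AE x in M. f x = g x"
  shows "AE x in M. sol f x = sol g x"
  using assms(3) AE_space
proof eventually_elim
  case (elim x)
  have "int_op M res_kernel f x = int_op M res_kernel g x"
    using elim assms by (intro int_op_cong_AE) auto
  then show ?case using elim by (simp add: sol_def)
qed

lemma (in contracting_kernel) sol_zero_AE:
  assumes "integrable M f" "AE x in M. f x = 0"
  shows "AE x in M. sol f x = 0"
proof -
  have "sol (\<lambda>_. 0) x = 0" for x
    by (simp add: sol_def int_op_def)
  then show ?thesis
    using sol_cong_AE[OF assms(1) _ assms(2)] by simp
qed

context reduction
begin

abbreviation full_op :: "('a \<Rightarrow> complex) \<Rightarrow> 'a \<Rightarrow> complex" where
  "full_op \<equiv> kernel_operator M d K"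

abbreviation red_op :: "('a \<Rightarrow> complex) \<Rightarrow> 'a \<Rightarrow> complex" where
  "red_op \<equiv> reduced_operator M d K S \<zeta>"

abbreviation M_S :: "'a measure" where
  "M_S \<equiv> restrict_space M S"

text \<open>The right-hand side of the reduced equation when A u - \<open>\<zeta>\<close> u = g:
  eliminating u off S leaves a term - q g there, which R carries back to S.\<close>

definition source :: "('a \<Rightarrow> complex) \<Rightarrow> 'a \<Rightarrow> complex" where
  "source g x = g x + int_op M res_kernel (\<lambda>x. q x * g x) x"

lemma L1_S: "integrable M u \<Longrightarrow> u \<in> L1 M_S"
  by (simp add: L1_restrict_iff zero_ext_integrable)

lemma source_integrable: "integrable M g \<Longrightarrow> integrable M (source g)"
  unfolding source_def[abs_def]
  by (intro Bochner_Integration.integrable_add int_op_integrable res_kernel_L1inf q_mult_integrable)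

lemma datum_integrable:
  assumes "f \<in> L1 M_S" "integrable M g"
  shows "integrable M (\<lambda>x. zero_ext S f x - q x * g x)"
  using assms by (intro Bochner_Integration.integrable_diff q_mult_integrable) (simp_all add: L1_restrict_iff)

text \<open>On \<open>V \<setminus> S\<close> the equation reads \<open>u = q (H u - g)\<close>, so \<open>u\<close> is determined by \<open>u\<^sub>S\<close> and \<open>g\<close>;
  inserting this on \<open>S\<close> leaves the reduced equation.\<close>

lemma full_eq_iff:
  assumes u: "integrable M u" and g: "integrable M g"
  shows "(AE x in M. full_op u x - \<zeta> * u x = g x) \<longleftrightarrow>
    (AE x in M. u x = sol (\<lambda>x. zero_ext S u x - q x * g x) x) \<and>
    (AE x in M_S. red_op u x - \<zeta> * u x = source g x)"
proof -
  define p where "p x = zero_ext S u x - q x * g x" for x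
  have p: "integrable M p"
    unfolding p_def[abs_def] using L1_S[OF u] g by (rule datum_integrable)
  have ext: "integrable M (zero_ext S u)"
    using u by (simp add: zero_ext_integrable)
  \<comment> \<open>For solutions, H u equals R applied to the datum; this is how the reduced kernel
    enters the equation on S.\<close>
  have H_eq: "AE x in M. int_op M h u x = int_op M res_kernel (zero_ext S u) x - int_op M res_kernel (\<lambda>x. q x * g x) x"
    if "AE x in M. u x = sol p x"
    using int_op_sol[OF p] int_op_diff[OF res_kernel_L1inf ext q_mult_integrable[OF g]] AE_space
  proof eventually_elim
    case (elim x)
    have "int_op M h u x = int_op M h (sol p) x"
      using u sol_integrable[OF p] elim(3) that by (intro int_op_cong_AE) auto
    with elim show ?case by (simp add: p_def[abs_def])
  qed
  have fix_iff: "(AE x in M. u x = sol p x) \<longleftrightarrow> (AE x in M. u x = p x + q x * int_op M h u x)"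
  proof
    assume eq: "AE x in M. u x = sol p x"
    show "AE x in M. u x = p x + q x * int_op M h u x"
      using sol_eq[OF p] eq AE_space
    proof eventually_elim
      case (elim x)
      have "int_op M h u x = int_op M h (sol p) x"
        using u sol_integrable[OF p] elim(3) eq by (intro int_op_cong_AE) auto
      with elim show ?case by simp
    qed
  qed (rule sol_unique[OF p u])
  have off: "full_op u x - \<zeta> * u x = g x \<longleftrightarrow> u x = p x + q x * int_op M h u x"
    if x: "x \<in> space M" "x \<notin> S" for x
  proof -
    have "p x + q x * int_op M h u x = (int_op M h u x - g x) / (\<zeta> - d x)"
      using x by (simp add: p_def q_off diff_divide_distrib)
    then have "u x = p x + q x * int_op M h u x \<longleftrightarrow> u x = (int_op M h u x - g x) / (\<zeta> - d x)"
      by (rule arg_cong)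
    also have "\<dots> \<longleftrightarrow> u x * (\<zeta> - d x) = int_op M h u x - g x"
      unfolding eq_divide_eq using \<zeta>_neq[OF x] by simp
    finally have "u x = p x + q x * int_op M h u x \<longleftrightarrow> u x * (\<zeta> - d x) = int_op M h u x - g x" .
    moreover have "full_op u x = d x * u x + int_op M h u x"
      using x u by (intro kernel_operator_eq) auto
    ultimately show ?thesis
      by (auto simp: algebra_simps)
  qed
  have on: "u x = p x + q x * int_op M h u x" if "x \<in> S" for x
    using that by (simp add: p_def)
  have "(AE x in M. full_op u x - \<zeta> * u x = g x) \<longleftrightarrow>
      (AE x in M. u x = p x + q x * int_op M h u x) \<and> (AE x in M. x \<in> S \<longrightarrow> full_op u x - \<zeta> * u x = g x)"
  proof -
    have "(AE x in M. full_op u x - \<zeta> * u x = g x) \<longleftrightarrow>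
      (AE x in M. u x = p x + q x * int_op M h u x \<and> (x \<in> S \<longrightarrow> full_op u x - \<zeta> * u x = g x))"
      by (rule AE_cong) (use on off in blast)
    then show ?thesis by simp
  qed
  also have "\<dots> \<longleftrightarrow> (AE x in M. u x = sol p x) \<and> (AE x in M_S. red_op u x - \<zeta> * u x = source g x)"
  proof -
    have "(AE x in M. x \<in> S \<longrightarrow> full_op u x - \<zeta> * u x = g x) \<longleftrightarrow>
        (AE x in M. x \<in> S \<longrightarrow> red_op u x - \<zeta> * u x = source g x)" if eq: "AE x in M. u x = sol p x"
    proof -
      have "AE x in M. x \<in> S \<longrightarrow>
          (full_op u x - \<zeta> * u x = g x \<longleftrightarrow> red_op u x - \<zeta> * u x = source g x)"
        using H_eq[OF eq] reduced_operator_eq[OF L1_S[OF u]] AE_space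
      proof eventually_elim
        case (elim x)
        define r where "r = int_op M res_kernel (\<lambda>x. q x * g x) x"
        have "full_op u x = d x * u x + int_op M h u x"
          using elim(3) u by (intro kernel_operator_eq) auto
        then have "red_op u x = full_op u x + r" if "x \<in> S"
          using elim(1,2) that by (simp add: r_def)
        moreover have "source g x = g x + r"
          by (simp add: source_def r_def)
        ultimately show ?case
          by (auto simp: algebra_simps)
      qed
      then show ?thesis
        by (auto elim: AE_mp)
    qed
    then show ?thesis
      unfolding fix_iff[symmetric] AE_restrict_iff[OF S] by blast
  qed
  finally show ?thesis
    unfolding p_def[abs_def] .
qed

lemma zero_ext_sol:
  assumes "x \<in> S"
  shows "sol (\<lambda>x. zero_ext S f x - q x * g x) x = f x"
  using assms by (simp add: sol_def)

lemma red_op_cong: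
  assumes "f \<in> L1 M_S" "g \<in> L1 M_S" "AE x in M_S. f x = g x"
  shows "AE x in M_S. red_op f x = red_op g x"
  unfolding AE_restrict_iff[OF S]
  using assms(3)[unfolded AE_restrict_iff[OF S]] reduced_operator_eq[OF assms(1)] reduced_operator_eq[OF assms(2)] AE_space
proof eventually_elim
  case (elim x)
  have "int_op M res_kernel (zero_ext S f) x = int_op M res_kernel (zero_ext S g) x"
  proof (rule int_op_cong_AE[OF res_kernel_measurable elim(4)])
    show "AE y in M. zero_ext S f y = zero_ext S g y"
      using assms(3)[unfolded AE_restrict_iff[OF S]] by eventually_elim (auto simp: zero_ext_def indicator_def)
  qed (use assms in \<open>auto simp: L1_restrict_iff\<close>)
  with elim show ?case by auto
qed

text \<open>The inverse is read off the elimination: the reduced inverse G, applied to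
  \<open>source g\<close>, gives the part on S, and \<open>sol\<close> with datum \<open>D g\<close>
  extends it to V. What remains is that this composite is linear up to null sets and
  bounded.\<close>

lemma full_invertible:
  assumes "invertible_L1 M_S (\<lambda>f x. red_op f x - \<zeta> * f x)"
  shows "invertible_L1 M (\<lambda>f x. full_op f x - \<zeta> * f x)"
proof -
  obtain G where G: "bounded_operator_L1 M_S G"
    and G_iff: "\<And>f g. f \<in> L1 M_S \<Longrightarrow> g \<in> L1 M_S \<Longrightarrow>
      (AE x in M_S. red_op f x - \<zeta> * f x = g x) \<longleftrightarrow> (AE x in M_S. G g x = f x)"
    using assms unfolding invertible_L1_def by blast
  have G_L1: "G g \<in> L1 M_S" if "g \<in> L1 M_S" for g
    using G that by (simp add: bounded_operator_L1_def)
  have G_add: "AE x in M_S. G (\<lambda>y. f y + g y) x = G f x + G g x" if "f \<in> L1 M_S" "g \<in> L1 M_S" for f g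
    using G that by (simp add: bounded_operator_L1_def)
  have G_cmult: "AE x in M_S. G (\<lambda>y. c * f y) x = c * G f x" if "f \<in> L1 M_S" for f c
    using G that by (simp add: bounded_operator_L1_def)
  obtain C where C: "\<And>f. f \<in> L1 M_S \<Longrightarrow> norm_L1 M_S (G f) \<le> C * norm_L1 M_S f"
    using G unfolding bounded_operator_L1_def by blast
  \<comment> \<open>\<open>G f\<close> solves the reduced equation with right-hand side f, hence
    also with g, and \<open>G_iff\<close> then identifies it with \<open>G g\<close>.\<close>
  have G_cong: "AE x in M_S. G f x = G g x" if fg: "f \<in> L1 M_S" "g \<in> L1 M_S" "AE x in M_S. f x = g x" for f g
  proof -
    have "AE x in M_S. red_op (G f) x - \<zeta> * G f x = f x"
      using G_iff[OF G_L1 fg(1)] fg(1) by simp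
    then have "AE x in M_S. red_op (G f) x - \<zeta> * G f x = g x"
      using fg(3) by eventually_elim simp
    then have "AE x in M_S. G g x = G f x"
      using G_iff[OF G_L1 fg(2)] fg(1) by blast
    then show ?thesis by eventually_elim simp
  qed
  define D where "D g x = zero_ext S (G (source g)) x - q x * g x" for g x
  define F where "F g = sol (D g)" for g
  have GS: "G (source g) \<in> L1 M_S" if "integrable M g" for g
    using that by (intro G_L1 L1_S source_integrable)
  have D: "integrable M (D g)" if "integrable M g" for g
    unfolding D_def[abs_def] using that by (intro datum_integrable GS)
  have F: "integrable M (F g)" if "integrable M g" for g
    unfolding F_def using that by (intro sol_integrable D)
  have F_S: "F g x = G (source g) x" if "x \<in> S" for g x
    unfolding F_def D_def[abs_def] using that by (rule zero_ext_sol)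
  have "(AE x in M. full_op f x - \<zeta> * f x = g x) \<longleftrightarrow> (AE x in M. F g x = f x)"
    if f: "f \<in> L1 M" and g: "g \<in> L1 M" for f g
  proof -
    have fi: "integrable M f" and gi: "integrable M g"
      using f g by (simp_all add: L1_def)
    define p where "p x = zero_ext S f x - q x * g x" for x
    have p: "integrable M p"
      unfolding p_def[abs_def] by (rule datum_integrable[OF L1_S[OF fi] gi])
    have D_cong: "AE x in M. sol (D g) x = sol p x" if "AE x in M_S. G (source g) x = f x"
    proof (rule sol_cong_AE[OF D[OF gi] p])
      show "AE x in M. D g x = p x"
        using that[unfolded AE_restrict_iff[OF S]]
        by eventually_elim (auto simp: D_def p_def zero_ext_def indicator_def)
    qed
    have "(AE x in M. full_op f x - \<zeta> * f x = g x) \<longleftrightarrow>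
      (AE x in M. f x = sol p x) \<and> (AE x in M_S. G (source g) x = f x)"
      unfolding full_eq_iff[OF fi gi] p_def[abs_def]
      using G_iff[OF L1_S[OF fi] L1_S[OF source_integrable[OF gi]]] by simp
    also have "\<dots> \<longleftrightarrow> (AE x in M. F g x = f x)"
    proof
      assume *: "(AE x in M. f x = sol p x) \<and> (AE x in M_S. G (source g) x = f x)"
      show "AE x in M. F g x = f x"
        unfolding F_def using *[THEN conjunct1] D_cong[OF *[THEN conjunct2]] by eventually_elim simp
    next
      assume Ff: "AE x in M. F g x = f x"
      have *: "AE x in M_S. G (source g) x = f x"
        unfolding AE_restrict_iff[OF S] using Ff by eventually_elim (auto simp: F_S)
      have "AE x in M. f x = sol p x"
        using Ff D_cong[OF *] unfolding F_def by eventually_elim simp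
      with * show "(AE x in M. f x = sol p x) \<and> (AE x in M_S. G (source g) x = f x)"
        by blast
    qed
    finally show ?thesis .
  qed
  moreover have "bounded_operator_L1 M F"
    unfolding bounded_operator_L1_def
  proof (intro conjI ballI allI)
    show "F f \<in> L1 M" if "f \<in> L1 M" for f
      using that F by (simp add: L1_def)
    show "AE x in M. F (\<lambda>y. f y + g y) x = F f x + F g x" if "f \<in> L1 M" "g \<in> L1 M" for f g
    proof -
      have i: "integrable M f" "integrable M g" "integrable M (\<lambda>y. f y + g y)"
        using that by (auto simp: L1_def)
      have s: "AE x in M. source (\<lambda>y. f y + g y) x = source f x + source g x"
        using int_op_add[OF res_kernel_L1inf q_mult_integrable[OF i(1)] q_mult_integrable[OF i(2)]]
        by eventually_elim (simp add: source_def distrib_left)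
      have "AE x in M_S. G (source (\<lambda>y. f y + g y)) x = G (\<lambda>y. source f y + source g y) x"
        using i s by (intro G_cong L1_S source_integrable Bochner_Integration.integrable_add)
          (auto simp: AE_restrict_iff[OF S] elim: AE_mp)
      with G_add[OF L1_S L1_S, OF source_integrable[OF i(1)] source_integrable[OF i(2)]]
      have "AE x in M_S. G (source (\<lambda>y. f y + g y)) x = G (source f) x + G (source g) x"
        by eventually_elim simp
      then have "AE x in M. D (\<lambda>y. f y + g y) x = D f x + D g x"
        unfolding AE_restrict_iff[OF S]
        by eventually_elim (auto simp: D_def zero_ext_def indicator_def algebra_simps)
      then have "AE x in M. F (\<lambda>y. f y + g y) x = sol (\<lambda>y. D f y + D g y) x"
        unfolding F_def using i by (intro sol_cong_AE D Bochner_Integration.integrable_add)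
      with sol_add[OF D[OF i(1)] D[OF i(2)]] show ?thesis
        unfolding F_def by eventually_elim simp
    qed
    show "AE x in M. F (\<lambda>y. c * f y) x = c * F f x" if "f \<in> L1 M" for c f
    proof -
      have i: "integrable M f" "integrable M (\<lambda>y. c * f y)"
        using that by (auto simp: L1_def)
      have s: "source (\<lambda>y. c * f y) = (\<lambda>x. c * source f x)"
      proof
        fix x
        have "(\<lambda>y. q y * (c * f y)) = (\<lambda>y. c * (q y * f y))"
          by (simp add: mult_ac)
        then show "source (\<lambda>y. c * f y) x = c * source f x"
          by (simp add: source_def int_op_cmult distrib_left)
      qed
      have "AE x in M. D (\<lambda>y. c * f y) x = c * D f x"
        using G_cmult[OF L1_S[OF source_integrable[OF i(1)]], of c]
        unfolding AE_restrict_iff[OF S] s[symmetric]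
        by eventually_elim (auto simp: D_def zero_ext_def indicator_def algebra_simps)
      then have "AE x in M. F (\<lambda>y. c * f y) x = sol (\<lambda>y. c * D f y) x"
        unfolding F_def using i by (intro sol_cong_AE D) (auto intro: D)
      then show ?thesis
        unfolding F_def by eventually_elim (simp add: sol_cmult)
    qed
    obtain Cs where Cs: "0 \<le> Cs" "\<And>f. integrable M f \<Longrightarrow> norm_L1 M (sol f) \<le> Cs * norm_L1 M f"
      using sol_bounded by blast
    obtain Cr where Cr: "0 \<le> Cr" "\<And>f. integrable M f \<Longrightarrow> norm_L1 M (int_op M res_kernel f) \<le> Cr * norm_L1 M f"
      using int_op_L1[OF res_kernel_L1inf] by blast
    define Cq where "Cq = \<bar>Q\<bar>"
    have Cq: "0 \<le> Cq" "\<And>f. integrable M f \<Longrightarrow> norm_L1 M (\<lambda>x. q x * f x) \<le> Cq * norm_L1 M f"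
      using q_mult_norm_le by (simp_all add: Cq_def)
    have "norm_L1 M (F g) \<le> Cs * (\<bar>C\<bar> * (1 + Cr * Cq) + Cq) * norm_L1 M g" if "g \<in> L1 M" for g
    proof -
      have g: "integrable M g" using that by (simp add: L1_def)
      note qg = q_mult_integrable[OF g]
      have "norm_L1 M (source g) \<le> norm_L1 M g + norm_L1 M (int_op M res_kernel (\<lambda>x. q x * g x))"
        unfolding source_def[abs_def] by (intro norm_L1_add g int_op_integrable res_kernel_L1inf qg)
      also have "norm_L1 M (int_op M res_kernel (\<lambda>x. q x * g x)) \<le> Cr * (Cq * norm_L1 M g)"
        using Cr(2)[OF qg] mult_left_mono[OF Cq(2)[OF g] Cr(1)] by linarith
      finally have src: "norm_L1 M (source g) \<le> (1 + Cr * Cq) * norm_L1 M g"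
        by (simp add: algebra_simps)
      have "norm_L1 M (zero_ext S (G (source g))) \<le> C * norm_L1 M (zero_ext S (source g))"
        using C[OF L1_S[OF source_integrable[OF g]]] by (simp add: norm_L1_restrict)
      also have "\<dots> \<le> \<bar>C\<bar> * norm_L1 M (source g)"
        using norm_L1_zero_ext_le[OF S source_integrable[OF g]] norm_L1_nonneg[of M "zero_ext S (source g)"]
        by (intro mult_mono) auto
      also have "\<dots> \<le> \<bar>C\<bar> * ((1 + Cr * Cq) * norm_L1 M g)"
        by (intro mult_left_mono src) simp
      finally have ext: "norm_L1 M (zero_ext S (G (source g))) \<le> \<bar>C\<bar> * ((1 + Cr * Cq) * norm_L1 M g)" .
      have "norm_L1 M (D g) \<le> norm_L1 M (zero_ext S (G (source g))) + norm_L1 M (\<lambda>x. - (q x * g x))"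
        unfolding D_def[abs_def] diff_conv_add_uminus
        using GS[OF g] qg by (intro norm_L1_add) (auto simp: L1_restrict_iff)
      also have "norm_L1 M (\<lambda>x. - (q x * g x)) = norm_L1 M (\<lambda>x. q x * g x)"
        by (simp add: norm_L1_def)
      also have "norm_L1 M (zero_ext S (G (source g))) + \<dots>
          \<le> \<bar>C\<bar> * ((1 + Cr * Cq) * norm_L1 M g) + Cq * norm_L1 M g"
        by (intro add_mono ext Cq g)
      also have "\<dots> = (\<bar>C\<bar> * (1 + Cr * Cq) + Cq) * norm_L1 M g"
        by (simp add: algebra_simps)
      finally have "Cs * norm_L1 M (D g) \<le> Cs * ((\<bar>C\<bar> * (1 + Cr * Cq) + Cq) * norm_L1 M g)"
        by (rule mult_left_mono[OF _ Cs(1)])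
      with Cs(2)[OF D[OF g]] show ?thesis
        unfolding F_def by (simp add: mult.assoc)
    qed
    then show "\<exists>C. \<forall>f\<in>L1 M. norm_L1 M (F f) \<le> C * norm_L1 M f"
      by blast
  qed
  ultimately show ?thesis
    unfolding invertible_L1_def by blast
qed

lemma full_eigen_iff:
  assumes u: "integrable M u"
  shows "(AE x in M. full_op u x = \<zeta> * u x) \<longleftrightarrow>
    (AE x in M. u x = sol (zero_ext S u) x) \<and> (AE x in M_S. red_op u x = \<zeta> * u x)"
proof -
  have "source (\<lambda>_. 0) x = 0" for x
    by (simp add: source_def int_op_def)
  then show ?thesis
    using full_eq_iff[OF u, of "\<lambda>_. 0"] by simp
qed

text \<open>Allowing any v that agrees with u on S covers \<open>restrict u S\<close>, whose values
  elsewhere are \<open>undefined\<close>. The restriction is nonzero because \<open>sol\<close>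
  recovers u from it: if it vanished, so would u.\<close>

lemma eigenfunction_restrict:
  assumes u: "eigenfunction_L1 M full_op \<zeta> u" and v: "\<And>x. x \<in> S \<Longrightarrow> v x = u x"
  shows "eigenfunction_L1 M_S red_op \<zeta> v"
proof -
  have ui: "integrable M u" and nz: "\<not> (AE x in M. u x = 0)" and eq: "AE x in M. full_op u x = \<zeta> * u x"
    using u by (auto simp: eigenfunction_L1_def L1_def)
  have ext: "zero_ext S v = zero_ext S u"
    using v by (auto simp: zero_ext_def indicator_def)
  have uS: "u \<in> L1 M_S" by (rule L1_S[OF ui])
  then have vS: "v \<in> L1 M_S"
    by (simp add: L1_restrict_iff ext)
  have AEv: "AE x in M_S. v x = u x"
    unfolding AE_restrict_iff[OF S] using v by simp
  have sol: "AE x in M. u x = sol (zero_ext S u) x" and red: "AE x in M_S. red_op u x = \<zeta> * u x"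
    using eq full_eigen_iff[OF ui] by auto
  have "\<not> (AE x in M_S. v x = 0)"
  proof
    assume "AE x in M_S. v x = 0"
    then have "AE x in M. zero_ext S u x = 0"
      unfolding AE_restrict_iff[OF S] using v by (auto simp: zero_ext_def indicator_def elim: AE_mp)
    then have "AE x in M. sol (zero_ext S u) x = 0"
      using uS by (intro sol_zero_AE) (simp_all add: L1_restrict_iff)
    then have "AE x in M. u x = 0"
      using sol by eventually_elim simp
    with nz show False by blast
  qed
  moreover have "AE x in M_S. red_op v x = \<zeta> * v x"
    using red red_op_cong[OF vS uS AEv] AEv by eventually_elim simp
  ultimately show ?thesis
    using vS by (simp add: eigenfunction_L1_def)
qed

text \<open>Equality with the solution is asked only almost everywhere, since the limit
  reconstruction is a choice among L^1 limits.\<close>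

lemma eigenfunction_sol:
  assumes v: "eigenfunction_L1 M_S red_op \<zeta> v"
    and u: "integrable M u" "AE x in M. u x = sol (zero_ext S v) x"
  shows "eigenfunction_L1 M full_op \<zeta> u"
proof -
  have vS: "v \<in> L1 M_S" and nz: "\<not> (AE x in M_S. v x = 0)" and eq: "AE x in M_S. red_op v x = \<zeta> * v x"
    using v by (auto simp: eigenfunction_L1_def)
  have vi: "integrable M (zero_ext S v)"
    using vS by (simp add: L1_restrict_iff)
  have uv: "AE x in M_S. u x = v x"
    unfolding AE_restrict_iff[OF S] using u(2) by eventually_elim (auto simp: sol_def)
  then have "AE x in M. zero_ext S v x = zero_ext S u x"
    unfolding AE_restrict_iff[OF S] by eventually_elim (auto simp: zero_ext_def indicator_def)
  then have "AE x in M. sol (zero_ext S v) x = sol (zero_ext S u) x"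
    using vi u(1) by (intro sol_cong_AE) (auto simp: zero_ext_integrable)
  then have "AE x in M. u x = sol (zero_ext S u) x"
    using u(2) by eventually_elim simp
  moreover have "AE x in M_S. red_op u x = \<zeta> * u x"
    using red_op_cong[OF L1_S[OF u(1)] vS uv] eq uv by eventually_elim simp
  ultimately have "AE x in M. full_op u x = \<zeta> * u x"
    using full_eigen_iff[OF u(1)] by blast
  moreover have "\<not> (AE x in M. u x = 0)"
  proof
    assume "AE x in M. u x = 0"
    then have "AE x in M_S. u x = 0"
      unfolding AE_restrict_iff[OF S] by eventually_elim simp
    with uv have "AE x in M_S. v x = 0"
      by eventually_elim simp
    with nz show False by blast
  qed
  ultimately show ?thesis
    using u(1) by (simp add: eigenfunction_L1_def L1_def)
qed

end

section \<open>Reconstruction\<close>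

lemma recon_stage_stable:
  assumes "z \<in> layer N L S m" "m \<le> n"
  shows "recon_stage N d L S \<zeta> v n z = recon_stage N d L S \<zeta> v m z"
  using assms(2)
proof (induction n rule: dec_induct)
  case (step n)
  then show ?case
    using layer_mono[of m n N L S] assms(1) by auto
qed simp

lemma reconstruction_on_layer:
  assumes "z \<in> layer N L S m"
  shows "reconstruction N d L S \<zeta> v z = recon_stage N d L S \<zeta> v m z"
  unfolding reconstruction_def
  using recon_stage_stable[OF layer_Least[OF assms]] by simp

context reduction
begin

text \<open>A new point of layer m + 1 charges only layer m, where the stage already agrees with
  \<open>sol\<close>; as the point lies off S, the datum vanishes there and the recursion is exactly
  the equation u = g + q H u. Measurability is carried for the cut-off to the layer, the part of a
  stage that is meaningful.\<close>

lemma recon_stage_sol: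
  assumes v: "integrable M (zero_ext S v)"
  shows "(\<lambda>z. indicator (layer M K S m) z * recon_stage M d K S \<zeta> v m z) \<in> borel_measurable M \<and>
    (AE z in M. z \<in> layer M K S m \<longrightarrow> recon_stage M d K S \<zeta> v m z = sol (zero_ext S v) z)"
proof (induction m)
  case 0
  have "(\<lambda>z. indicator S z * v z) \<in> borel_measurable M"
    using v by (auto simp: zero_ext_def[abs_def])
  then show ?case
    by (simp add: sol_def)
next
  case (Suc m)
  define u where "u = sol (zero_ext S v)"
  let ?A = "layer M K S m" and ?B = "layer M K S (Suc m)"
  let ?r = "recon_stage M d K S \<zeta> v"
  define f where "f z = indicator ?A z * ?r m z" for z
  have u: "integrable M u"
    unfolding u_def by (rule sol_integrable[OF v])
  have A[measurable]: "?A \<in> sets M" and B[measurable]: "?B \<in> sets M"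
    using layer_sets[OF K S] by blast+
  have f[measurable]: "f \<in> borel_measurable M"
    unfolding f_def[abs_def] using Suc.IH by blast
  have [measurable]: "u \<in> borel_measurable M"
    using u by auto
  have IH: "AE z in M. z \<in> ?A \<longrightarrow> ?r m z = u z"
    using Suc.IH by (simp add: u_def)
  have AB: "?A \<subseteq> ?B" by auto
  have SA: "S \<subseteq> ?A" using layer_mono[of 0 m M K S] by simp
  have step: "?r (Suc m) z = 1 / (\<zeta> - d z) * int_op M h f z" if "z \<in> space M" "z \<notin> ?A" for z
    using cm_integral_kernel[OF that(1) A, of "?r m"] f that(2) by (simp add: f_def[abs_def])
  have "(\<lambda>z. indicator ?B z * ?r (Suc m) z) \<in> borel_measurable M \<longleftrightarrow>
    (\<lambda>z. f z + indicator (?B - ?A) z * (1 / (\<zeta> - d z) * int_op M h f z)) \<in> borel_measurable M"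
  proof (rule measurable_cong)
    fix z assume "z \<in> space M"
    then show "indicator ?B z * ?r (Suc m) z = f z + indicator (?B - ?A) z * (1 / (\<zeta> - d z) * int_op M h f z)"
      using step[of z] AB by (cases "z \<in> ?A"; cases "z \<in> ?B") (auto simp: f_def indicator_def simp del: layer.simps)
  qed
  moreover have "(\<lambda>z. f z + indicator (?B - ?A) z * (1 / (\<zeta> - d z) * int_op M h f z)) \<in> borel_measurable M"
    by measurable
  moreover have "AE z in M. z \<in> ?B \<longrightarrow> ?r (Suc m) z = u z"
    using IH sol_eq[OF v, folded u_def] AE_space
  proof eventually_elim
    case (elim z)
    show ?case
    proof (intro impI, cases "z \<in> ?A")
      case True
      with elim show "?r (Suc m) z = u z" by simp
    next
      case False
      assume "z \<in> ?B"
      then have zero: "AE y in M. y \<notin> ?A \<longrightarrow> h z y = 0"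
        using False by (rule layer_zero[OF K S])
      have [measurable]: "h z \<in> borel_measurable M"
        using elim(3) by measurable
      have "int_op M h f z = int_op M h u z"
        unfolding int_op_def
      proof (rule integral_cong_AE)
        show "AE y in M. f y * h z y = u y * h z y"
          using zero IH by eventually_elim (auto simp: f_def indicator_def)
      qed measurable
      moreover have "z \<notin> S" using False SA by blast
      ultimately show "?r (Suc m) z = u z"
        using step[OF elim(3) False] elim(2,3) by (simp add: q_off)
    qed
  qed
  ultimately show ?case
    unfolding u_def by blast
qed

text \<open>Every point lies in some layer, from which on the cut-off stages are constant at that
  point. The reconstruction is thus a pointwise limit of measurable functions, and it inherits
  integrability from \<open>sol\<close>.\<close>

lemma reconstruction_sol:
  assumes B: "structural_B M K h S" and v: "integrable M (zero_ext S v)"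
  shows "integrable M (reconstruction M d K S \<zeta> v)"
    and "AE z in M. reconstruction M d K S \<zeta> v z = sol (zero_ext S v) z"
proof -
  let ?r = "reconstruction M d K S \<zeta> v"
  note ex = structural_B_layer[OF K S B]
  have "AE z in M. \<forall>m. z \<in> layer M K S m \<longrightarrow> recon_stage M d K S \<zeta> v m z = sol (zero_ext S v) z"
    using recon_stage_sol[OF v] by (simp add: AE_all_countable)
  then show AE: "AE z in M. ?r z = sol (zero_ext S v) z"
    using AE_space
  proof eventually_elim
    case (elim z)
    from ex[OF elim(2)] obtain m where m: "z \<in> layer M K S m" ..
    show ?case
      unfolding reconstruction_on_layer[OF m] using elim(1) m by blast
  qed
  have m: "?r \<in> borel_measurable M"
  proof (rule borel_measurable_LIMSEQ_metric)
    fix z assume "z \<in> space M"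
    from ex[OF this] obtain m where m: "z \<in> layer M K S m" ..
    have "\<forall>\<^sub>F n in sequentially. indicator (layer M K S n) z * recon_stage M d K S \<zeta> v n z = ?r z"
      using eventually_ge_at_top[of m]
    proof eventually_elim
      case (elim n)
      have n: "z \<in> layer M K S n"
        by (rule subsetD[OF layer_mono[OF elim] m])
      then show ?case
        unfolding reconstruction_on_layer[OF n] by simp
    qed
    then show "(\<lambda>n. indicator (layer M K S n) z * recon_stage M d K S \<zeta> v n z) \<longlonglongrightarrow> ?r z"
      by (rule tendsto_eventually)
  qed (rule conjunct1[OF recon_stage_sol[OF v]])
  have "AE z in M. sol (zero_ext S v) z = ?r z"
    using AE by eventually_elim (rule sym)
  then show "integrable M ?r"
    by (rule integrable_cong_AE_imp[OF sol_integrable[OF v] m])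
qed

end

section \<open>Stability of the solution under perturbation of the kernel\<close>

context contracting_kernel
begin

text \<open>The error z = \<open>sol p\<close> - w satisfies z = q H z + q (H - L) w. The
  contraction absorbs half of its weighted norm, and b converts back to the L^1 norm. Only the
  weight of h enters, so the constants do not depend on l.\<close>

lemma perturbation_bound:
  assumes l: "l \<in> L1inf M" and e: "0 \<le> e" "norm_1inf M (\<lambda>x y. h x y - l x y) \<le> ennreal e"
    and p: "integrable M p" and w: "integrable M w" "AE x in M. w x = p x + q x * int_op M l w x"
  shows "b / 2 * norm_L1 M (\<lambda>x. w x - sol p x) \<le> \<bar>B\<bar> * e * norm_L1 M w"
proof -
  let ?k = "\<lambda>x y. h x y - l x y"
  let ?z = "\<lambda>x. sol p x - w x"
  note [measurable] = L1infD(1)[OF l]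
  have u: "integrable M (sol p)" by (rule sol_integrable[OF p])
  have z: "integrable M ?z" using u w by auto
  have k_le: "\<And>y. y \<in> space M \<Longrightarrow> (\<integral>\<^sup>+x. ennreal (cmod (?k x y)) \<partial>M) \<le> ennreal e"
    using norm_1inf_le[OF e(2)] .
  have k: "?k \<in> L1inf M"
    by (rule L1infI[OF _ k_le]) measurable
  have Kw: "integrable M (int_op M ?k w)"
    by (rule int_op_integrable[OF k w(1)])
  have Kw_le: "norm_L1 M (int_op M ?k w) \<le> e * norm_L1 M w"
    using e(1) k_le w(1) k by (rule int_op_norm_L1_le)
  have "AE x in M. ?z x = q x * int_op M h ?z x + q x * int_op M ?k w x"
    using sol_eq[OF p] w(2) int_op_diff[OF h u w(1)] int_op_kernel_diff[OF h l w(1)]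
  proof eventually_elim
    case (elim x)
    have "?z x = q x * (int_op M h (sol p) x - int_op M l w x)"
      unfolding right_diff_distrib using elim(1,2) by simp
    also have "int_op M h (sol p) x - int_op M l w x = int_op M h ?z x + int_op M ?k w x"
      unfolding elim(3,4) by simp
    finally show ?case by (simp add: distrib_left)
  qed
  moreover have supp: "AE x in M. q x = 0 \<longrightarrow> ?z x = 0"
    using sol_eq[OF p] w(2) by eventually_elim auto
  ultimately have "wnorm ?z = wnorm (\<lambda>x. q x * int_op M h ?z x + q x * int_op M ?k w x)"
    using z by (intro wnorm_cong_AE Bochner_Integration.integrable_add q_mult_integrable int_op_integrable h k w(1))
  also have "\<dots> \<le> wnorm (\<lambda>x. q x * int_op M h ?z x) + wnorm (\<lambda>x. q x * int_op M ?k w x)"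
    using z by (intro wnorm_add q_mult_integrable int_op_integrable h k w(1))
  also have "\<dots> \<le> wnorm ?z / 2 + norm_L1 M (\<lambda>x. q x * int_op M ?k w x)"
    using z Kw supp by (intro add_mono wnorm_contract wnorm_le q_mult_integrable)
  also have "norm_L1 M (\<lambda>x. q x * int_op M ?k w x) \<le> \<bar>B\<bar> * (e * norm_L1 M w)"
    using q_mult_norm_le[OF Kw] mult_left_mono[OF Kw_le, of "\<bar>B\<bar>"] by simp
  finally have "wnorm ?z / 2 \<le> \<bar>B\<bar> * e * norm_L1 M w"
    by (simp add: mult.assoc)
  moreover have "b * norm_L1 M ?z \<le> wnorm ?z"
    by (rule wnorm_le(2)[OF z])
  moreover have "norm_L1 M ?z = norm_L1 M (\<lambda>x. w x - sol p x)"
    by (simp add: norm_L1_def norm_minus_commute)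
  ultimately show ?thesis by simp
qed

text \<open>No bound on the norms of the \<open>wn n\<close> is given in advance. Estimating them by
  the norm of \<open>sol p\<close> plus the error puts the error on both sides, where it is absorbed
  once its coefficient falls below 1/2.\<close>

lemma perturbation_limit:
  assumes l: "\<And>n. kn n \<in> L1inf M" and lim: "(\<lambda>n. norm_1inf M (\<lambda>x y. h x y - kn n x y)) \<longlonglongrightarrow> 0"
    and p: "integrable M p"
    and w: "\<And>n. integrable M (wn n)" "\<And>n. AE x in M. wn n x = p x + q x * int_op M (kn n) (wn n) x"
  shows "(\<lambda>n. norm_L1 M (\<lambda>x. wn n x - sol p x)) \<longlonglongrightarrow> 0"
proof -
  define e where "e n = enn2real (norm_1inf M (\<lambda>x y. h x y - kn n x y))" for n
  define N where "N n = norm_L1 M (\<lambda>x. wn n x - sol p x)" for n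
  define U where "U = norm_L1 M (sol p)"
  define c where "c = \<bar>B\<bar> * (2 / b)"
  have c0: "0 \<le> c" using b by (simp add: c_def)
  have u: "integrable M (sol p)" by (rule sol_integrable[OF p])
  have e0: "0 \<le> e n" for n by (simp add: e_def)
  have N0: "0 \<le> N n" for n by (simp add: N_def norm_L1_nonneg)
  have e_lim: "e \<longlonglongrightarrow> 0"
    unfolding e_def[abs_def] by (rule tendsto_enn2real) (use lim in simp_all)
  \<comment> \<open>\<open>enn2real\<close> sends infinity to 0, so \<open>e n\<close> bounds the
    perturbation norm only once that norm is known to be finite.\<close>
  have fin: "\<forall>\<^sub>F n in sequentially. norm_1inf M (\<lambda>x y. h x y - kn n x y) < \<infinity>"
    using order_tendstoD(2)[OF lim, of \<infinity>] by simp
  have small: "\<forall>\<^sub>F n in sequentially. c * e n < 1 / 2"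
    using order_tendstoD(2)[OF tendsto_mult_left[OF e_lim, of c], of "1/2"] by simp
  have "\<forall>\<^sub>F n in sequentially. N n \<le> 2 * (c * e n * U)"
    using fin small
  proof eventually_elim
    case (elim n)
    have "norm_1inf M (\<lambda>x y. h x y - kn n x y) \<le> ennreal (e n)"
      using elim(1) by (simp add: e_def)
    from perturbation_bound[OF l e0 this p w] have "b / 2 * N n \<le> \<bar>B\<bar> * e n * norm_L1 M (wn n)"
      by (simp add: N_def)
    then have "N n \<le> c * e n * norm_L1 M (wn n)"
      using b by (simp add: c_def field_simps)
    also have "norm_L1 M (wn n) \<le> U + N n"
      using norm_L1_add[OF u, of "\<lambda>x. wn n x - sol p x"] w(1)[of n] u by (simp add: U_def N_def)
    finally have "N n \<le> c * e n * (U + N n)"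
      using c0 e0[of n] by (simp add: mult_left_mono)
    also have "\<dots> \<le> c * e n * U + 1 / 2 * N n"
      unfolding distrib_left using elim(2) N0[of n] by (intro add_left_mono mult_right_mono) auto
    finally show ?case by simp
  qed
  moreover have "(\<lambda>n. 2 * (c * e n * U)) \<longlonglongrightarrow> 0"
    using tendsto_mult_left[OF tendsto_mult_right[OF tendsto_mult_left[OF e_lim, of c], of U], of 2] by simp
  ultimately have "N \<longlonglongrightarrow> 0"
    using N0 by (intro tendsto_sandwich[of "\<lambda>_. 0" N _ "\<lambda>n. 2 * (c * e n * U)"]) auto
  then show ?thesis by (simp add: N_def[abs_def])
qed

end

text \<open>With \<open>\<delta>\<close> the distance bound off S, |q| is at most 1 /
  \<open>\<delta>\<close>; the weight lemma with \<open>\<delta> / 2\<close> then yields the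
  contraction ratio 1/2. The weight thus depends on \<open>\<zeta>\<close>.\<close>

lemma reduction_exists:
  assumes "sigma_finite_measure M" and K: "kernel_1inf M K h" and d: "d \<in> Linf M" and S: "S \<in> sets M"
    and approx: "B_approximation M h S Kn hn" and \<zeta>: "\<zeta> \<notin> Sigma_d M d S"
  shows "\<exists>W b Q. reduction M h (off_weight M d S \<zeta>) W b Q K d S \<zeta>"
proof -
  interpret sigma_finite_measure M by fact
  note S[measurable] Linf_D(1)[OF d, measurable]
  let ?q = "off_weight M d S \<zeta>"
  obtain \<delta> where \<delta>: "0 < \<delta>" "\<And>z. z \<in> space M - S \<Longrightarrow> \<delta> \<le> cmod (\<zeta> - d z)"
    using off_Sigma_d[OF \<zeta>] by blast
  have q_le: "cmod (?q z) \<le> 1 / \<delta> * indicator (space M - S) z" for z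
    using \<delta>(2)[of z] \<delta>(1) by (auto simp: off_weight_def indicator_def norm_divide intro!: divide_left_mono mult_pos_pos)
  obtain W b where W[measurable]: "W \<in> borel_measurable M" and b: "0 < b" and Wb: "\<And>z. b \<le> W z \<and> W z \<le> 1"
    and W_int: "AE y in M. y \<notin> S \<longrightarrow>
      (\<integral>\<^sup>+x. ennreal (W x) * indicator (space M - S) x * ennreal (cmod (h x y)) \<partial>M) \<le> ennreal (\<delta> / 2 * W y)"
    using quasi_B_weight[OF K S approx, of "\<delta> / 2"] \<delta>(1) by auto
  have W0: "0 \<le> W z" for z using Wb[of z] b by simp
  have [measurable]: "case_prod h \<in> borel_measurable (M \<Otimes>\<^sub>M M)"
    by (rule kernel_1infD(2)[OF K])
  have "reduction M h ?q W b (1 / \<delta>) K d S \<zeta>"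
  proof unfold_locales
    show "h \<in> L1inf M" by (rule kernel_1infD(1)[OF K])
    show "?q \<in> borel_measurable M"
      unfolding off_weight_def[abs_def] by measurable
    show "cmod (?q z) \<le> 1 / \<delta>" for z
      by (rule order_trans[OF q_le]) (use \<delta>(1) in \<open>simp add: indicator_def\<close>)
    show "AE z in M. ?q z \<noteq> 0 \<longrightarrow>
      (\<integral>\<^sup>+x. ennreal (W x * cmod (?q x)) * ennreal (cmod (h x z)) \<partial>M) \<le> ennreal (1/2) * ennreal (W z)"
      using W_int AE_space
    proof (eventually_elim, intro impI)
      case (elim z)
      note [measurable] = elim(2)
      assume "?q z \<noteq> 0"
      then have z: "z \<notin> S" by (auto simp: off_weight_def)
      have "(\<integral>\<^sup>+x. ennreal (W x * cmod (?q x)) * ennreal (cmod (h x z)) \<partial>M)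
          \<le> (\<integral>\<^sup>+x. ennreal (1 / \<delta>) * (ennreal (W x) * indicator (space M - S) x * ennreal (cmod (h x z))) \<partial>M)"
      proof (rule nn_integral_mono)
        fix x
        have *: "W x * cmod (?q x) \<le> W x * (1 / \<delta> * indicator (space M - S) x)"
          using W0 q_le by (rule mult_left_mono[rotated])
        have "ennreal (W x * cmod (?q x)) \<le> ennreal (1 / \<delta>) * (ennreal (W x) * indicator (space M - S) x)"
        proof (cases "x \<in> space M - S")
          case True
          then show ?thesis
            using * \<delta>(1) W0[of x] by (simp add: ennreal_mult[symmetric] ennreal_leI)
        next
          case False
          then have "?q x = 0" by (simp add: off_weight_def)
          then show ?thesis by simp
        qed
        then show "ennreal (W x * cmod (?q x)) * ennreal (cmod (h x z))
          \<le> ennreal (1 / \<delta>) * (ennreal (W x) * indicator (space M - S) x * ennreal (cmod (h x z)))"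
          unfolding mult.assoc[symmetric] by (rule mult_right_mono) simp
      qed
      also have "\<dots> = ennreal (1 / \<delta>) * (\<integral>\<^sup>+x. ennreal (W x) * indicator (space M - S) x * ennreal (cmod (h x z)) \<partial>M)"
        by (rule nn_integral_cmult) measurable
      also have "\<dots> \<le> ennreal (1 / \<delta>) * ennreal (\<delta> / 2 * W z)"
        using elim(1) z by (intro mult_left_mono) auto
      also have "\<dots> = ennreal (1/2) * ennreal (W z)"
        using \<delta>(1) by (subst (1 2) ennreal_mult'[symmetric]) auto
      finally show "(\<integral>\<^sup>+x. ennreal (W x * cmod (?q x)) * ennreal (cmod (h x z)) \<partial>M) \<le> ennreal (1/2) * ennreal (W z)" .
    qed
  qed (use assms b Wb in auto)
  then show ?thesis by blast
qed

theorem theorem3p18: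
  fixes \<mu> :: "'a measure" and K :: "'a \<Rightarrow> 'a set \<Rightarrow> complex" and h :: "'a \<Rightarrow> 'a \<Rightarrow> complex"
    and d :: "'a \<Rightarrow> complex" and S :: "'a set"
  assumes "sigma_finite_measure \<mu>"
    and "kernel_1inf \<mu> K h"
    and "d \<in> Linf \<mu>"
    and "S \<in> sets \<mu>"
    and "structural_A_quasi_B \<mu> K h S"
  shows "spectrum_L1 \<mu> (kernel_operator \<mu> d K) - Sigma_d \<mu> d S \<subseteq> reduced_spectrum \<mu> d K S \<and>
         (\<forall>\<zeta>. \<zeta> \<notin> Sigma_d \<mu> d S \<longrightarrow>
           (eigenvalue_L1 \<mu> (kernel_operator \<mu> d K) \<zeta> \<longleftrightarrow>
            eigenvalue_L1 (restrict_space \<mu> S) (reduced_operator \<mu> d K S \<zeta>) \<zeta>)) \<and>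
         (\<forall>\<zeta> u. \<zeta> \<notin> Sigma_d \<mu> d S \<longrightarrow>
           eigenfunction_L1 \<mu> (kernel_operator \<mu> d K) \<zeta> u \<longrightarrow>
           eigenfunction_L1 (restrict_space \<mu> S) (reduced_operator \<mu> d K S \<zeta>) \<zeta> (restrict u S)) \<and>
         (\<forall>Kn hn \<zeta> v. B_approximation \<mu> h S Kn hn \<longrightarrow> \<zeta> \<notin> Sigma_d \<mu> d S \<longrightarrow>
           eigenfunction_L1 (restrict_space \<mu> S) (reduced_operator \<mu> d K S \<zeta>) \<zeta> v \<longrightarrow>
           eigenfunction_L1 \<mu> (kernel_operator \<mu> d K) \<zeta> (limit_reconstruction \<mu> d Kn S \<zeta> v))"
proof -
  interpret sigma_finite_measure \<mu> by fact
  obtain Kn0 hn0 where approx0: "B_approximation \<mu> h S Kn0 hn0"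
    using assms(5) unfolding structural_A_quasi_B_def by blast
  have red: "\<exists>W b Q. reduction \<mu> h (off_weight \<mu> d S \<zeta>) W b Q K d S \<zeta>" if "\<zeta> \<notin> Sigma_d \<mu> d S" for \<zeta>
    by (rule reduction_exists[OF assms(1-4) approx0 that])
  have spec: "\<zeta> \<in> reduced_spectrum \<mu> d K S"
    if z: "\<zeta> \<in> spectrum_L1 \<mu> (kernel_operator \<mu> d K)" "\<zeta> \<notin> Sigma_d \<mu> d S" for \<zeta>
  proof -
    obtain W b Q where "reduction \<mu> h (off_weight \<mu> d S \<zeta>) W b Q K d S \<zeta>"
      using red[OF z(2)] by blast
    then interpret reduction \<mu> h "off_weight \<mu> d S \<zeta>" W b Q K d S \<zeta> .
    have "\<not> invertible_L1 \<mu> (\<lambda>f x. full_op f x - \<zeta> * f x)"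
      using z(1) by (simp add: spectrum_L1_def)
    then have "\<not> invertible_L1 M_S (\<lambda>f x. red_op f x - \<zeta> * f x)"
      using full_invertible by blast
    then show ?thesis
      using z(2) by (simp add: reduced_spectrum_def)
  qed
  have eig_restrict: "eigenfunction_L1 (restrict_space \<mu> S) (reduced_operator \<mu> d K S \<zeta>) \<zeta> (restrict u S)"
    if z: "\<zeta> \<notin> Sigma_d \<mu> d S" "eigenfunction_L1 \<mu> (kernel_operator \<mu> d K) \<zeta> u" for \<zeta> u
  proof -
    obtain W b Q where "reduction \<mu> h (off_weight \<mu> d S \<zeta>) W b Q K d S \<zeta>"
      using red[OF z(1)] by blast
    then interpret reduction \<mu> h "off_weight \<mu> d S \<zeta>" W b Q K d S \<zeta> .
    show ?thesis
      by (rule eigenfunction_restrict[OF z(2)]) simp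
  qed
  have eig_recon: "eigenfunction_L1 \<mu> (kernel_operator \<mu> d K) \<zeta> (limit_reconstruction \<mu> d Kn S \<zeta> v)"
    if approx: "B_approximation \<mu> h S Kn hn" and z: "\<zeta> \<notin> Sigma_d \<mu> d S"
      and v: "eigenfunction_L1 (restrict_space \<mu> S) (reduced_operator \<mu> d K S \<zeta>) \<zeta> v" for Kn hn \<zeta> v
  proof -
    let ?q = "off_weight \<mu> d S \<zeta>"
    obtain W b Q where "reduction \<mu> h ?q W b Q K d S \<zeta>"
      using red[OF z] by blast
    then interpret reduction \<mu> h ?q W b Q K d S \<zeta> .
    define p where "p = zero_ext S v"
    have p: "integrable \<mu> p"
      using v S by (simp add: p_def eigenfunction_L1_def L1_restrict_iff)
    define wn where "wn n = reconstruction \<mu> d (Kn n) S \<zeta> v" for n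
    have kn: "kernel_1inf \<mu> (Kn n) (hn n)" "structural_B \<mu> (Kn n) (hn n) S" for n
      using approx by (simp_all add: B_approximation_def)
    have wn: "integrable \<mu> (wn n) \<and> (AE x in \<mu>. wn n x = p x + ?q x * int_op \<mu> (hn n) (wn n) x)" for n
    proof -
      \<comment> \<open>A type B kernel is approximated by the constant sequence of itself, so the
        resolvent construction applies to \<open>Kn n\<close> with a weight of its own. That weight
        serves only to identify the reconstruction with the solution for
        \<open>hn n\<close>.\<close>
      have "norm_1inf \<mu> (\<lambda>x y. hn n x y - hn n x y) = 0"
        unfolding norm_1inf_def by (rule antisym, rule SUP_least) simp_all
      then have "B_approximation \<mu> (hn n) S (\<lambda>_. Kn n) (\<lambda>_. hn n)"
        using kn by (simp add: B_approximation_def)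
      from reduction_exists[OF assms(1) kn(1) assms(3,4) this z]
      obtain W' b' Q' where "reduction \<mu> (hn n) ?q W' b' Q' (Kn n) d S \<zeta>"
        by blast
      then interpret B: reduction \<mu> "hn n" ?q W' b' Q' "Kn n" d S \<zeta> .
      note rec = B.reconstruction_sol[OF kn(2) p[unfolded p_def], folded p_def wn_def]
      have "AE x in \<mu>. wn n x = p x + ?q x * int_op \<mu> (hn n) (wn n) x"
        using rec(2) B.sol_eq[OF p] AE_space
      proof eventually_elim
        case (elim x)
        have "int_op \<mu> (hn n) (wn n) x = int_op \<mu> (hn n) (B.sol p) x"
          using elim(3) rec B.sol_integrable[OF p] by (intro int_op_cong_AE) auto
        with elim show ?case by simp
      qed
      with rec(1) show ?thesis by blast
    qed
    have lim: "(\<lambda>n. norm_L1 \<mu> (\<lambda>x. wn n x - sol p x)) \<longlonglongrightarrow> 0"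
    proof (rule perturbation_limit[OF _ _ p])
      show "hn n \<in> L1inf \<mu>" for n
        by (rule kernel_1infD(1)[OF kn(1)])
      show "(\<lambda>n. norm_1inf \<mu> (\<lambda>x y. h x y - hn n x y)) \<longlonglongrightarrow> 0"
        using approx by (simp add: B_approximation_def)
    qed (rule conjunct1[OF wn], rule conjunct2[OF wn])
    have u: "integrable \<mu> (sol p)" by (rule sol_integrable[OF p])
    \<comment> \<open>The limit reconstruction is a \<open>SOME\<close>. That \<open>sol p\<close>
      is a limit shows the choice to be meaningful, and the triangle inequality shows the chosen
      limit to agree with \<open>sol p\<close> almost everywhere.\<close>
    define P where "P u \<longleftrightarrow> u \<in> L1 \<mu> \<and> (\<forall>n. wn n \<in> L1 \<mu>) \<and> (\<lambda>n. norm_L1 \<mu> (\<lambda>x. wn n x - u x)) \<longlonglongrightarrow> 0" for u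
    have "P (sol p)"
      using u wn lim by (simp add: P_def L1_def)
    then have "P (SOME u. P u)"
      by (rule someI[of P])
    moreover define u' where "u' = limit_reconstruction \<mu> d Kn S \<zeta> v"
    have "u' = (SOME u. P u)"
      unfolding u'_def limit_reconstruction_def P_def[abs_def] wn_def ..
    ultimately have "P u'"
      by (simp only:)
    then have iu: "integrable \<mu> u'" and lim': "(\<lambda>n. norm_L1 \<mu> (\<lambda>x. wn n x - u' x)) \<longlonglongrightarrow> 0"
      by (auto simp: P_def L1_def)
    have "norm_L1 \<mu> (\<lambda>x. u' x - sol p x) \<le> 0"
    proof (rule tendsto_lowerbound)
      show "(\<lambda>n. norm_L1 \<mu> (\<lambda>x. wn n x - sol p x) + norm_L1 \<mu> (\<lambda>x. wn n x - u' x)) \<longlonglongrightarrow> 0"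
        using tendsto_add[OF lim lim'] by simp
      show "\<forall>\<^sub>F n in sequentially. norm_L1 \<mu> (\<lambda>x. u' x - sol p x)
          \<le> norm_L1 \<mu> (\<lambda>x. wn n x - sol p x) + norm_L1 \<mu> (\<lambda>x. wn n x - u' x)"
      proof (rule always_eventually, rule allI)
        fix n
        have "norm_L1 \<mu> (\<lambda>x. u' x - sol p x) \<le> norm_L1 \<mu> (\<lambda>x. wn n x - sol p x) + norm_L1 \<mu> (\<lambda>x. u' x - wn n x)"
          using norm_L1_add[of \<mu> "\<lambda>x. wn n x - sol p x" "\<lambda>x. u' x - wn n x"] wn[of n] u iu by simp
        then show "norm_L1 \<mu> (\<lambda>x. u' x - sol p x)
            \<le> norm_L1 \<mu> (\<lambda>x. wn n x - sol p x) + norm_L1 \<mu> (\<lambda>x. wn n x - u' x)"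
          by (simp add: norm_L1_def norm_minus_commute)
      qed
    qed simp
    then have "norm_L1 \<mu> (\<lambda>x. u' x - sol p x) = 0"
      using norm_L1_nonneg[of \<mu> "\<lambda>x. u' x - sol p x"] by simp
    then have "AE x in \<mu>. u' x - sol p x = 0"
      using iu u by (intro norm_L1_eq_0) auto
    then have "AE x in \<mu>. u' x = sol p x"
      by eventually_elim simp
    then show ?thesis
      using eigenfunction_sol[OF v iu] by (simp add: p_def u'_def)
  qed
  \<comment> \<open>The backward implication needs some eigenfunction only, so a reconstruction
    along one fixed approximating sequence suffices.\<close>
  have eig_iff: "eigenvalue_L1 \<mu> (kernel_operator \<mu> d K) \<zeta> \<longleftrightarrow>
      eigenvalue_L1 (restrict_space \<mu> S) (reduced_operator \<mu> d K S \<zeta>) \<zeta>" if "\<zeta> \<notin> Sigma_d \<mu> d S" for \<zeta>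
    unfolding eigenvalue_L1_def by (intro iffI; elim exE; rule exI, (rule eig_restrict[OF that] | rule eig_recon[OF approx0 that]), assumption)
  show ?thesis
    by (intro conjI allI impI subsetI; (elim DiffE)?) (rule spec eig_iff eig_restrict eig_recon; assumption)+
qed

end
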